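(* Let $\varepsilon\in(0,1)$ and let $(x_i)_{i=1}^n$ be chosen uniformly at random from $\mathcal{F}_{d,n}^{\varepsilon}$ (i.e. according to the probability measure $\nu$). Then the bound $$\inf_{(y_i)_{i=1}^n\in\mathcal{F}_{d,n}}\ d\big((x_i)_{i=1}^n,(y_i)_{i=1}^n\big)^2\ \le\ (\sqrt{20}+\sqrt{2})^2\,\varepsilon^2 d$$ holds with probability at least $$1-\frac{2d\exp\left(-\frac{n\varepsilon^4}{2d^3}\right)}{1-2d\exp\left(-\frac{6\varepsilon^2n}{5(d+2)^2}\right)}.$$
   Context: A frame is a finite sequence $(x_i)_{i=1}^n$ of vectors spanning $\mathbb{R}^d$; its frame operator is $S=\sum_{i=1}^n x_ix_i^*$. The frame is $\varepsilon$-nearly Parseval if $\|S-I_d\|_{\mathrm{op}}\le\varepsilon$ (operator norm), and $\varepsilon$-nearly equal-norm if $(1-\varepsilon)\frac dn\le\|x_i\|^2\le(1+\varepsilon)\frac dn$ for all $i$. $\mathcal{F}_{d,n}^{\varepsilon}$ is the set of frames of $n$ vectors in $\mathbb{R}^d$ that are both $\varepsilon$-nearly equal-norm and $\varepsilon$-nearly Parseval; $\mathcal{F}_{d,n}$ is the set of exactly equal-norm Parseval frames, i.e. $S=I_d$ and $\|x_i\|^2=d/n$ for all $i$. The distance is $d\big((x_i)_{i=1}^n,(y_i)_{i=1}^n\big)=\left(\sum_{i=1}^n\|x_i-y_i\|^2\right)^{1/2}$. Uniform measure on $\mathcal{F}_{d,n}^\varepsilon$: let $\mathcal{S}^d_\varepsilon=\{v\in\mathbb{R}^d:(1-\varepsilon)\frac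 dn\le\|v\|^2\le(1+\varepsilon)\frac dn\}$, let $\mu$ be the uniform probability measure on $\mathcal{S}^d_\varepsilon$, and let $\nu(\cdot)=\mu^{\otimes n}(\,\cdot\mid\mathcal{F}_{d,n}^\varepsilon)$ be the product measure on $(\mathcal{S}^d_\varepsilon)^n$ conditioned on $\mathcal{F}_{d,n}^\varepsilon\subset(\mathcal{S}^d_\varepsilon)^n$ (which has positive $\mu^{\otimes n}$-measure).
   Formalization: The formal theorem assumes that the denominator 1−2d·exp(−6ε²n/(5(d+2)²)) is positive; when it is negative the claimed lower bound exceeds 1 (e.g. d=n=1, ε=1/2), and when it is zero the bound is undefined. *)

theory Defs
  imports "HOL-Probability.Probability"
begin

text \<open>
  A sequence \<open>x\<^sub>1, \<dots>, x\<^sub>n\<close> of vectors in \<open>\<real>\<^sup>d\<close> is a function \<open>x :: nat \<Rightarrow> real^'d\<close> indexed by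
  \<open>{..<n}\<close>, with \<open>d = CARD('d)\<close>. It is required to be extensional, i.e. \<open>undefined\<close> outside
  \<open>{..<n}\<close>, so that sets of sequences are subsets of the space of the product measure \<open>\<Pi>\<^sub>M\<close>.
\<close>

definition frames :: "nat \<Rightarrow> (nat \<Rightarrow> real^'d) set" where
  "frames n = {x \<in> extensional {..<n}. span (x ` {..<n}) = UNIV}"

text \<open>The summands are the matrices \<open>x\<^sub>i x\<^sub>i\<^sup>*\<close>.\<close>

definition frame_operator :: "nat \<Rightarrow> (nat \<Rightarrow> real^'d) \<Rightarrow> real^'d^'d" where
  "frame_operator n x = (\<Sum>i<n. (columnvector (x i) :: real^1^'d) ** (rowvector (x i) :: real^'d^1))"

definition nearly_parseval :: "real \<Rightarrow> nat \<Rightarrow> (nat \<Rightarrow> real^'d) \<Rightarrow> bool" where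
  "nearly_parseval \<epsilon> n x \<longleftrightarrow> onorm ((*v) (frame_operator n x - mat 1)) \<le> \<epsilon>"

definition shell :: "real \<Rightarrow> nat \<Rightarrow> (real^'d) set" where
  "shell \<epsilon> n = {v. (1 - \<epsilon>) * (real CARD('d) / real n) \<le> (norm v)\<^sup>2 \<and>
                   (norm v)\<^sup>2 \<le> (1 + \<epsilon>) * (real CARD('d) / real n)}"

definition nearly_equal_norm :: "real \<Rightarrow> nat \<Rightarrow> (nat \<Rightarrow> real^'d) \<Rightarrow> bool" where
  "nearly_equal_norm \<epsilon> n x \<longleftrightarrow> (\<forall>i<n. x i \<in> shell \<epsilon> n)"

definition nearly_ENP_frames :: "real \<Rightarrow> nat \<Rightarrow> (nat \<Rightarrow> real^'d) set" where
  "nearly_ENP_frames \<epsilon> n =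
     {x \<in> frames n. nearly_equal_norm \<epsilon> n x \<and> nearly_parseval \<epsilon> n x}"

definition ENP_frames :: "nat \<Rightarrow> (nat \<Rightarrow> real^'d) set" where
  "ENP_frames n = {x \<in> frames n. frame_operator n x = mat 1 \<and>
                     (\<forall>i<n. (norm (x i))\<^sup>2 = real CARD('d) / real n)}"

definition frame_dist :: "nat \<Rightarrow> (nat \<Rightarrow> real^'d) \<Rightarrow> (nat \<Rightarrow> real^'d) \<Rightarrow> real" where
  "frame_dist n x y = sqrt (\<Sum>i<n. (norm (x i - y i))\<^sup>2)"

definition shell_measure :: "real \<Rightarrow> nat \<Rightarrow> (real^'d) measure" where
  "shell_measure \<epsilon> n = uniform_measure lborel (shell \<epsilon> n)"

text \<open>
  \<open>uniform_measure M A\<close> assigns \<open>M (A \<inter> B) / M A\<close> to \<open>B\<close>, so here it is the product measure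
  conditioned on \<open>nearly_ENP_frames \<epsilon> n\<close>.
\<close>

definition nearly_ENP_measure :: "real \<Rightarrow> nat \<Rightarrow> (nat \<Rightarrow> real^'d) measure" where
  "nearly_ENP_measure \<epsilon> n =
     uniform_measure (\<Pi>\<^sub>M i\<in>{..<n}. shell_measure \<epsilon> n) (nearly_ENP_frames \<epsilon> n)"

end

(*
  Write S for the frame operator of x and u_i = x_i / |x_i|. Normalising the lengths moves x by at
  most eps sqrt d. If the frame operator of sqrt (d/n) u is within 10 eps^2 / sqrt d of the
  identity in the Frobenius norm, then moving u to radial isotropic position costs at most
  sqrt 20 eps sqrt d: by Forster there is a positive matrix B such that the B u_i / |B u_i| form a
  tight frame (a minimiser of prod |B u_i|^(2d) / det B^(2n)), and by Hamilton and Moitra B only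
  shifts spectral mass towards its large eigenvalues, so that the total displacement is controlled
  by the distance of the frame operator from the identity.

  The exceptional event is exponentially unlikely by a dimension-free Hoeffding inequality in the
  Hilbert space of matrices. The bound of the theorem is trivial unless n eps^4 > 2 d^3 ln (2d);
  in that regime the set of nearly equal-norm Parseval frames has probability at least 1/8 (by a
  matrix Chernoff bound for the largest eigenvalue of S and Chebyshev's inequality for the smallest
  one), and the constants leave enough room for the loss of a factor 8. This replaces the
  denominator of the stated bound, which is only used to be at most 1.
*)
theory Submission
  imports Defs
begin

section \<open>Spectral theorem for self-adjoint operators\<close>

text \<open>The shell is not centred: volume favours its outer part, so for d >= 2 the mean of S is
  m times the identity with 1 <= m <= 1 + \<epsilon> - 4 \<epsilon> / (d + 2). Below, S has the full
  margin \<epsilon>, and Chebyshev's inequality is affordable. Above, the guaranteed margin shrinks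
  like 1 / d, and a variance bound would grow with d in the relevant regime; hence the exponential
  bound there. It is obtained without matrix exponentials: all summands have rank one, so a
  Golden-Thompson inequality can be proved coefficient by coefficient for truncated power series.
  Constants: put E = n \<epsilon>^4 / (2 d^3). The squared displacement is at most 2 d sqrt d times
  the deviation, so the threshold 10 \<epsilon>^2 / sqrt d yields 20 \<epsilon>^2 d, and it makes
  the Hoeffding exponent 25 E; the surplus 24 E pays for the conditioning. In sqrt 20 + sqrt 2,
  length normalisation uses 1 of the second term, and sqrt 2 - 1 pays for a small perturbation into
  general position, without which the minimiser need not exist.\<close>

definition orthonormal_basis :: "(nat \<Rightarrow> 'a::euclidean_space) \<Rightarrow> bool" where
  "orthonormal_basis q \<longleftrightarrow> (\<forall>i<DIM('a). \<forall>j<DIM('a). q i \<bullet> q j = (if i = j then 1 else 0))"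

lemma orthonormal_basis_expansion:
  fixes q :: "nat \<Rightarrow> 'a::euclidean_space"
  assumes "orthonormal_basis q"
  shows "x = (\<Sum>i<DIM('a). (x \<bullet> q i) *\<^sub>R q i)"
proof -
  let ?B = "q ` {..<DIM('a)}"
  have dot: "q i \<bullet> q j = (if i = j then 1 else 0)" if "i < DIM('a)" "j < DIM('a)" for i j
    using assms that by (auto simp: orthonormal_basis_def)
  have inj: "inj_on q {..<DIM('a)}"
    by (rule inj_onI) (metis dot lessThan_iff zero_neq_one)
  have orth: "pairwise orthogonal ?B"
    by (auto simp: pairwise_def orthogonal_def dot)
  have nz: "0 \<notin> ?B"
    using dot by fastforce
  have "independent ?B"
    using orth nz by (rule pairwise_orthogonal_independent)
  moreover have "card ?B = DIM('a)"
    using inj by (simp add: card_image)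
  ultimately have "span ?B = UNIV"
    by (metis card_eq_dim dim_UNIV finite_imageI finite_lessThan order_refl subset_UNIV top.extremum_uniqueI)
  hence "(\<Sum>b\<in>?B. (x \<bullet> b) *\<^sub>R b) = x"
    by (intro orthonormal_basis_expand) (use orth dot in \<open>auto simp: norm_eq_1\<close>)
  then show ?thesis
    by (simp add: sum.reindex[OF inj])
qed

lemma orthonormal_basis_inner:
  fixes q :: "nat \<Rightarrow> 'a::euclidean_space"
  assumes "orthonormal_basis q"
  shows "x \<bullet> y = (\<Sum>i<DIM('a). (x \<bullet> q i) * (y \<bullet> q i))"
  by (subst orthonormal_basis_expansion[OF assms, of y])
     (simp add: inner_sum_right mult.commute)

lemma orthonormal_basis_norm_sq:
  fixes q :: "nat \<Rightarrow> 'a::euclidean_space"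
  assumes "orthonormal_basis q"
  shows "(norm x)\<^sup>2 = (\<Sum>i<DIM('a). (x \<bullet> q i)\<^sup>2)"
  using orthonormal_basis_inner[OF assms, of x x] by (simp add: dot_square_norm power2_eq_square)

text \<open>Rayleigh quotient argument: take a maximiser v on the unit sphere of V. The residual w =
  f v - l v lies in V because V is invariant, so v may be varied in direction w, and the first-order
  gain forces w = 0. The bound on all of V is exported because it will order the
  eigenvalues.\<close>

lemma self_adjoint_max_eigenvector:
  fixes f :: "'a::euclidean_space \<Rightarrow> 'a"
  assumes "linear f" and sa: "\<And>x y. f x \<bullet> y = x \<bullet> f y"
    and V: "subspace V" "f ` V \<subseteq> V" and "z \<in> V" "z \<noteq> 0"
  shows "\<exists>v l. v \<in> V \<and> norm v = 1 \<and> f v = l *\<^sub>R v \<and> (\<forall>x\<in>V. f x \<bullet> x \<le> l * (x \<bullet> x))"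
proof -
  interpret f: linear f by fact
  let ?K = "sphere 0 1 \<inter> V"
  have "compact ?K"
    using V(1) by (intro compact_Int_closed) (auto simp: closed_subspace)
  moreover have "(1 / norm z) *\<^sub>R z \<in> ?K"
    using \<open>z \<in> V\<close> \<open>z \<noteq> 0\<close> V(1) by (auto simp: subspace_scale)
  moreover have "continuous_on ?K (\<lambda>x. f x \<bullet> x)"
    by (intro continuous_intros linear_continuous_on f.linear_axioms linear_conv_bounded_linear[THEN iffD1])
  ultimately obtain v where v: "v \<in> ?K" "\<And>x. x \<in> ?K \<Longrightarrow> f x \<bullet> x \<le> f v \<bullet> v"
    using continuous_attains_sup[of ?K "\<lambda>x. f x \<bullet> x"] by (metis empty_iff)
  define l where "l = f v \<bullet> v"
  have vv: "v \<bullet> v = 1" "v \<in> V" "norm v = 1"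
    using v(1) by (auto simp: dot_square_norm)
  have max: "f x \<bullet> x \<le> l * (x \<bullet> x)" if "x \<in> V" for x
  proof (cases "x = 0")
    case True
    then show ?thesis by (simp add: f.zero)
  next
    case False
    have "(1 / norm x) *\<^sub>R x \<in> ?K"
      using False that V(1) by (auto simp: subspace_scale)
    from v(2)[OF this] have "(f x \<bullet> x) / (norm x)\<^sup>2 \<le> l"
      by (simp add: f.scale l_def power2_eq_square)
    then show ?thesis
      using False by (simp add: dot_square_norm divide_le_eq)
  qed
  define w where "w = f v - l *\<^sub>R v"
  have wV: "w \<in> V"
    using V vv(2) by (auto simp: w_def intro!: subspace_diff subspace_scale)
  define C where "C = l * (w \<bullet> w) - f w \<bullet> w"
  have C: "C \<ge> 0"
    using max[OF wV] by (simp add: C_def)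
  \<comment> \<open>Maximality tested at v + t w: the terms of order zero cancel, and those linear
    in t add up to 2 t |w|^2.\<close>
  have quad: "2 * t * (w \<bullet> w) \<le> t\<^sup>2 * C" for t
  proof -
    have "v + t *\<^sub>R w \<in> V"
      using V(1) vv(2) wV by (auto intro!: subspace_add subspace_scale)
    from max[OF this] have
      "l + 2 * t * (f v \<bullet> w) + t\<^sup>2 * (f w \<bullet> w) \<le> l * (1 + 2 * t * (v \<bullet> w) + t\<^sup>2 * (w \<bullet> w))"
      using sa[of w v] vv(1) unfolding l_def
      by (simp add: f.add f.scale inner_add_left inner_add_right inner_commute power2_eq_square algebra_simps)
    moreover have "f v \<bullet> w = w \<bullet> w + l * (v \<bullet> w)"
      by (subst (2) w_def) (simp add: inner_diff_left)
    ultimately show ?thesis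
      by (simp add: C_def algebra_simps)
  qed
  have "w \<bullet> w = 0"
  proof (rule ccontr)
    assume "w \<bullet> w \<noteq> 0"
    hence pos: "w \<bullet> w > 0" by simp
    \<comment> \<open>This t is small enough for the linear term to win; C + 1 stays positive when C
      = 0.\<close>
    have "2 * (w \<bullet> w / (C + 1)) * (w \<bullet> w) \<le> (w \<bullet> w / (C + 1))\<^sup>2 * C"
      by (rule quad)
    also have "\<dots> = (w \<bullet> w) * (w \<bullet> w) / (C + 1) * (C / (C + 1))"
      by (simp add: power2_eq_square)
    also have "\<dots> \<le> (w \<bullet> w) * (w \<bullet> w) / (C + 1) * 1"
      using C pos by (intro mult_left_mono) auto
    finally have "2 * ((w \<bullet> w) * (w \<bullet> w) / (C + 1)) \<le> (w \<bullet> w) * (w \<bullet> w) / (C + 1)"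
      by simp
    moreover have "(w \<bullet> w) * (w \<bullet> w) / (C + 1) > 0"
      using C pos by simp
    ultimately show False by linarith
  qed
  hence "f v = l *\<^sub>R v" by (simp add: w_def)
  with vv max show ?thesis by blast
qed

text \<open>Greedy construction: each new eigenvector maximises the quadratic form on the orthogonal
  complement of the earlier ones, which f preserves by self-adjointness. The last clause of
  \<open>good\<close>, comparing f on the complement with every earlier eigenvalue, keeps the
  eigenvalues sorted. The order matters later, where prefix sums along it are taken.\<close>

lemma self_adjoint_eigenbasis:
  fixes f :: "'a::euclidean_space \<Rightarrow> 'a"
  assumes "linear f" and sa: "\<And>x y. f x \<bullet> y = x \<bullet> f y"
  obtains q :: "nat \<Rightarrow> 'a" and l :: "nat \<Rightarrow> real"
  where "orthonormal_basis q" and "\<And>i. i < DIM('a) \<Longrightarrow> f (q i) = l i *\<^sub>R q i"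
    and "\<And>i j. i \<le> j \<Longrightarrow> j < DIM('a) \<Longrightarrow> l j \<le> l i"
proof -
  interpret f: linear f by fact
  define good where "good k q l \<longleftrightarrow>
      (\<forall>i<k. \<forall>j<k. (q i :: 'a) \<bullet> q j = (if i = j then 1 else 0)) \<and>
      (\<forall>i<k. f (q i) = (l i :: real) *\<^sub>R q i) \<and>
      (\<forall>j<k. \<forall>i\<le>j. l j \<le> l i) \<and>
      (\<forall>x. (\<forall>i<k. x \<bullet> q i = 0) \<longrightarrow> (\<forall>i<k. f x \<bullet> x \<le> l i * (x \<bullet> x)))" for k :: nat and q l
  have "\<exists>q l. good k q l" if "k \<le> DIM('a)" for k
    using that
  proof (induction k)
    case 0
    show ?case by (simp add: good_def)
  next
    case (Suc k)
    then obtain q l where g: "good k q l" by auto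
    let ?V = "{x. \<forall>i<k. x \<bullet> q i = 0}"
    have "subspace ?V"
      by (auto simp: subspace_def inner_add_left)
    have "f ` ?V \<subseteq> ?V"
      using g by (auto simp: good_def sa)
    have "dim (q ` {..<k}) \<le> card (q ` {..<k})"
      by (rule dim_le_card') simp
    also have "\<dots> \<le> k"
      using card_image_le[of "{..<k}" q] by simp
    finally have "dim (q ` {..<k}) < DIM('a)"
      using Suc.prems by simp
    then obtain z where z: "z \<noteq> 0" "\<And>y. y \<in> span (q ` {..<k}) \<Longrightarrow> orthogonal z y"
      using orthogonal_to_subspace_exists by blast
    have "z \<in> ?V"
      using z(2) by (auto simp: orthogonal_def span_base)
    from self_adjoint_max_eigenvector[OF assms \<open>subspace ?V\<close> \<open>f ` ?V \<subseteq> ?V\<close> this z(1)]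
    obtain v m where v: "v \<in> ?V" "norm v = 1" "f v = m *\<^sub>R v" "\<And>x. x \<in> ?V \<Longrightarrow> f x \<bullet> x \<le> m * (x \<bullet> x)"
      by blast
    have vv: "v \<bullet> v = 1"
      using v(2) by (simp add: dot_square_norm)
    have ml: "m \<le> l i" if "i < k" for i
      using g v(1,3) that vv by (auto simp: good_def dest!: spec[of _ v])
    have "good (Suc k) (q(k := v)) (l(k := m))"
      unfolding good_def
    proof (intro conjI allI impI)
      fix i j assume "i < Suc k" "j < Suc k"
      then show "(q(k := v)) i \<bullet> (q(k := v)) j = (if i = j then 1 else 0)"
        using g v(1) vv by (auto simp: good_def less_Suc_eq inner_commute)
    next
      fix i assume "i < Suc k"
      then show "f ((q(k := v)) i) = (l(k := m)) i *\<^sub>R (q(k := v)) i"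
        using g v(3) by (auto simp: good_def less_Suc_eq)
    next
      fix j i assume "j < Suc k" "i \<le> j"
      then show "(l(k := m)) j \<le> (l(k := m)) i"
        using g ml by (auto simp: good_def less_Suc_eq)
    next
      fix x i assume x: "\<forall>i<Suc k. x \<bullet> (q(k := v)) i = 0" and i: "i < Suc k"
      have xV: "x \<in> ?V"
      proof safe
        fix j assume "j < k"
        then show "x \<bullet> q j = 0"
          using spec[OF x, of j] by simp
      qed
      show "f x \<bullet> x \<le> (l(k := m)) i * (x \<bullet> x)"
      proof (cases "i = k")
        case True
        then show ?thesis using v(4)[OF xV] by simp
      next
        case False
        then show ?thesis using g i xV by (auto simp: good_def)
      qed
    qed
    then show ?case by blast
  qed
  from this[of "DIM('a)"] obtain q l where "good DIM('a) q l" by auto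
  then show thesis
    by (intro that[of q l]) (auto simp: good_def orthonormal_basis_def)
qed

definition trace_of :: "('a::euclidean_space \<Rightarrow> 'a) \<Rightarrow> real" where
  "trace_of g = (\<Sum>b\<in>Basis. g b \<bullet> b)"

lemma trace_of_orthonormal_basis:
  fixes g :: "'a::euclidean_space \<Rightarrow> 'a"
  assumes "linear g" "orthonormal_basis q"
  shows "trace_of g = (\<Sum>i<DIM('a). g (q i) \<bullet> q i)"
proof -
  interpret g: linear g by fact
  have "(\<Sum>i<DIM('a). g (q i) \<bullet> q i) = (\<Sum>i<DIM('a). \<Sum>b\<in>Basis. (g (q i) \<bullet> b) * (q i \<bullet> b))"
    by (subst euclidean_inner) simp
  also have "\<dots> = (\<Sum>i<DIM('a). \<Sum>b\<in>Basis. \<Sum>c\<in>Basis. (q i \<bullet> c) * (g c \<bullet> b) * (q i \<bullet> b))"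
    by (subst (2) euclidean_representation[symmetric])
       (simp add: g.sum g.scale inner_sum_left sum_distrib_right)
  also have "\<dots> = (\<Sum>b\<in>Basis. \<Sum>c\<in>Basis. (g c \<bullet> b) * (\<Sum>i<DIM('a). (c \<bullet> q i) * (b \<bullet> q i)))"
    by (subst sum.swap, rule sum.cong[OF refl], subst sum.swap)
       (simp add: sum_distrib_left mult_ac inner_commute)
  also have "\<dots> = (\<Sum>b\<in>Basis. \<Sum>c\<in>Basis. (g c \<bullet> b) * (c \<bullet> b))"
    by (simp add: orthonormal_basis_inner[OF assms(2), symmetric])
  also have "\<dots> = trace_of g"
    unfolding trace_of_def
    by (intro sum.cong refl) (simp add: inner_Basis if_distrib if_distribR sum.delta cong: if_cong)
  finally show ?thesis ..
qed

section \<open>A rank-one Golden-Thompson inequality\<close>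

definition psd_op :: "('a::euclidean_space \<Rightarrow> 'a) \<Rightarrow> bool" where
  "psd_op S \<longleftrightarrow> linear S \<and> (\<forall>x y. S x \<bullet> y = x \<bullet> S y) \<and> (\<forall>x. 0 \<le> S x \<bullet> x)"

lemma linear_funpow:
  fixes S :: "'a::real_vector \<Rightarrow> 'a"
  assumes "linear S" shows "linear (S ^^ k)"
proof (induction k)
  case 0
  show ?case by (simp add: linear_iff)
next
  case (Suc k)
  then show ?case using linear_compose[OF Suc assms] by (simp add: o_def)
qed

lemma funpow_self_adjoint:
  fixes S :: "'a::real_inner \<Rightarrow> 'a"
  assumes "\<And>x y. S x \<bullet> y = x \<bullet> S y"
  shows "(S ^^ k) x \<bullet> y = x \<bullet> (S ^^ k) y"
proof (induction k arbitrary: y)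
  case 0
  show ?case by simp
next
  case (Suc k)
  have "(S ^^ Suc k) x \<bullet> y = x \<bullet> (S ^^ k) (S y)"
    by (simp add: assms Suc)
  then show ?case by (simp add: funpow_swap1)
qed

text \<open>The last conclusion turns quadratic forms of all powers of S into moments of one
  nonnegative measure on the eigenvalues, with weights
  \<open>(x \<bullet> q i)\<^sup>2\<close>.\<close>

lemma psd_op_eigenbasis:
  fixes S :: "'a::euclidean_space \<Rightarrow> 'a"
  assumes "psd_op S"
  obtains q :: "nat \<Rightarrow> 'a" and l :: "nat \<Rightarrow> real"
  where "orthonormal_basis q" and "\<And>i. i < DIM('a) \<Longrightarrow> S (q i) = l i *\<^sub>R q i"
    and "\<And>i j. i \<le> j \<Longrightarrow> j < DIM('a) \<Longrightarrow> l j \<le> l i"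
    and "\<And>i. i < DIM('a) \<Longrightarrow> 0 \<le> l i"
    and "\<And>k x. (S ^^ k) x \<bullet> x = (\<Sum>i<DIM('a). l i ^ k * (x \<bullet> q i)\<^sup>2)"
proof -
  have lin: "linear S" and sa: "\<And>x y. S x \<bullet> y = x \<bullet> S y" and psd: "\<And>x. 0 \<le> S x \<bullet> x"
    using assms by (auto simp: psd_op_def)
  obtain q l where q: "orthonormal_basis q" "\<And>i. i < DIM('a) \<Longrightarrow> S (q i) = l i *\<^sub>R q i"
    "\<And>i j. i \<le> j \<Longrightarrow> j < DIM('a) \<Longrightarrow> l j \<le> l i"
    using self_adjoint_eigenbasis[OF lin sa] by blast
  have "0 \<le> l i" if "i < DIM('a)" for i
    using psd[of "q i"] q(1,2) that by (simp add: orthonormal_basis_def)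
  moreover have pow: "(S ^^ k) (q i) = l i ^ k *\<^sub>R q i" if "i < DIM('a)" for i k
    using that lin by (induction k) (simp_all add: q(2) linear_scale)
  have "(S ^^ k) x \<bullet> x = (\<Sum>i<DIM('a). l i ^ k * (x \<bullet> q i)\<^sup>2)" for k x
    by (subst orthonormal_basis_inner[OF q(1)], rule sum.cong)
       (simp_all add: funpow_self_adjoint[OF sa] pow power2_eq_square)
  ultimately show thesis using that q by blast
qed

lemma trace_of_funpow:
  fixes S :: "'a::euclidean_space \<Rightarrow> 'a"
  assumes "linear S" "orthonormal_basis q" and "\<And>i. i < DIM('a) \<Longrightarrow> S (q i) = l i *\<^sub>R q i"
  shows "trace_of (S ^^ k) = (\<Sum>i<DIM('a). l i ^ k)"
proof -
  have "(S ^^ k) (q i) = l i ^ k *\<^sub>R q i" if "i < DIM('a)" for i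
    using that assms(1) by (induction k) (simp_all add: assms(3) linear_scale)
  then show ?thesis
    using assms by (simp add: trace_of_orthonormal_basis[OF linear_funpow] orthonormal_basis_def)
qed

lemma psd_op_funpow_nonneg:
  assumes "psd_op S" shows "0 \<le> (S ^^ k) x \<bullet> x"
  using psd_op_eigenbasis[OF assms] by (metis (no_types, lifting) lessThan_iff mult_nonneg_nonneg
      sum_nonneg zero_le_power zero_le_power2)

lemma trace_of_funpow_nonneg:
  assumes "psd_op S" shows "0 \<le> trace_of (S ^^ k)"
  unfolding trace_of_def using psd_op_funpow_nonneg[OF assms] by (simp add: sum_nonneg)

text \<open>Chebyshev's correlation inequality: \<open>l i ^ a\<close> and \<open>l i ^ b\<close>
  increase together on nonnegative eigenvalues, so they are positively correlated under the spectral
  weights of x. The double sum over pairs of eigenvalues expresses this covariance.\<close>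

lemma psd_op_moments:
  fixes S :: "'a::euclidean_space \<Rightarrow> 'a"
  assumes "psd_op S"
  shows "((S ^^ a) x \<bullet> x) * ((S ^^ b) x \<bullet> x) \<le> (x \<bullet> x) * ((S ^^ (a + b)) x \<bullet> x)"
proof -
  obtain q l where q: "\<And>i. i < DIM('a) \<Longrightarrow> 0 \<le> l i"
    "\<And>k x. (S ^^ k) x \<bullet> x = (\<Sum>i<DIM('a). l i ^ k * (x \<bullet> q i)\<^sup>2)"
    using psd_op_eigenbasis[OF assms] by metis
  define w where "w i = (x \<bullet> q i)\<^sup>2" for i
  let ?D = "{..<DIM('a)}"
  have "0 \<le> (\<Sum>i\<in>?D. \<Sum>j\<in>?D. w i * w j * ((l i ^ a - l j ^ a) * (l i ^ b - l j ^ b)))"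
  proof (intro sum_nonneg)
    fix i j assume "i \<in> ?D" "j \<in> ?D"
    then have "0 \<le> l i" "0 \<le> l j" using q(1) by auto
    then have "0 \<le> (l i ^ a - l j ^ a) * (l i ^ b - l j ^ b)"
      by (cases "l i \<le> l j") (simp_all add: mult_nonpos_nonpos power_mono)
    then show "0 \<le> w i * w j * ((l i ^ a - l j ^ a) * (l i ^ b - l j ^ b))"
      by (simp add: w_def)
  qed
  also have "\<dots> = 2 * ((\<Sum>i\<in>?D. w i) * (\<Sum>i\<in>?D. l i ^ (a + b) * w i)
      - (\<Sum>i\<in>?D. l i ^ a * w i) * (\<Sum>i\<in>?D. l i ^ b * w i))"
  proof -
    have "(\<Sum>i\<in>?D. \<Sum>j\<in>?D. w i * w j * ((l i ^ a - l j ^ a) * (l i ^ b - l j ^ b)))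
       = (\<Sum>i\<in>?D. \<Sum>j\<in>?D. w j * (l i ^ (a + b) * w i)) + (\<Sum>i\<in>?D. \<Sum>j\<in>?D. w i * (l j ^ (a + b) * w j))
        - (\<Sum>i\<in>?D. \<Sum>j\<in>?D. (l i ^ a * w i) * (l j ^ b * w j)) - (\<Sum>i\<in>?D. \<Sum>j\<in>?D. (l j ^ a * w j) * (l i ^ b * w i))"
      by (simp add: sum.distrib[symmetric] sum_subtractf[symmetric] power_add algebra_simps)
    also have "(\<Sum>i\<in>?D. \<Sum>j\<in>?D. w j * (l i ^ (a + b) * w i)) = (\<Sum>i\<in>?D. w i) * (\<Sum>i\<in>?D. l i ^ (a + b) * w i)"
      by (subst sum.swap) (simp add: sum_product)
    also have "(\<Sum>i\<in>?D. \<Sum>j\<in>?D. w i * (l j ^ (a + b) * w j)) = (\<Sum>i\<in>?D. w i) * (\<Sum>i\<in>?D. l i ^ (a + b) * w i)"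
      by (simp add: sum_product)
    also have "(\<Sum>i\<in>?D. \<Sum>j\<in>?D. (l i ^ a * w i) * (l j ^ b * w j)) = (\<Sum>i\<in>?D. l i ^ a * w i) * (\<Sum>i\<in>?D. l i ^ b * w i)"
      by (simp add: sum_product)
    also have "(\<Sum>i\<in>?D. \<Sum>j\<in>?D. (l j ^ a * w j) * (l i ^ b * w i)) = (\<Sum>i\<in>?D. l i ^ a * w i) * (\<Sum>i\<in>?D. l i ^ b * w i)"
      by (subst sum.swap) (simp add: sum_product)
    finally show ?thesis by simp
  qed
  finally show ?thesis
    using q(2)[of 0 x] by (simp add: q(2) w_def)
qed

definition rank_one_add :: "('a::real_inner \<Rightarrow> 'a) \<Rightarrow> 'a \<Rightarrow> 'a \<Rightarrow> 'a" where
  "rank_one_add S x y = S y + (x \<bullet> y) *\<^sub>R x"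

lemma rank_one_add_psd_op:
  assumes "psd_op S" shows "psd_op (rank_one_add S x)"
proof -
  have "linear S" using assms by (simp add: psd_op_def)
  then have "linear (rank_one_add S x)"
    by (auto simp: rank_one_add_def linear_iff inner_add_right scaleR_add_left algebra_simps)
  then show ?thesis
    using assms by (auto simp: psd_op_def rank_one_add_def inner_add_left inner_add_right inner_commute)
qed

text \<open>Expanding (S + x x^T)^b, every factor x x^T cuts the word into a product of two moments,
  and \<open>psd_op_moments\<close> fuses them again at the price of |x|^2. So a word with i such
  factors costs |x|^(2 i), and the binomial coefficient counts the words. The exponent a must be
  arbitrary in the induction, since an outermost factor S is absorbed into it.\<close>

lemma psd_op_mixed_moment:
  fixes S :: "'a::euclidean_space \<Rightarrow> 'a"
  assumes S: "psd_op S"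
  shows "(S ^^ a) ((rank_one_add S x ^^ b) x) \<bullet> x
    \<le> (\<Sum>i\<le>b. real (b choose i) * (x \<bullet> x) ^ i * ((S ^^ (a + b - i)) x \<bullet> x))"
proof (induction b arbitrary: a)
  case 0
  show ?case by simp
next
  case (Suc b)
  have lin: "linear (S ^^ a)" for a
    using S by (intro linear_funpow) (simp add: psd_op_def)
  have sa: "(S ^^ a) u \<bullet> v = u \<bullet> (S ^^ a) v" for a u v
    using S by (intro funpow_self_adjoint) (simp add: psd_op_def)
  let ?T = "rank_one_add S x"
  let ?u = "(?T ^^ b) x"
  let ?m = "\<lambda>k. (S ^^ k) x \<bullet> x"
  have "(S ^^ a) ((?T ^^ Suc b) x) \<bullet> x = (S ^^ Suc a) ?u \<bullet> x + (?u \<bullet> x) * ?m a"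
  proof -
    have "(?T ^^ Suc b) x = S ?u + (x \<bullet> ?u) *\<^sub>R x"
      by (simp add: rank_one_add_def)
    moreover have "(S ^^ Suc a) ?u = (S ^^ a) (S ?u)"
      by (simp add: funpow_swap1)
    ultimately show ?thesis
      by (simp only: linear_add[OF lin] linear_scale[OF lin] inner_add_left inner_scaleR_left inner_commute[of x ?u])
  qed
  also have "(S ^^ Suc a) ?u \<bullet> x \<le> (\<Sum>i\<le>b. real (b choose i) * (x \<bullet> x) ^ i * ?m (Suc a + b - i))"
    by (rule Suc.IH)
  also have "(?u \<bullet> x) * ?m a \<le> (\<Sum>i\<le>b. real (b choose i) * (x \<bullet> x) ^ i * ?m (b - i)) * ?m a"
    using Suc.IH[of 0] psd_op_funpow_nonneg[OF S] by (intro mult_right_mono) auto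
  also have "\<dots> \<le> (\<Sum>i\<le>b. real (b choose i) * (x \<bullet> x) ^ Suc i * ?m (a + b - i))"
    unfolding sum_distrib_right
  proof (rule sum_mono)
    fix i assume "i \<in> {..b}"
    then have "?m (b - i) * ?m a \<le> (x \<bullet> x) * ?m (a + b - i)"
      using psd_op_moments[OF S, of "b - i" x a] by (simp add: add.commute)
    then have "real (b choose i) * (x \<bullet> x) ^ i * (?m (b - i) * ?m a)
        \<le> real (b choose i) * (x \<bullet> x) ^ i * ((x \<bullet> x) * ?m (a + b - i))"
      by (rule mult_left_mono) simp
    then show "real (b choose i) * (x \<bullet> x) ^ i * ?m (b - i) * ?m a
        \<le> real (b choose i) * (x \<bullet> x) ^ Suc i * ?m (a + b - i)"
      by (simp add: mult_ac)
  qed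
  \<comment> \<open>Pascal's rule: the outermost factor is S in the first sum and x x^T in the
    second.\<close>
  also have "(\<Sum>i\<le>b. real (b choose i) * (x \<bullet> x) ^ i * ?m (Suc a + b - i))
      + (\<Sum>i\<le>b. real (b choose i) * (x \<bullet> x) ^ Suc i * ?m (a + b - i))
     = (\<Sum>i\<le>Suc b. real (Suc b choose i) * (x \<bullet> x) ^ i * ?m (a + Suc b - i))"
  proof -
    have "(\<Sum>i\<le>Suc b. real (Suc b choose i) * (x \<bullet> x) ^ i * ?m (a + Suc b - i))
       = ?m (a + Suc b) + (\<Sum>i\<le>b. real ((b choose i) + (b choose Suc i)) * (x \<bullet> x) ^ Suc i * ?m (a + b - i))"
      by (subst sum.atMost_Suc_shift) simp
    also have "\<dots> = ?m (a + Suc b) + (\<Sum>i\<le>b. real (b choose Suc i) * (x \<bullet> x) ^ Suc i * ?m (a + b - i))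
        + (\<Sum>i\<le>b. real (b choose i) * (x \<bullet> x) ^ Suc i * ?m (a + b - i))"
      by (simp add: sum.distrib[symmetric] algebra_simps)
    also have "?m (a + Suc b) + (\<Sum>i\<le>b. real (b choose Suc i) * (x \<bullet> x) ^ Suc i * ?m (a + b - i))
        = (\<Sum>i\<le>Suc b. real (b choose i) * (x \<bullet> x) ^ i * ?m (Suc a + b - i))"
      by (subst sum.atMost_Suc_shift) simp
    also have "\<dots> = (\<Sum>i\<le>b. real (b choose i) * (x \<bullet> x) ^ i * ?m (Suc a + b - i))"
      by (simp add: binomial_eq_0)
    finally show ?thesis by simp
  qed
  finally show ?case by simp
qed

lemma funpow_diff_telescope:
  fixes S T :: "'a::real_vector \<Rightarrow> 'a"
  assumes "linear S"
  shows "(T ^^ p) y - (S ^^ p) y = (\<Sum>k<p. (S ^^ (p - Suc k)) (T ((T ^^ k) y) - S ((T ^^ k) y)))"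
proof (induction p)
  case 0
  show ?case by simp
next
  case (Suc p)
  have "(T ^^ Suc p) y - (S ^^ Suc p) y
     = (T ((T ^^ p) y) - S ((T ^^ p) y)) + S ((T ^^ p) y - (S ^^ p) y)"
    by (simp add: linear_diff[OF assms])
  also have "S ((T ^^ p) y - (S ^^ p) y) = (\<Sum>k<p. (S ^^ (Suc p - Suc k)) (T ((T ^^ k) y) - S ((T ^^ k) y)))"
    unfolding Suc.IH by (auto simp: linear_sum[OF assms] Suc_diff_Suc[symmetric] intro!: sum.cong)
  finally show ?case by simp
qed

text \<open>The coefficient form of the Golden-Thompson inequality
  \<open>tr (exp (S + x x\<^sup>*)) \<le> tr (exp S exp (x x\<^sup>*))\<close> for a rank-one summand.\<close>

lemma trace_of_rank_one_add_funpow: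
  fixes S :: "'a::euclidean_space \<Rightarrow> 'a"
  assumes S: "psd_op S"
  shows "trace_of (rank_one_add S x ^^ p)
    \<le> trace_of (S ^^ p) + (\<Sum>i<p. real (p choose Suc i) * (x \<bullet> x) ^ i * ((S ^^ (p - Suc i)) x \<bullet> x))"
proof -
  let ?T = "rank_one_add S x"
  have linS: "linear S" and saS: "\<And>u v. S u \<bullet> v = u \<bullet> S v"
    using S by (auto simp: psd_op_def)
  have saT: "?T u \<bullet> v = u \<bullet> ?T v" for u v
    using rank_one_add_psd_op[OF S] by (auto simp: psd_op_def)
  have "trace_of (?T ^^ p) - trace_of (S ^^ p)
     = (\<Sum>b\<in>Basis. ((?T ^^ p) b - (S ^^ p) b) \<bullet> b)"
    by (simp add: trace_of_def inner_diff_left sum_subtractf)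
  also have "\<dots> = (\<Sum>b\<in>Basis. \<Sum>k<p. ((?T ^^ k) x \<bullet> b) * ((S ^^ (p - Suc k)) x \<bullet> b))"
    unfolding funpow_diff_telescope[OF linS]
    by (simp add: rank_one_add_def linear_scale[OF linear_funpow[OF linS]] inner_sum_left
        funpow_self_adjoint[of "rank_one_add S x", OF saT])
  \<comment> \<open>Since T - S is x x^T, the sum over the basis collapses by Parseval;
    self-adjointness then produces the mixed moment with a = p - 1 - k and b = k.\<close>
  also have "\<dots> = (\<Sum>k<p. (?T ^^ k) x \<bullet> (S ^^ (p - Suc k)) x)"
    by (subst sum.swap) (simp add: euclidean_inner[symmetric])
  also have "\<dots> = (\<Sum>k<p. (S ^^ (p - Suc k)) ((?T ^^ k) x) \<bullet> x)"
    by (simp add: funpow_self_adjoint[OF saS])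
  also have "\<dots> \<le> (\<Sum>k<p. \<Sum>i\<le>k. real (k choose i) * (x \<bullet> x) ^ i * ((S ^^ (p - Suc i)) x \<bullet> x))"
    using psd_op_mixed_moment[OF S] by (intro sum_mono order.trans[OF psd_op_mixed_moment[OF S]]) auto
  also have "\<dots> = (\<Sum>k<p. \<Sum>i<p. real (k choose i) * (x \<bullet> x) ^ i * ((S ^^ (p - Suc i)) x \<bullet> x))"
    by (intro sum.cong sum.mono_neutral_left) (auto simp: binomial_eq_0)
  also have "\<dots> = (\<Sum>i<p. real (\<Sum>k<p. k choose i) * (x \<bullet> x) ^ i * ((S ^^ (p - Suc i)) x \<bullet> x))"
    by (subst sum.swap) (simp add: sum_distrib_right)
  also have "\<dots> = (\<Sum>i<p. real (p choose Suc i) * (x \<bullet> x) ^ i * ((S ^^ (p - Suc i)) x \<bullet> x))"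
  proof (intro sum.cong refl)
    fix i assume "i \<in> {..<p}"
    then obtain p' where p': "p = Suc p'" by (cases p) auto
    \<comment> \<open>Hockey-stick identity; it turns the telescoping sum into the coefficients of
      the exponential series of |x|^2.\<close>
    have "(\<Sum>k<p. k choose i) = p choose Suc i"
      unfolding p' lessThan_Suc_atMost using sum_choose_upper[of i p'] by (simp add: atLeast0AtMost)
    then show "real (\<Sum>k<p. k choose i) * (x \<bullet> x) ^ i * ((S ^^ (p - Suc i)) x \<bullet> x)
       = real (p choose Suc i) * (x \<bullet> x) ^ i * ((S ^^ (p - Suc i)) x \<bullet> x)"
      by simp
  qed
  finally show ?thesis by simp
qed

section \<open>Sums of independent random vectors\<close>

lemma convex_combination_power_le:
  fixes a b p :: real
  assumes "0 \<le> p" "p \<le> 1" "0 \<le> a" "0 \<le> b"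
  shows "(p * a + (1 - p) * b) ^ m \<le> p * a ^ m + (1 - p) * b ^ m"
proof -
  have "convex_on {0..} (\<lambda>x::real. x ^ m)"
    using convex_power_even[of m] convex_power_odd[of m]
    by (cases "even m") (auto intro: convex_on_subset)
  from convex_onD[OF this assms(1,2), of b a] assms(3,4) show ?thesis
    by (simp add: add.commute)
qed

lemma sums_cosh_power2:
  fixes x y :: real
  assumes "x\<^sup>2 = y"
  shows "(\<lambda>m. y ^ m / fact (2 * m)) sums cosh x"
proof -
  have "(\<lambda>m. if even (2 * m) then x ^ (2 * m) /\<^sub>R fact (2 * m) else 0) sums cosh x"
    by (subst sums_mono_reindex[of "\<lambda>m. 2 * m"])
       (auto simp: strict_mono_def elim!: evenE intro: cosh_converges)
  then show ?thesis
    by (simp add: assms[symmetric] power_mult[symmetric] divide_inverse mult.commute)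
qed

text \<open>\<open>cosh \<circ> sqrt\<close> is convex, its power series having nonnegative coefficients.\<close>

lemma cosh_le_convex_combination:
  fixes p r u v :: real
  assumes "0 \<le> p" "p \<le> 1" "r\<^sup>2 = p * u\<^sup>2 + (1 - p) * v\<^sup>2"
  shows "cosh r \<le> p * cosh u + (1 - p) * cosh v"
proof (rule sums_le)
  show "(\<lambda>m. (p * u\<^sup>2 + (1 - p) * v\<^sup>2) ^ m / fact (2 * m)) sums cosh r"
    by (rule sums_cosh_power2[OF assms(3)])
  show "(\<lambda>m. p * ((u\<^sup>2) ^ m / fact (2 * m)) + (1 - p) * ((v\<^sup>2) ^ m / fact (2 * m))) sums
      (p * cosh u + (1 - p) * cosh v)"
    by (intro sums_add sums_mult sums_cosh_power2 refl)
  show "(p * u\<^sup>2 + (1 - p) * v\<^sup>2) ^ m / fact (2 * m)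
      \<le> p * ((u\<^sup>2) ^ m / fact (2 * m)) + (1 - p) * ((v\<^sup>2) ^ m / fact (2 * m))" for m
    using divide_right_mono[OF convex_combination_power_le[OF assms(1,2), of "u\<^sup>2" "v\<^sup>2" m], of "fact (2 * m)"]
    by (simp add: add_divide_distrib)
qed

text \<open>Both sides are power series in the square of x, compared term by term; this needs 2^m m!
  <= (2 m)!.\<close>

lemma cosh_le_exp_half_square: "cosh (x::real) \<le> exp (x\<^sup>2 / 2)"
proof (rule sums_le)
  show "(\<lambda>m. (x\<^sup>2) ^ m / fact (2 * m)) sums cosh x"
    by (rule sums_cosh_power2) simp
  show "(\<lambda>m. (x\<^sup>2 / 2) ^ m /\<^sub>R fact m) sums exp (x\<^sup>2 / 2)"
    by (rule exp_converges)
  show "(x\<^sup>2) ^ m / fact (2 * m) \<le> (x\<^sup>2 / 2) ^ m /\<^sub>R fact m" for m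
  proof -
    have "2 ^ m * fact m \<le> (fact (2 * m) :: real)"
    proof (induction m)
      case 0
      show ?case by simp
    next
      case (Suc m)
      have "2 ^ Suc m * fact (Suc m) = 2 * (1 + real m) * (2 ^ m * fact m)"
        by (simp add: algebra_simps)
      also have "\<dots> \<le> 2 * (1 + real m) * fact (2 * m)"
        using Suc by (intro mult_left_mono) auto
      also have "\<dots> \<le> (2 * (1 + real m) * (1 + 2 * real m)) * fact (2 * m)"
        by (intro mult_right_mono) (auto simp: algebra_simps)
      also have "\<dots> = fact (2 * Suc m)"
        by (simp add: algebra_simps)
      finally show ?case .
    qed
    then have "(x\<^sup>2) ^ m / fact (2 * m) \<le> (x\<^sup>2) ^ m / (2 ^ m * fact m)"
      by (intro divide_left_mono) auto
    then show ?thesis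
      by (simp add: power_divide field_simps)
  qed
qed

text \<open>The one-step bound of the Hoeffding argument, made affine in
  \<open>s \<bullet> y\<close> so that a centred y removes the last term. The square of |s + y| is
  at most |s|^2 + 2 s.y + B^2, which interpolates between (|s| - B)^2 and (|s| + B)^2 with weight (1
  + \<rho>) / 2; convexity of cosh o sqrt then gives the claim. For s = 0 the last term
  vanishes.\<close>

lemma cosh_norm_add_le:
  fixes s y :: "'a::real_inner"
  assumes "0 < B" "norm y \<le> B"
  shows "cosh (a * norm (s + y)) \<le> cosh (a * norm s) * cosh (a * B)
           + sinh (a * norm s) * sinh (a * B) / (norm s * B) * (s \<bullet> y)"
proof (cases "s = 0")
  case True
  have "\<bar>a * norm y\<bar> \<le> \<bar>a * B\<bar>"
    using assms by (simp add: abs_mult mult_left_mono)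
  then have "cosh \<bar>a * norm y\<bar> \<le> cosh \<bar>a * B\<bar>"
    by (subst cosh_real_nonneg_le_iff) auto
  then show ?thesis using True by simp
next
  case False
  define \<rho> where "\<rho> = (s \<bullet> y) / (norm s * B)"
  define r where "r = sqrt ((norm s)\<^sup>2 + 2 * (s \<bullet> y) + B\<^sup>2)"
  have pos: "norm s * B > 0" using False assms by simp
  have "\<bar>s \<bullet> y\<bar> \<le> norm s * B"
    using Cauchy_Schwarz_ineq2[of s y] mult_left_mono[OF assms(2) norm_ge_zero[of s]] by linarith
  then have \<rho>: "\<bar>\<rho>\<bar> \<le> 1"
    using pos by (simp add: \<rho>_def)
  have sy: "s \<bullet> y = \<rho> * (norm s * B)"
    using pos False assms by (simp add: \<rho>_def)
  have "(norm (s + y))\<^sup>2 \<le> (norm s)\<^sup>2 + 2 * (s \<bullet> y) + B\<^sup>2"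
    using assms power_mono[of "norm y" B 2]
    by (simp add: power2_norm_eq_inner inner_add_left inner_add_right inner_commute)
  then have rn: "norm (s + y) \<le> r" and r2: "r\<^sup>2 = (norm s)\<^sup>2 + 2 * (s \<bullet> y) + B\<^sup>2"
    using order_trans[OF zero_le_power2, of "norm (s + y)"] by (auto simp: r_def intro: real_le_rsqrt)
  have "\<bar>a * norm (s + y)\<bar> \<le> \<bar>a * r\<bar>"
    using rn norm_ge_zero[of "s + y"] by (simp add: abs_mult mult_left_mono del: norm_ge_zero)
  then have "cosh \<bar>a * norm (s + y)\<bar> \<le> cosh \<bar>a * r\<bar>"
    by (subst cosh_real_nonneg_le_iff) auto
  also have "cosh \<bar>a * r\<bar> \<le> (1 + \<rho>) / 2 * cosh (a * norm s + a * B)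
      + (1 - (1 + \<rho>) / 2) * cosh (a * norm s - a * B)"
  proof (rule cosh_le_convex_combination)
    have "\<bar>a * r\<bar>\<^sup>2 = a\<^sup>2 * r\<^sup>2"
      by (simp add: power_mult_distrib)
    also have "\<dots> = (1 + \<rho>) / 2 * (a * norm s + a * B)\<^sup>2 + (1 - (1 + \<rho>) / 2) * (a * norm s - a * B)\<^sup>2"
      unfolding r2 sy by (simp add: power2_eq_square field_simps)
    finally show "\<bar>a * r\<bar>\<^sup>2
      = (1 + \<rho>) / 2 * (a * norm s + a * B)\<^sup>2 + (1 - (1 + \<rho>) / 2) * (a * norm s - a * B)\<^sup>2" .
  qed (use \<rho> in auto)
  also have "\<dots> = cosh (a * norm s) * cosh (a * B) + \<rho> * (sinh (a * norm s) * sinh (a * B))"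
    by (simp add: cosh_add cosh_diff field_simps)
  finally show ?thesis by (simp add: \<rho>_def mult.commute mult.left_commute)
qed

text \<open>A supermartingale argument: \<open>\<Phi> k\<close> is a potential for the sum of the
  first k terms, and Fubini peels off the last coordinate. The set C, which contains all partial
  sums, allows a one-step inequality that holds only on part of the space, such as the positive
  semidefinite matrices.\<close>

lemma nn_integral_PiM_potential_le:
  fixes f :: "'b \<Rightarrow> 'v::{second_countable_topology, real_normed_vector}"
    and \<Phi> :: "nat \<Rightarrow> 'v \<Rightarrow> ennreal"
  assumes "prob_space M"
    and f [measurable]: "f \<in> borel_measurable M"
    and \<Phi> [measurable]: "\<And>k. \<Phi> k \<in> borel_measurable borel"
    and C: "0 \<in> C" "\<And>s x. s \<in> C \<Longrightarrow> s + f x \<in> C"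
    and step: "\<And>k s. k < n \<Longrightarrow> s \<in> C \<Longrightarrow> (\<integral>\<^sup>+x. \<Phi> (Suc k) (s + f x) \<partial>M) \<le> \<Phi> k s"
  shows "(\<integral>\<^sup>+x. \<Phi> n (\<Sum>i<n. f (x i)) \<partial>(\<Pi>\<^sub>M i\<in>{..<n}. M)) \<le> \<Phi> 0 0"
proof -
  interpret prob_space M by fact
  interpret P: product_sigma_finite "\<lambda>_::nat. M" by standard
  have sumC: "(\<Sum>i<k. f (x i)) \<in> C" for k and x :: "nat \<Rightarrow> 'b"
    by (induction k) (auto simp: C)
  have "(\<integral>\<^sup>+x. \<Phi> k (\<Sum>i<k. f (x i)) \<partial>(\<Pi>\<^sub>M i\<in>{..<k}. M)) \<le> \<Phi> 0 0" if "k \<le> n" for k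
    using that
  proof (induction k)
    case 0
    show ?case by (simp add: PiM_empty nn_integral_count_space_finite)
  next
    case (Suc k)
    have "(\<integral>\<^sup>+x. \<Phi> (Suc k) (\<Sum>i<Suc k. f (x i)) \<partial>(\<Pi>\<^sub>M i\<in>{..<Suc k}. M))
        = (\<integral>\<^sup>+x. \<integral>\<^sup>+y. \<Phi> (Suc k) (\<Sum>i<Suc k. f ((x(k := y)) i)) \<partial>M \<partial>(\<Pi>\<^sub>M i\<in>{..<k}. M))"
      unfolding lessThan_Suc by (rule P.product_nn_integral_insert) measurable
    also have "\<dots> = (\<integral>\<^sup>+x. \<integral>\<^sup>+y. \<Phi> (Suc k) ((\<Sum>i<k. f (x i)) + f y) \<partial>M \<partial>(\<Pi>\<^sub>M i\<in>{..<k}. M))"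
      by simp
    also have "\<dots> \<le> (\<integral>\<^sup>+x. \<Phi> k (\<Sum>i<k. f (x i)) \<partial>(\<Pi>\<^sub>M i\<in>{..<k}. M))"
      using Suc.prems sumC by (intro nn_integral_mono step) auto
    also have "\<dots> \<le> \<Phi> 0 0" using Suc by simp
    finally show ?case .
  qed
  then show ?thesis by simp
qed

lemma nn_integral_le_integral_bound:
  fixes g h :: "'b \<Rightarrow> real"
  assumes "AE x in M. 0 \<le> g x \<and> g x \<le> h x" "integrable M h"
  shows "(\<integral>\<^sup>+x. ennreal (g x) \<partial>M) \<le> ennreal (\<integral>x. h x \<partial>M)"
proof -
  have "(\<integral>\<^sup>+x. ennreal (g x) \<partial>M) \<le> (\<integral>\<^sup>+x. ennreal (h x) \<partial>M)"
    using assms(1) by (intro nn_integral_mono_AE) (auto intro: ennreal_leI)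
  also have "\<dots> = ennreal (\<integral>x. h x \<partial>M)"
    using assms by (intro nn_integral_eq_integral) auto
  finally show ?thesis .
qed

lemma emeasure_le_of_nn_integral:
  fixes c b :: real
  assumes "(\<integral>\<^sup>+x. ennreal (g x) \<partial>M) \<le> ennreal b" and [measurable]: "A \<in> sets M"
    and "\<And>x. x \<in> A \<Longrightarrow> c \<le> g x" "0 < c" "0 \<le> b"
  shows "emeasure M A \<le> ennreal (b / c)"
proof -
  have "ennreal c * emeasure M A = (\<integral>\<^sup>+x. ennreal c * indicator A x \<partial>M)"
    by (simp add: nn_integral_cmult_indicator)
  also have "\<dots> \<le> (\<integral>\<^sup>+x. ennreal (g x) \<partial>M)"
    using assms(3) by (intro nn_integral_mono) (auto split: split_indicator intro: ennreal_leI)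
  also have "\<dots> \<le> ennreal b" by fact
  finally have "inverse (ennreal c) * (ennreal c * emeasure M A) \<le> inverse (ennreal c) * ennreal b"
    by (rule mult_left_mono) simp
  then show ?thesis
    using assms(4,5)
    by (simp add: mult.assoc[symmetric] ennreal_inverse_mult inverse_ennreal ennreal_mult[symmetric] divide_inverse mult.commute)
qed

lemma (in prob_space) integrable_inner_AE_bounded:
  fixes f :: "'a \<Rightarrow> 'v::euclidean_space"
  assumes [measurable]: "f \<in> borel_measurable M" and "AE x in M. norm (f x) \<le> B"
  shows "integrable M (\<lambda>x. s \<bullet> f x)"
proof (rule integrable_const_bound[where B = "norm s * B"])
  show "AE x in M. norm (s \<bullet> f x) \<le> norm s * B"
    using assms(2)
  proof eventually_elim
    case (elim x)
    then show ?case
      using Cauchy_Schwarz_ineq2[of s "f x"] mult_left_mono[OF elim norm_ge_zero[of s]] by auto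
  qed
qed measurable

text \<open>The potential cosh (a |s|) depends on the norm alone, which makes the bound independent
  of the dimension; each step multiplies its mean by at most cosh (a B). Centring is assumed weakly,
  for scalar products. The factor 2 comes from cosh z >= exp z / 2.\<close>

lemma (in prob_space) PiM_norm_sum_hoeffding:
  fixes f :: "'a \<Rightarrow> 'v::euclidean_space"
  assumes f [measurable]: "f \<in> borel_measurable M" and bound: "AE x in M. norm (f x) \<le> B" and "0 < B"
    and mean: "\<And>s. (\<integral>x. s \<bullet> f x \<partial>M) = 0"
    and "0 < n" "0 \<le> t"
  shows "emeasure (\<Pi>\<^sub>M i\<in>{..<n}. M) {x \<in> space (\<Pi>\<^sub>M i\<in>{..<n}. M). t \<le> norm (\<Sum>i<n. f (x i))}
    \<le> ennreal (2 * exp (- t\<^sup>2 / (2 * real n * B\<^sup>2)))"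
proof -
  \<comment> \<open>Minimises the final exponent n (a B)^2 / 2 - a t.\<close>
  define a where "a = t / (real n * B\<^sup>2)"
  have "a \<ge> 0" using assms by (simp add: a_def)
  define \<Phi> where "\<Phi> k s = ennreal (cosh (a * B) ^ (n - k) * cosh (a * norm s))" for k and s :: 'v
  have "(\<integral>\<^sup>+x. \<Phi> n (\<Sum>i<n. f (x i)) \<partial>(\<Pi>\<^sub>M i\<in>{..<n}. M)) \<le> \<Phi> 0 0"
  proof (rule nn_integral_PiM_potential_le[where C = UNIV])
    show "prob_space M" by unfold_locales
    show "\<Phi> k \<in> borel_measurable borel" for k
      unfolding \<Phi>_def by (intro borel_measurable_continuous_onI measurable_compose[OF _ measurable_ennreal] continuous_intros)
    fix k and s :: 'v assume "k < n"
    then have nk: "n - k = Suc (n - Suc k)" by simp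
    let ?K = "sinh (a * norm s) * sinh (a * B) / (norm s * B)"
    have "(\<integral>\<^sup>+x. \<Phi> (Suc k) (s + f x) \<partial>M)
      \<le> ennreal (\<integral>x. cosh (a * B) ^ (n - Suc k) * (cosh (a * norm s) * cosh (a * B) + ?K * (s \<bullet> f x)) \<partial>M)"
      unfolding \<Phi>_def
    proof (rule nn_integral_le_integral_bound)
      show "AE x in M. 0 \<le> cosh (a * B) ^ (n - Suc k) * cosh (a * norm (s + f x)) \<and>
        cosh (a * B) ^ (n - Suc k) * cosh (a * norm (s + f x))
          \<le> cosh (a * B) ^ (n - Suc k) * (cosh (a * norm s) * cosh (a * B) + ?K * (s \<bullet> f x))"
        using bound
      proof eventually_elim
        case (elim x)
        then show ?case
          using cosh_norm_add_le[OF \<open>0 < B\<close> elim, of a s]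
          by (auto intro!: mult_left_mono mult_nonneg_nonneg zero_le_power)
      qed
      show "integrable M (\<lambda>x. cosh (a * B) ^ (n - Suc k) * (cosh (a * norm s) * cosh (a * B) + ?K * (s \<bullet> f x)))"
        using integrable_inner_AE_bounded[OF f bound, of s] by (intro integrable_mult_right integrable_add) auto
    qed
    also have "(\<integral>x. cosh (a * B) ^ (n - Suc k) * (cosh (a * norm s) * cosh (a * B) + ?K * (s \<bullet> f x)) \<partial>M)
       = cosh (a * B) ^ (n - Suc k) * (cosh (a * norm s) * cosh (a * B))"
      using integrable_inner_AE_bounded[OF f bound, of s] mean[of s] by (simp add: prob_space)
    also have "\<dots> = cosh (a * B) ^ (n - k) * cosh (a * norm s)"
      by (simp add: nk)
    finally show "(\<integral>\<^sup>+x. \<Phi> (Suc k) (s + f x) \<partial>M) \<le> \<Phi> k s"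
      by (simp add: \<Phi>_def)
  qed auto
  then have main: "(\<integral>\<^sup>+x. ennreal (cosh (a * norm (\<Sum>i<n. f (x i)))) \<partial>(\<Pi>\<^sub>M i\<in>{..<n}. M)) \<le> ennreal (cosh (a * B) ^ n)"
    by (simp add: \<Phi>_def)
  have "emeasure (\<Pi>\<^sub>M i\<in>{..<n}. M) {x \<in> space (\<Pi>\<^sub>M i\<in>{..<n}. M). t \<le> norm (\<Sum>i<n. f (x i))}
     \<le> ennreal (cosh (a * B) ^ n / (exp (a * t) / 2))"
  proof (rule emeasure_le_of_nn_integral[OF main])
    fix x assume "x \<in> {x \<in> space (\<Pi>\<^sub>M i\<in>{..<n}. M). t \<le> norm (\<Sum>i<n. f (x i))}"
    then have "a * t \<le> a * norm (\<Sum>i<n. f (x i))"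
      using \<open>a \<ge> 0\<close> by (auto intro: mult_left_mono)
    then have "exp (a * t) / 2 \<le> exp (a * norm (\<Sum>i<n. f (x i))) / 2" by simp
    also have "\<dots> \<le> cosh (a * norm (\<Sum>i<n. f (x i)))"
      by (simp add: cosh_def)
    finally show "exp (a * t) / 2 \<le> cosh (a * norm (\<Sum>i<n. f (x i)))" .
  qed auto
  also have "\<dots> \<le> ennreal (2 * exp (- t\<^sup>2 / (2 * real n * B\<^sup>2)))"
  proof (rule ennreal_leI)
    have "cosh (a * B) ^ n \<le> exp ((a * B)\<^sup>2 / 2) ^ n"
      by (intro power_mono cosh_le_exp_half_square) auto
    also have "\<dots> = exp (real n * ((a * B)\<^sup>2 / 2))"
      by (rule exp_of_nat_mult[symmetric])
    finally have "cosh (a * B) ^ n / (exp (a * t) / 2) \<le> exp (real n * ((a * B)\<^sup>2 / 2)) / (exp (a * t) / 2)"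
      by (rule divide_right_mono) simp
    also have "\<dots> = 2 * exp (real n * ((a * B)\<^sup>2 / 2) - a * t)"
      by (simp add: exp_diff)
    also have "real n * ((a * B)\<^sup>2 / 2) - a * t = - t\<^sup>2 / (2 * real n * B\<^sup>2)"
      using assms(3,5) by (simp add: a_def field_simps power2_eq_square)
    finally show "cosh (a * B) ^ n / (exp (a * t) / 2) \<le> 2 * exp (- t\<^sup>2 / (2 * real n * B\<^sup>2))" .
  qed
  finally show ?thesis .
qed

text \<open>Variances add because the cross term has mean zero; the potential is |s|^2 plus the
  variance still to come. The bound B serves integrability only and does not enter the
  estimate.\<close>

lemma (in prob_space) PiM_norm_sum_chebyshev:
  fixes f :: "'a \<Rightarrow> 'v::euclidean_space"
  assumes f [measurable]: "f \<in> borel_measurable M" and bound: "AE x in M. norm (f x) \<le> B"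
    and mean: "\<And>s. (\<integral>x. s \<bullet> f x \<partial>M) = 0"
    and var: "(\<integral>x. (norm (f x))\<^sup>2 \<partial>M) \<le> \<sigma>" and "0 < t"
  shows "emeasure (\<Pi>\<^sub>M i\<in>{..<n}. M) {x \<in> space (\<Pi>\<^sub>M i\<in>{..<n}. M). t \<le> norm (\<Sum>i<n. f (x i))}
    \<le> ennreal (real n * \<sigma> / t\<^sup>2)"
proof -
  have "0 \<le> (\<integral>x. (norm (f x))\<^sup>2 \<partial>M)" by simp
  then have "\<sigma> \<ge> 0" using var by linarith
  have int2: "integrable M (\<lambda>x. (norm (f x))\<^sup>2)"
    by (rule integrable_const_bound[where B = "B\<^sup>2"])
       (use bound in \<open>auto elim!: eventually_mono intro: power_mono\<close>)
  define \<Phi> where "\<Phi> k s = ennreal ((norm s)\<^sup>2 + real (n - k) * \<sigma>)" for k and s :: 'v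
  have "(\<integral>\<^sup>+x. \<Phi> n (\<Sum>i<n. f (x i)) \<partial>(\<Pi>\<^sub>M i\<in>{..<n}. M)) \<le> \<Phi> 0 0"
  proof (rule nn_integral_PiM_potential_le[where C = UNIV])
    show "prob_space M" by unfold_locales
    show "\<Phi> k \<in> borel_measurable borel" for k
      unfolding \<Phi>_def by measurable
    fix k and s :: 'v assume "k < n"
    then have nk: "n - k = Suc (n - Suc k)" by simp
    let ?h = "\<lambda>x. (norm s)\<^sup>2 + 2 * (s \<bullet> f x) + (norm (f x))\<^sup>2 + real (n - Suc k) * \<sigma>"
    note int1 = integrable_inner_AE_bounded[OF f bound, of s]
    have "(\<integral>\<^sup>+x. \<Phi> (Suc k) (s + f x) \<partial>M) \<le> ennreal (\<integral>x. ?h x \<partial>M)"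
      unfolding \<Phi>_def
    proof (rule nn_integral_le_integral_bound)
      show "AE x in M. 0 \<le> (norm (s + f x))\<^sup>2 + real (n - Suc k) * \<sigma> \<and>
          (norm (s + f x))\<^sup>2 + real (n - Suc k) * \<sigma> \<le> ?h x"
      proof (rule AE_I2)
        fix x
        have "(norm (s + f x))\<^sup>2 = (norm s)\<^sup>2 + 2 * (s \<bullet> f x) + (norm (f x))\<^sup>2"
          by (simp add: power2_norm_eq_inner inner_add_left inner_add_right inner_commute)
        then show "0 \<le> (norm (s + f x))\<^sup>2 + real (n - Suc k) * \<sigma> \<and>
          (norm (s + f x))\<^sup>2 + real (n - Suc k) * \<sigma> \<le> ?h x"
          using \<open>\<sigma> \<ge> 0\<close> by (metis add_nonneg_nonneg mult_nonneg_nonneg of_nat_0_le_iff order_refl zero_le_power2)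
      qed
      show "integrable M ?h"
        using int1 int2 by auto
    qed
    also have "(\<integral>x. ?h x \<partial>M) \<le> (norm s)\<^sup>2 + \<sigma> + real (n - Suc k) * \<sigma>"
      using int1 int2 mean[of s] var by (simp add: prob_space)
    also have "\<dots> = (norm s)\<^sup>2 + real (n - k) * \<sigma>"
      by (simp add: nk algebra_simps)
    finally show "(\<integral>\<^sup>+x. \<Phi> (Suc k) (s + f x) \<partial>M) \<le> \<Phi> k s"
      by (simp add: \<Phi>_def ennreal_leI)
  qed auto
  then have main: "(\<integral>\<^sup>+x. ennreal ((norm (\<Sum>i<n. f (x i)))\<^sup>2) \<partial>(\<Pi>\<^sub>M i\<in>{..<n}. M)) \<le> ennreal (real n * \<sigma>)"
    by (simp add: \<Phi>_def)
  show ?thesis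
    by (rule emeasure_le_of_nn_integral[OF main])
       (use \<open>0 < t\<close> \<open>\<sigma> \<ge> 0\<close> in \<open>auto intro: power_mono\<close>)
qed

section \<open>Radial isotropic position\<close>

definition outer :: "real^'d \<Rightarrow> real^'d^'d" where
  "outer x = (\<chi> i j. x $ i * x $ j)"

lemma outer_mult_vec: "outer x *v y = (x \<bullet> y) *\<^sub>R x"
  by (simp add: outer_def vec_eq_iff matrix_vector_mult_def inner_vec_def sum_distrib_left sum_distrib_right mult_ac)

lemma det_scaleR: "det (c *\<^sub>R A) = c ^ CARD('d) * det (A :: real^'d^'d)"
proof -
  have "c *\<^sub>R A = mat c ** A"
    by (simp add: vec_eq_iff matrix_matrix_mult_def mat_def if_distrib if_distribR sum.delta cong: if_cong)
  moreover have "det (mat c :: real^'d^'d) = c ^ CARD('d)"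
    by (subst det_diagonal) (auto simp: mat_def)
  ultimately show ?thesis by (simp add: det_mul)
qed

text \<open>Hadamard's inequality up to a factorial, read off the Leibniz formula. The loss is
  harmless because only finiteness of a constant in a compactness argument depends on it.\<close>

lemma abs_det_le_prod_norm_rows:
  fixes A :: "real^'d^'d"
  shows "\<bar>det A\<bar> \<le> fact CARD('d) * (\<Prod>i\<in>UNIV. norm (A $ i))"
proof -
  let ?P = "{p. p permutes (UNIV :: 'd set)}"
  have "\<bar>det A\<bar> \<le> (\<Sum>p\<in>?P. \<bar>of_int (sign p) * (\<Prod>i\<in>UNIV. A $ i $ p i)\<bar>)"
    unfolding det_def by (rule sum_abs)
  also have "\<dots> \<le> (\<Sum>p\<in>?P. \<Prod>i\<in>UNIV. norm (A $ i))"
  proof (rule sum_mono)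
    fix p :: "'d \<Rightarrow> 'd"
    have "\<bar>of_int (sign p) * (\<Prod>i\<in>UNIV. A $ i $ p i)\<bar> = (\<Prod>i\<in>UNIV. \<bar>A $ i $ p i\<bar>)"
      by (simp add: abs_mult abs_prod sign_def)
    also have "\<dots> \<le> (\<Prod>i\<in>UNIV. norm (A $ i))"
      by (intro prod_mono) (auto intro: component_le_norm_cart)
    finally show "\<bar>of_int (sign p) * (\<Prod>i\<in>UNIV. A $ i $ p i)\<bar> \<le> (\<Prod>i\<in>UNIV. norm (A $ i))" .
  qed
  also have "\<dots> = fact CARD('d) * (\<Prod>i\<in>UNIV. norm (A $ i))"
    by (simp add: card_permutations)
  finally show ?thesis .
qed

text \<open>A rotation taking a coordinate axis to w makes the matrix diagonal.\<close>

lemma det_mat_add_outer: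
  fixes w :: "real^'d"
  assumes "norm w = 1"
  shows "det (mat 1 + t *\<^sub>R outer w) = 1 + t"
proof -
  obtain k :: 'd where True by simp
  obtain Q :: "real^'d^'d" where Q: "orthogonal_matrix Q" "Q *v (axis k 1) = w"
    using orthogonal_matrix_exists_basis[OF assms, of k] by blast
  define D where "D = mat 1 + t *\<^sub>R outer (axis k 1 :: real^'d)"
  have QQ: "Q ** transpose Q = mat 1"
    using Q(1) by (simp add: orthogonal_matrix_def)
  have "mat 1 + t *\<^sub>R outer w = Q ** D ** transpose Q"
  proof (rule matrix_eq[THEN iffD2], rule allI)
    fix x
    have *: "axis k 1 \<bullet> (transpose Q *v x) = w \<bullet> x"
      by (metis Q(2) dot_lmul_matrix transpose_matrix_vector inner_commute)
    have QQx: "Q *v (transpose Q *v x) = x"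
      by (simp add: matrix_vector_mul_assoc QQ del: transpose_matrix_vector)
    have "(Q ** D ** transpose Q) *v x = Q *v (transpose Q *v x + t *\<^sub>R (outer (axis k 1) *v (transpose Q *v x)))"
      by (simp add: D_def matrix_vector_mul_assoc[symmetric] matrix_vector_mult_add_rdistrib
          scaleR_matrix_vector_assoc)
    also have "\<dots> = x + t *\<^sub>R ((w \<bullet> x) *\<^sub>R w)"
      by (simp add: outer_mult_vec * QQx matrix_vector_right_distrib matrix_vector_mult_scaleR Q(2)
          del: transpose_matrix_vector)
    finally show "(mat 1 + t *\<^sub>R outer w) *v x = (Q ** D ** transpose Q) *v x"
      by (simp add: matrix_vector_mult_add_rdistrib scaleR_matrix_vector_assoc[symmetric] outer_mult_vec)
  qed
  then have "det (mat 1 + t *\<^sub>R outer w) = det D * (det Q * det (transpose Q))"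
    by (simp add: det_mul)
  also have "det Q * det (transpose Q) = 1"
    by (metis QQ det_I det_mul)
  also have "det D = (\<Prod>i\<in>UNIV. D $ i $ i)"
    by (rule det_diagonal) (auto simp: D_def mat_def outer_def axis_def)
  also have "\<dots> = (\<Prod>i\<in>UNIV. if i = k then 1 + t else 1)"
    by (intro prod.cong refl) (auto simp: D_def mat_def outer_def axis_def)
  also have "\<dots> = 1 + t" by simp
  finally show ?thesis by simp
qed

text \<open>Any d of the n vectors, chosen by distinct indices, are linearly independent.
  Determinants are used because the compactness argument divides by them.\<close>

definition general_position :: "nat \<Rightarrow> (nat \<Rightarrow> real^'d) \<Rightarrow> bool" where
  "general_position n u \<longleftrightarrow>
     (\<forall>\<sigma>::'d \<Rightarrow> nat. inj \<sigma> \<longrightarrow> range \<sigma> \<subseteq> {..<n} \<longrightarrow> det (\<chi> j. u (\<sigma> j)) \<noteq> 0)"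

lemma det_rows_image:
  fixes A :: "real^'d^'d"
  shows "det (\<chi> j. A *v u j) = det (\<chi> j. u j) * det A"
proof -
  have "(\<chi> j. A *v u j) = (\<chi> j. u j) ** transpose A"
    by (simp add: vec_eq_iff matrix_matrix_mult_def matrix_vector_mult_def transpose_def mult.commute)
  then show ?thesis by (simp add: det_mul)
qed

text \<open>More than d vectors in the kernel of A would include d independent ones and force A = 0.
  The killed indices are padded to exactly d of them, so that they can be enumerated by the column
  type.\<close>

lemma general_position_kernel:
  fixes A :: "real^'d^'d"
  assumes gp: "general_position n u" and "A \<noteq> 0" and "CARD('d) \<le> n"
  shows "\<exists>\<sigma>::'d \<Rightarrow> nat. inj \<sigma> \<and> range \<sigma> \<subseteq> {..<n} \<and> (\<forall>i<n. A *v u i = 0 \<longrightarrow> i \<in> range \<sigma>)"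
proof -
  let ?Z = "{i. i < n \<and> A *v u i = 0}"
  have enum: "\<exists>\<sigma>::'d \<Rightarrow> nat. inj \<sigma> \<and> range \<sigma> = I" if "card I = CARD('d)" "finite I" for I :: "nat set"
    using finite_same_card_bij[of "UNIV :: 'd set" I] that by (auto simp: bij_betw_def)
  have "card ?Z \<le> CARD('d)"
  proof (rule ccontr)
    assume "\<not> card ?Z \<le> CARD('d)"
    then obtain I where I: "I \<subseteq> ?Z" "card I = CARD('d)"
      by (meson nat_le_linear obtain_subset_with_card_n)
    moreover from this have "finite I"
      by (metis card.infinite zero_less_card_finite less_irrefl)
    ultimately obtain \<sigma> :: "'d \<Rightarrow> nat" where \<sigma>: "inj \<sigma>" "range \<sigma> = I"
      using enum by blast
    define U where "U = (\<chi> j. u (\<sigma> j))"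
    have "det U \<noteq> 0"
      using gp \<sigma> I(1) unfolding general_position_def U_def by blast
    then obtain U' where U': "U' ** U = mat 1"
      by (metis invertible_det_nz invertible_def)
    have "U ** transpose A = (\<chi> j. A *v u (\<sigma> j))"
      by (simp add: U_def vec_eq_iff matrix_matrix_mult_def matrix_vector_mult_def transpose_def mult.commute)
    also have "\<dots> = 0"
      using \<sigma>(2) I(1) by (auto simp: vec_eq_iff)
    finally have "U' ** (U ** transpose A) = 0"
      by (simp add: matrix_matrix_mult_def vec_eq_iff)
    then have "transpose A = 0"
      by (simp add: matrix_mul_assoc U')
    then have "A = 0"
      by (simp add: vec_eq_iff transpose_def)
    with \<open>A \<noteq> 0\<close> show False by simp
  qed
  then obtain I where I: "?Z \<subseteq> I" "I \<subseteq> {..<n}" "card I = CARD('d)"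
    using exists_subset_between[of ?Z "CARD('d)" "{..<n}"] assms(3) by auto
  then have "finite I"
    using finite_subset by blast
  with enum I obtain \<sigma> :: "'d \<Rightarrow> nat" where "inj \<sigma>" "range \<sigma> = I" by blast
  with I show ?thesis by blast
qed

text \<open>A minimiser over all invertible \<open>A\<close> puts \<open>u\<close> into radial isotropic position.\<close>

definition radial_potential :: "nat \<Rightarrow> (nat \<Rightarrow> real^'d) \<Rightarrow> real^'d^'d \<Rightarrow> real" where
  "radial_potential n u A = (\<Prod>i<n. (norm (A *v u i))\<^sup>2) ^ CARD('d) / ((det A)\<^sup>2) ^ n"

text \<open>Numerator and denominator are homogeneous of the same degree 2 n d, so the search for a
  minimiser may be confined to the unit sphere of matrices.\<close>

lemma radial_potential_scaleR:
  fixes A :: "real^'d^'d"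
  assumes "c \<noteq> 0"
  shows "radial_potential n u (c *\<^sub>R A) = radial_potential n u A"
proof -
  have "(\<Prod>i<n. (norm ((c *\<^sub>R A) *v u i))\<^sup>2) = (c\<^sup>2) ^ n * (\<Prod>i<n. (norm (A *v u i))\<^sup>2)"
    by (simp add: scaleR_matrix_vector_assoc[symmetric] power_mult_distrib prod.distrib)
  moreover have "(det (c *\<^sub>R A))\<^sup>2 = (c\<^sup>2) ^ CARD('d) * (det A)\<^sup>2"
    by (simp add: det_scaleR power_mult_distrib power_mult[symmetric] mult.commute)
  ultimately show ?thesis
    using assms
    by (simp add: radial_potential_def power_mult_distrib power_mult[symmetric] mult.commute mult.left_commute)
qed

text \<open>The obstacle is that invertible matrices do not form a closed set: along a minimising
  sequence the determinant might tend to zero. On a sublevel set, the d factors |A u_i|^2 picked by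
  \<sigma> can be cancelled against (det A)^2 by Hadamard's inequality, leaving a closed condition
  on the other n - d factors. At a singular nonzero A it fails for the \<sigma> that covers all
  killed vectors, so the constrained set is compact and consists of invertible matrices.\<close>

lemma radial_potential_minimizer:
  fixes u :: "nat \<Rightarrow> real^'d"
  assumes gp: "general_position n u" and n: "CARD('d) < n"
  obtains A :: "real^'d^'d" where "det A \<noteq> 0"
    and "\<And>B. det B \<noteq> 0 \<Longrightarrow> radial_potential n u A \<le> radial_potential n u B"
proof -
  let ?f = "radial_potential n u"
  let ?d = "CARD('d)"
  \<comment> \<open>The sublevel of the identity: it is not empty, and matrices outside it cannot
    beat a minimiser found inside.\<close>
  define c where "c = ?f (mat 1)"
  define \<Sigma> where "\<Sigma> = {\<sigma>::'d \<Rightarrow> nat. inj \<sigma> \<and> range \<sigma> \<subseteq> {..<n}}"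
  define C where "C \<sigma> = c * ((fact ?d / det (\<chi> j. u (\<sigma> j)))\<^sup>2) ^ ?d" for \<sigma> :: "'d \<Rightarrow> nat"
  text \<open>The conditions indexed by \<open>\<sigma>\<close> are closed, follow from the first one off the zero set
    of the determinant, and keep the determinant away from zero.\<close>
  define K where "K = {A :: real^'d^'d. norm A = 1 \<and>
      (\<Prod>i<n. (norm (A *v u i))\<^sup>2) ^ ?d \<le> c * ((det A)\<^sup>2) ^ n \<and>
      (\<forall>\<sigma>\<in>\<Sigma>. (\<Prod>i\<in>{..<n} - range \<sigma>. (norm (A *v u i))\<^sup>2) ^ ?d \<le> C \<sigma> * ((det A)\<^sup>2) ^ (n - ?d))}"
  have cont: "continuous_on UNIV (\<lambda>A :: real^'d^'d. det A)"
    unfolding det_def by (intro continuous_intros)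
  have contv: "continuous_on UNIV (\<lambda>A :: real^'d^'d. A *v x)" for x
    unfolding matrix_vector_mult_def by (intro continuous_intros)
  have "compact K"
  proof -
    have "closed K"
      unfolding K_def Ball_def
      by (intro closed_Collect_conj closed_Collect_all closed_Collect_imp open_Collect_const
          closed_Collect_le closed_Collect_eq continuous_intros cont contv)
    moreover have "bounded K"
      by (rule bounded_subset[of "cball 0 1"]) (auto simp: K_def)
    ultimately show ?thesis by (simp add: compact_eq_bounded_closed)
  qed
  have det_K: "det A \<noteq> 0" if "A \<in> K" for A
  proof
    assume "det A = 0"
    have "A \<noteq> 0" using that by (auto simp: K_def)
    then obtain \<sigma> :: "'d \<Rightarrow> nat" where \<sigma>: "inj \<sigma>" "range \<sigma> \<subseteq> {..<n}" "\<forall>i<n. A *v u i = 0 \<longrightarrow> i \<in> range \<sigma>"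
      using general_position_kernel[OF gp, of A] n by auto
    \<comment> \<open>All vanishing factors have index in the range of \<sigma>, so the left side is
      positive; the right side is zero because the exponent n - d is positive.\<close>
    have "0 < (\<Prod>i\<in>{..<n} - range \<sigma>. (norm (A *v u i))\<^sup>2) ^ ?d"
      using \<sigma>(3) by (intro zero_less_power prod_pos) auto
    also have "\<dots> \<le> C \<sigma> * ((det A)\<^sup>2) ^ (n - ?d)"
      using that \<sigma> by (auto simp: K_def \<Sigma>_def)
    also have "\<dots> = 0" using \<open>det A = 0\<close> n by simp
    finally show False by simp
  qed
  have unz: "u i \<noteq> 0" if i: "i < n" for i
  proof
    assume "u i = 0"
    obtain I where I: "{i} \<subseteq> I" "I \<subseteq> {..<n}" "card I = ?d"
      using exists_subset_between[of "{i}" ?d "{..<n}"] i n by (auto simp: Suc_le_eq)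
    then have "finite I" using finite_subset by blast
    then obtain \<sigma> :: "'d \<Rightarrow> nat" where \<sigma>: "inj \<sigma>" "range \<sigma> = I"
      using finite_same_card_bij[of "UNIV :: 'd set" I] I by (auto simp: bij_betw_def)
    then obtain j where "\<sigma> j = i" using I by blast
    then have "row j (\<chi> j. u (\<sigma> j)) = 0"
      using \<open>u i = 0\<close> by (simp add: row_def vec_eq_iff)
    then have "det (\<chi> j. u (\<sigma> j)) = 0" by (rule det_zero_row(1))
    then show False using gp \<sigma> I by (auto simp: general_position_def)
  qed
  have Au: "A *v u i \<noteq> 0" if "det A \<noteq> 0" "i < n" for A :: "real^'d^'d" and i
    using that unz by (metis det_nz_iff_inj inj_matrix_vector_mult injD invertible_det_nz matrix_vector_mult_0_right)
  have in_K: "A \<in> K" if A: "norm A = 1" "det A \<noteq> 0" "?f A \<le> c" for A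
  proof -
    have le: "(\<Prod>i<n. (norm (A *v u i))\<^sup>2) ^ ?d \<le> c * ((det A)\<^sup>2) ^ n"
      using A(2,3) by (simp add: radial_potential_def divide_le_eq)
    have "(\<Prod>i\<in>{..<n} - range \<sigma>. (norm (A *v u i))\<^sup>2) ^ ?d \<le> C \<sigma> * ((det A)\<^sup>2) ^ (n - ?d)"
      if \<sigma>: "\<sigma> \<in> \<Sigma>" for \<sigma>
    proof -
      let ?U = "det (\<chi> j. u (\<sigma> j))"
      have "?U \<noteq> 0" using gp \<sigma> by (auto simp: general_position_def \<Sigma>_def)
      let ?Q = "\<Prod>i\<in>range \<sigma>. (norm (A *v u i))\<^sup>2" and ?R = "\<Prod>i\<in>{..<n} - range \<sigma>. (norm (A *v u i))\<^sup>2"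
      have Qpos: "?Q > 0"
        using \<sigma> Au[OF A(2)] by (intro prod_pos) (auto simp: \<Sigma>_def)
      \<comment> \<open>Hadamard for the images of the d selected vectors bounds (det A)^2 by a
        constant times Q; that lets the power of Q cancel from the sublevel inequality.\<close>
      have "\<bar>?U * det A\<bar> \<le> fact ?d * (\<Prod>j\<in>UNIV. norm (A *v u (\<sigma> j)))"
        using abs_det_le_prod_norm_rows[of "\<chi> j. A *v u (\<sigma> j)"] by (simp add: det_rows_image)
      then have "(?U * det A)\<^sup>2 \<le> (fact ?d * (\<Prod>j\<in>UNIV. norm (A *v u (\<sigma> j))))\<^sup>2"
        by (metis abs_ge_zero power2_abs power_mono)
      also have "\<dots> = (fact ?d)\<^sup>2 * (\<Prod>j\<in>UNIV. (norm (A *v u (\<sigma> j)))\<^sup>2)"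
        by (simp add: power_mult_distrib prod_power_distrib)
      also have "(\<Prod>j\<in>UNIV. (norm (A *v u (\<sigma> j)))\<^sup>2) = ?Q"
        using \<sigma> by (subst prod.reindex) (auto simp: \<Sigma>_def)
      finally have "(det A)\<^sup>2 \<le> (fact ?d / ?U)\<^sup>2 * ?Q"
        using \<open>?U \<noteq> 0\<close> by (simp add: power_mult_distrib power_divide field_simps)
      then have d1: "((det A)\<^sup>2) ^ ?d \<le> ((fact ?d / ?U)\<^sup>2) ^ ?d * ?Q ^ ?d"
        unfolding power_mult_distrib[symmetric] by (intro power_mono) auto
      have "(\<Prod>i<n. (norm (A *v u i))\<^sup>2) = ?R * ?Q"
        using \<sigma> by (intro prod.subset_diff) (auto simp: \<Sigma>_def)
      then have "?R ^ ?d * ?Q ^ ?d \<le> c * ((det A)\<^sup>2) ^ n"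
        using le by (simp add: power_mult_distrib)
      also have "((det A)\<^sup>2) ^ n = ((det A)\<^sup>2) ^ (n - ?d) * ((det A)\<^sup>2) ^ ?d"
        using n by (simp add: power_add[symmetric])
      also have "c * (((det A)\<^sup>2) ^ (n - ?d) * ((det A)\<^sup>2) ^ ?d)
          \<le> c * (((det A)\<^sup>2) ^ (n - ?d) * (((fact ?d / ?U)\<^sup>2) ^ ?d * ?Q ^ ?d))"
        using d1 by (intro mult_left_mono) (auto simp: c_def radial_potential_def intro!: prod_nonneg divide_nonneg_nonneg zero_le_power)
      also have "\<dots> = C \<sigma> * ((det A)\<^sup>2) ^ (n - ?d) * ?Q ^ ?d"
        by (simp add: C_def)
      finally show ?thesis
        using Qpos by (simp add: mult_le_cancel_right)
    qed
    with A le show ?thesis by (auto simp: K_def)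
  qed
  have normalise: "\<exists>A'. norm A' = 1 \<and> det A' \<noteq> 0 \<and> ?f A' = ?f A" if "det A \<noteq> 0" for A
  proof -
    have "A \<noteq> 0" using that by (metis det_0 mat_0)
    then show ?thesis
      using that by (intro exI[of _ "(1 / norm A) *\<^sub>R A"]) (simp add: det_scaleR radial_potential_scaleR)
  qed
  have "K \<noteq> {}"
    using normalise[of "mat 1"] in_K unfolding c_def by (metis det_I empty_iff order_refl zero_neq_one)
  moreover have "continuous_on K ?f"
    unfolding radial_potential_def
    by (intro continuous_intros continuous_on_subset[OF cont] continuous_on_subset[OF contv]) (auto simp: det_K)
  ultimately obtain A where A: "A \<in> K" "\<And>B. B \<in> K \<Longrightarrow> ?f A \<le> ?f B"
    using continuous_attains_inf[OF \<open>compact K\<close>] by blast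
  have "?f A \<le> c"
    using A(1) det_K[OF A(1)] by (simp add: K_def radial_potential_def divide_le_eq)
  have "?f A \<le> ?f B" if "det B \<noteq> 0" for B
  proof (cases "?f B \<le> c")
    case True
    with normalise[OF that] A(2) in_K show ?thesis by metis
  qed (use \<open>?f A \<le> c\<close> in linarith)
  with det_K[OF A(1)] that show thesis by blast
qed

text \<open>First variation: replacing A by (1 + t w w^T) A changes the logarithm of the potential
  by the function h below, which has a minimum at 0. Its vanishing derivative there is exactly
  tightness in direction w.\<close>

lemma radial_potential_minimizer_tight:
  fixes u :: "nat \<Rightarrow> real^'d" and A :: "real^'d^'d"
  assumes det: "det A \<noteq> 0"
    and min: "\<And>B. det B \<noteq> 0 \<Longrightarrow> radial_potential n u A \<le> radial_potential n u B"
    and unz: "\<And>i. i < n \<Longrightarrow> u i \<noteq> 0" and w: "norm w = 1"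
  shows "real CARD('d) * (\<Sum>i<n. ((A *v u i) \<bullet> w / norm (A *v u i))\<^sup>2) = real n"
proof -
  let ?d = "CARD('d)"
  define x where "x i = A *v u i" for i
  define q where "q i = (x i \<bullet> w / norm (x i))\<^sup>2" for i
  have xnz: "x i \<noteq> 0" if "i < n" for i
    using det unz[OF that] unfolding x_def
    by (metis det_nz_iff_inj inj_matrix_vector_mult injD invertible_det_nz matrix_vector_mult_0_right)
  have q: "0 \<le> q i" "q i \<le> 1" if "i < n" for i
  proof -
    have "\<bar>x i \<bullet> w\<bar> \<le> norm (x i)"
      using Cauchy_Schwarz_ineq2[of "x i" w] w by simp
    then have "\<bar>x i \<bullet> w / norm (x i)\<bar> \<le> 1"
      using xnz[OF that] by simp
    then show "q i \<le> 1"
      by (simp add: q_def abs_square_le_1)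
  qed (simp add: q_def)
  define h where "h s = real ?d * (\<Sum>i<n. ln (1 + s * q i)) - real n * ln (1 + s)" for s
  have pos: "1 + s * q i > 0" if "i < n" "\<bar>s\<bar> < 1" for s i
  proof -
    have "\<bar>s * q i\<bar> \<le> \<bar>s\<bar> * 1"
      unfolding abs_mult using q[OF that(1)] by (intro mult_left_mono) auto
    with that(2) show ?thesis by linarith
  qed
  have "0 \<le> h s" if s: "\<bar>s\<bar> < 1" for s
  proof -
    \<comment> \<open>With (1 + t)^2 = 1 + s, the squared determinant and the squared norms change
      by factors affine in s.\<close>
    define t where "t = sqrt (1 + s) - 1"
    have t: "(1 + t)\<^sup>2 = 1 + s" using s by (simp add: t_def)
    define B where "B = (mat 1 + t *\<^sub>R outer w) ** A"
    have detB: "(det B)\<^sup>2 = (1 + s) * (det A)\<^sup>2"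
      by (simp add: B_def det_mul det_mat_add_outer[OF w] power_mult_distrib t)
    then have "det B \<noteq> 0" using s det by auto
    have normB: "(norm (B *v u i))\<^sup>2 = (norm (x i))\<^sup>2 * (1 + s * q i)" if "i < n" for i
    proof -
      have "B *v u i = x i + (t * (w \<bullet> x i)) *\<^sub>R w"
        by (simp add: B_def x_def matrix_vector_mul_assoc[symmetric] matrix_vector_mult_add_rdistrib
            scaleR_matrix_vector_assoc[symmetric] outer_mult_vec)
      then have "(norm (B *v u i))\<^sup>2 = (norm (x i))\<^sup>2 + (2 * t + t\<^sup>2) * (x i \<bullet> w)\<^sup>2"
        using w unfolding power2_norm_eq_inner
        by (simp add: norm_eq_1 inner_add_left inner_add_right inner_commute power2_eq_square algebra_simps)
      also have "2 * t + t\<^sup>2 = s"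
        using t by (simp add: power2_eq_square algebra_simps)
      also have "(x i \<bullet> w)\<^sup>2 = (norm (x i))\<^sup>2 * q i"
        using xnz[OF that] by (simp add: q_def power_divide)
      finally show ?thesis by (simp add: algebra_simps)
    qed
    let ?P = "(\<Prod>i<n. (norm (x i))\<^sup>2) ^ ?d"
    have Ppos: "?P > 0"
      using xnz by (intro zero_less_power prod_pos) auto
    have "?P / ((det A)\<^sup>2) ^ n \<le> (?P * (\<Prod>i<n. 1 + s * q i) ^ ?d) / (((1 + s) ^ n) * ((det A)\<^sup>2) ^ n)"
      using min[OF \<open>det B \<noteq> 0\<close>] normB detB
      by (simp add: radial_potential_def x_def[symmetric] prod.distrib power_mult_distrib)
    then have *: "(1 + s) ^ n \<le> (\<Prod>i<n. 1 + s * q i) ^ ?d"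
      using Ppos det s by (simp add: field_simps)
    have ln_P: "ln (\<Prod>i<n. 1 + s * q i) = (\<Sum>i<n. ln (1 + s * q i))"
    proof (rule ln_prod)
      show "1 + s * q i \<noteq> 0" if "i \<in> {..<n}" for i
        using pos[OF _ s, of i] that by auto
    qed simp
    from * have "ln ((1 + s) ^ n) \<le> ln ((\<Prod>i<n. 1 + s * q i) ^ ?d)"
      using s pos[OF _ s] by (subst ln_le_cancel_iff) (auto intro!: zero_less_power prod_pos)
    then show ?thesis
      using s by (simp add: h_def ln_realpow ln_P)
  qed
  then have min0: "\<forall>s. \<bar>0 - s\<bar> < 1 \<longrightarrow> h 0 \<le> h s"
    by (simp add: h_def)
  have deriv: "(h has_real_derivative (real ?d * (\<Sum>i<n. q i) - real n)) (at 0)"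
    unfolding h_def by (auto intro!: derivative_eq_intros sum.cong)
  have "real ?d * (\<Sum>i<n. q i) - real n = 0"
    by (rule DERIV_local_min[OF deriv zero_less_one min0])
  then show ?thesis by (simp add: q_def x_def)
qed

text \<open>Polar decomposition: the positive square root B of A^T A has |B x| = |A x| and the same
  squared determinant as A, and the potential sees nothing else. Positivity with an eigenbasis is
  what the comparison of coordinates before and after the move requires.\<close>

lemma radial_potential_psd_minimizer:
  fixes u :: "nat \<Rightarrow> real^'d"
  assumes gp: "general_position n u" and n: "CARD('d) < n"
  obtains B :: "real^'d^'d" and q :: "nat \<Rightarrow> real^'d" and a :: "nat \<Rightarrow> real"
  where "det B \<noteq> 0" and "\<And>C. det C \<noteq> 0 \<Longrightarrow> radial_potential n u B \<le> radial_potential n u C"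
    and "orthonormal_basis q" and "\<And>x j. j < CARD('d) \<Longrightarrow> (B *v x) \<bullet> q j = a j * (x \<bullet> q j)"
    and "\<And>j. j < CARD('d) \<Longrightarrow> 0 < a j"
    and "\<And>i j. i \<le> j \<Longrightarrow> j < CARD('d) \<Longrightarrow> a j \<le> a i"
proof -
  let ?d = "CARD('d)"
  obtain A :: "real^'d^'d" where A: "det A \<noteq> 0"
    "\<And>B. det B \<noteq> 0 \<Longrightarrow> radial_potential n u A \<le> radial_potential n u B"
    using radial_potential_minimizer[OF gp n] by blast
  define f where "f x = transpose A *v (A *v x)" for x
  have f_dot: "f x \<bullet> y = (A *v x) \<bullet> (A *v y)" for x y
    by (simp add: f_def dot_lmul_matrix)
  have "linear f"
    unfolding f_def using linear_compose[OF matrix_vector_mul_linear matrix_vector_mul_linear]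
    by (simp add: o_def del: transpose_matrix_vector)
  moreover have sa: "f x \<bullet> y = x \<bullet> f y" for x y
    by (metis f_dot inner_commute)
  ultimately obtain q l where q: "orthonormal_basis q"
    and "\<And>i. i < DIM(real^'d) \<Longrightarrow> f (q i) = l i *\<^sub>R q i"
    and "\<And>i j. i \<le> j \<Longrightarrow> j < DIM(real^'d) \<Longrightarrow> l j \<le> l i"
    using self_adjoint_eigenbasis[of f] by blast
  then have fq: "\<And>i. i < ?d \<Longrightarrow> f (q i) = l i *\<^sub>R q i" and l: "\<And>i j. i \<le> j \<Longrightarrow> j < ?d \<Longrightarrow> l j \<le> l i"
    by simp_all
  have qq: "q i \<bullet> q j = (if i = j then 1 else 0)" if "i < ?d" "j < ?d" for i j
    using q that by (auto simp: orthonormal_basis_def)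
  have inj: "inj ((*v) A)"
    using A(1) by (simp add: inj_matrix_vector_mult invertible_det_nz)
  have lpos: "0 < l i" if "i < ?d" for i
  proof -
    have "q i \<noteq> 0" using qq[OF that that] by auto
    then have "A *v q i \<noteq> 0"
      using injD[OF inj, of "q i" 0] by auto
    then have "0 < f (q i) \<bullet> q i" by (simp add: f_dot)
    then show ?thesis using fq[OF that] qq[OF that that] by simp
  qed
  define a where "a i = sqrt (l i)" for i
  define g where "g x = (\<Sum>j<?d. (a j * (x \<bullet> q j)) *\<^sub>R q j)" for x
  define B where "B = matrix g"
  have "linear g"
    unfolding g_def
    by (intro linearI) (simp_all add: inner_add_left distrib_left scaleR_add_left sum.distrib scaleR_sum_right mult_ac)
  then have Bg: "B *v x = g x" for x
    by (simp add: B_def matrix_works)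
  have gq: "g x \<bullet> q j = a j * (x \<bullet> q j)" if "j < ?d" for x j
    using that by (simp add: g_def inner_sum_left qq if_distrib sum.delta cong: if_cong)
  have fgg: "f x = g (g x)" for x
  proof -
    have "f x \<bullet> q j = g (g x) \<bullet> q j" if "j < ?d" for j
      using that lpos[OF that] by (simp add: gq sa fq a_def mult.assoc[symmetric])
    then show ?thesis
      using orthonormal_basis_expansion[OF q, of "f x"] orthonormal_basis_expansion[OF q, of "g (g x)"]
      by simp
  qed
  have "transpose A ** A = B ** B"
    by (rule matrix_eq[THEN iffD2])
       (simp add: matrix_vector_mul_assoc[symmetric] Bg fgg[symmetric], simp add: f_def)
  then have "det (transpose A ** A) = det (B ** B)" by simp
  then have det: "(det B)\<^sup>2 = (det A)\<^sup>2"
    by (simp add: det_mul power2_eq_square)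
  have norm: "(norm (B *v x))\<^sup>2 = (norm (A *v x))\<^sup>2" for x
  proof -
    have "(norm (A *v x))\<^sup>2 = f x \<bullet> x"
      by (simp add: f_dot power2_norm_eq_inner)
    also have "\<dots> = (\<Sum>j<?d. (g (g x) \<bullet> q j) * (x \<bullet> q j))"
      using orthonormal_basis_inner[OF q, of "f x" x] by (simp add: fgg)
    also have "\<dots> = (\<Sum>j<?d. (g x \<bullet> q j)\<^sup>2)"
      by (simp add: gq power2_eq_square mult_ac)
    also have "\<dots> = (norm (B *v x))\<^sup>2"
      using orthonormal_basis_norm_sq[OF q, of "g x"] by (simp add: Bg)
    finally show ?thesis by simp
  qed
  have "radial_potential n u B = radial_potential n u A"
    by (simp add: radial_potential_def det norm)
  moreover have "det B \<noteq> 0" using det A(1) by auto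
  ultimately show thesis
    using A(2) q lpos l by (intro that[of B q a]) (auto simp: Bg gq a_def)
qed

text \<open>After cross-multiplication, the weights of the indices below k are bounded below by
  \<open>a k\<close>, the others above by \<open>a k\<close>: decreasing weights shift a probability
  vector towards its first entries.\<close>

lemma reweighting_prefix_sum_mono:
  fixes c a :: "nat \<Rightarrow> real"
  assumes c: "\<And>j. j < d \<Longrightarrow> 0 \<le> c j" and "(\<Sum>j<d. c j) = 1"
    and a: "\<And>j. j < d \<Longrightarrow> 0 \<le> a j" "\<And>i j. i \<le> j \<Longrightarrow> j < d \<Longrightarrow> a j \<le> a i"
    and "0 < (\<Sum>j<d. a j * c j)" and "k \<le> d"
  shows "(\<Sum>j<k. c j) \<le> (\<Sum>j<k. a j * c j) / (\<Sum>j<d. a j * c j)"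
proof (cases "k = d")
  case True
  then show ?thesis using assms by simp
next
  case False
  with \<open>k \<le> d\<close> have "k < d" by simp
  have split: "(\<Sum>j<d. h j) = (\<Sum>j<k. h j) + (\<Sum>j\<in>{k..<d}. h j)" for h :: "nat \<Rightarrow> real"
    using sum.atLeastLessThan_concat[of 0 k d h] \<open>k \<le> d\<close> by (simp add: atLeast0LessThan)
  have "(\<Sum>j<k. c j) * (\<Sum>j\<in>{k..<d}. a j * c j) \<le> (\<Sum>j<k. c j) * (\<Sum>j\<in>{k..<d}. a k * c j)"
    using c a \<open>k < d\<close> by (intro mult_left_mono sum_mono mult_right_mono sum_nonneg) auto
  also have "\<dots> = (\<Sum>j<k. a k * c j) * (\<Sum>j\<in>{k..<d}. c j)"
    by (simp add: sum_distrib_left[symmetric])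
  also have "\<dots> \<le> (\<Sum>j<k. a j * c j) * (\<Sum>j\<in>{k..<d}. c j)"
    using c a \<open>k < d\<close> by (intro mult_right_mono sum_mono sum_nonneg) auto
  finally have "(\<Sum>j<k. c j) * (\<Sum>j<d. a j * c j) \<le> (\<Sum>j<k. a j * c j) * (\<Sum>j<d. c j)"
    by (simp only: split[of "\<lambda>j. a j * c j"] split[of c]) (simp add: algebra_simps)
  then show ?thesis
    using assms by (simp add: pos_le_divide_eq)
qed

text \<open>Each entry is a difference of two consecutive prefix sums, both nonnegative, hence at
  most their sum in absolute value. As the empty and the full prefix sum vanish, the two shifted
  sums agree.\<close>

lemma sum_abs_diff_le_prefix_sums:
  fixes h :: "nat \<Rightarrow> real"
  assumes "\<And>k. k \<le> d \<Longrightarrow> 0 \<le> (\<Sum>j<k. h j)" and "(\<Sum>j<d. h j) = 0"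
  shows "(\<Sum>j<d. \<bar>h j\<bar>) \<le> 2 * (\<Sum>k<d. \<Sum>j<k. h j)"
proof -
  have "(\<Sum>j<d. \<bar>h j\<bar>) \<le> (\<Sum>k<d. (\<Sum>j<Suc k. h j) + (\<Sum>j<k. h j))"
  proof (rule sum_mono)
    fix k assume "k \<in> {..<d}"
    then show "\<bar>h k\<bar> \<le> (\<Sum>j<Suc k. h j) + (\<Sum>j<k. h j)"
      using assms(1)[of k] assms(1)[of "Suc k"] by auto
  qed
  also have "\<dots> = (\<Sum>k<d. \<Sum>j<Suc k. h j) + (\<Sum>k<d. \<Sum>j<k. h j)"
    by (rule sum.distrib)
  also have "(\<Sum>k<d. \<Sum>j<Suc k. h j) = (\<Sum>k<Suc d. \<Sum>j<k. h j)"
    by (subst (2) sum.lessThan_Suc_shift) simp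
  also have "\<dots> = (\<Sum>k<d. \<Sum>j<k. h j)"
    using assms(2) by simp
  finally show ?thesis by simp
qed

text \<open>\<open>norm M\<close> is the Frobenius norm, which dominates the l2 norm of the diagonal
  in any orthonormal basis; Cauchy-Schwarz supplies the factor sqrt d.\<close>

lemma sum_orthonormal_quadratic_form_le:
  fixes M :: "real^'d^'d"
  assumes "orthonormal_basis q"
  shows "(\<Sum>j<CARD('d). \<bar>(M *v q j) \<bullet> q j\<bar>) \<le> sqrt CARD('d) * norm M"
proof -
  let ?d = "CARD('d)"
  have qn: "norm (q j) = 1" if "j < ?d" for j
    using assms that by (simp add: orthonormal_basis_def norm_eq_1)
  have nsq: "(norm x)\<^sup>2 = (\<Sum>j<?d. (x \<bullet> q j)\<^sup>2)" for x :: "real^'d"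
    using orthonormal_basis_norm_sq[OF assms, of x] by simp
  have "(\<Sum>j<?d. ((M *v q j) \<bullet> q j)\<^sup>2) \<le> (\<Sum>j<?d. (norm (M *v q j))\<^sup>2)"
  proof (rule sum_mono)
    fix j assume "j \<in> {..<?d}"
    then have "\<bar>(M *v q j) \<bullet> q j\<bar> \<le> norm (M *v q j)"
      using Cauchy_Schwarz_ineq2[of "M *v q j" "q j"] qn by simp
    then show "((M *v q j) \<bullet> q j)\<^sup>2 \<le> (norm (M *v q j))\<^sup>2"
      using abs_le_square_iff[of "(M *v q j) \<bullet> q j" "norm (M *v q j)"] by simp
  qed
  also have "\<dots> = (\<Sum>j<?d. \<Sum>r\<in>UNIV. (M $ r \<bullet> q j)\<^sup>2)"
    unfolding power2_norm_eq_inner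
    by (simp add: inner_vec_def[of "M *v _"] matrix_vector_mul_component power2_eq_square)
  also have "\<dots> = (\<Sum>r\<in>UNIV. (norm (M $ r))\<^sup>2)"
    unfolding nsq by (rule sum.swap)
  also have "\<dots> = (norm M)\<^sup>2"
    by (simp add: power2_norm_eq_inner inner_vec_def[of M])
  finally have *: "(\<Sum>j<?d. ((M *v q j) \<bullet> q j)\<^sup>2) \<le> (norm M)\<^sup>2" .
  have "(\<Sum>j<?d. \<bar>(M *v q j) \<bullet> q j\<bar> * 1)\<^sup>2 \<le> (\<Sum>j<?d. \<bar>(M *v q j) \<bullet> q j\<bar>\<^sup>2) * (\<Sum>j<?d. 1\<^sup>2)"
    by (rule Cauchy_Schwarz_ineq_sum)
  also have "\<dots> \<le> (norm M)\<^sup>2 * ?d"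
    using * by (simp add: mult_right_mono)
  also have "\<dots> = (sqrt ?d * norm M)\<^sup>2"
    by (simp add: power_mult_distrib)
  finally have "(\<Sum>j<?d. \<bar>(M *v q j) \<bullet> q j\<bar> * 1) \<le> sqrt ?d * norm M"
    by (rule power2_le_imp_le) simp
  then show ?thesis by simp
qed

text \<open>The argument of Hamilton and Moitra: moving to radial isotropic position by a positive
  matrix only shifts spectral mass towards the large eigenvalues, so the prefix sums of the shifts
  in the eigenbasis are nonnegative and are controlled by the distance of the frame operator
  from the identity.\<close>

lemma radial_isotropic_close:
  fixes u :: "nat \<Rightarrow> real^'d"
  assumes gp: "general_position n u" and n: "CARD('d) < n" and u: "\<And>i. i < n \<Longrightarrow> norm (u i) = 1"
  obtains v :: "nat \<Rightarrow> real^'d" where "\<And>i. i < n \<Longrightarrow> norm (v i) = 1"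
    and "\<And>w. norm w = 1 \<Longrightarrow> real CARD('d) * (\<Sum>i<n. (v i \<bullet> w)\<^sup>2) = real n"
    and "(\<Sum>i<n. (norm (u i - v i))\<^sup>2)
      \<le> 2 * sqrt CARD('d) * real n * norm ((CARD('d) / real n) *\<^sub>R (\<Sum>i<n. outer (u i)) - mat 1)"
proof -
  let ?d = "CARD('d)"
  obtain B q a where B: "det B \<noteq> 0"
    "\<And>C. det C \<noteq> 0 \<Longrightarrow> radial_potential n u B \<le> radial_potential n u C"
    and q: "orthonormal_basis q" and Bq: "\<And>x j. j < ?d \<Longrightarrow> (B *v x) \<bullet> q j = a j * (x \<bullet> q j)"
    and apos: "\<And>j. j < ?d \<Longrightarrow> 0 < a j" and amono: "\<And>i j. i \<le> j \<Longrightarrow> j < ?d \<Longrightarrow> a j \<le> a i"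
    using radial_potential_psd_minimizer[OF gp n] by blast
  define v where "v i = (1 / norm (B *v u i)) *\<^sub>R (B *v u i)" for i
  have unz: "u i \<noteq> 0" if "i < n" for i using u[OF that] by auto
  have Bu: "B *v u i \<noteq> 0" if "i < n" for i
    using B(1) unz[OF that]
    by (metis inj_matrix_vector_mult injD invertible_det_nz matrix_vector_mult_0_right)
  have v1: "norm (v i) = 1" if "i < n" for i
    using Bu[OF that] by (simp add: v_def)
  have tight: "real ?d * (\<Sum>i<n. (v i \<bullet> w)\<^sup>2) = real n" if "norm w = 1" for w
    using radial_potential_minimizer_tight[OF B unz that] by (simp add: v_def)
  have qn: "norm (q j) = 1" if "j < ?d" for j
    using q that by (simp add: orthonormal_basis_def norm_eq_1)
  define h where "h i j = (v i \<bullet> q j)\<^sup>2 - (u i \<bullet> q j)\<^sup>2" for i j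
  have hsum: "(\<Sum>j<?d. h i j) = 0" if "i < n" for i
    using orthonormal_basis_norm_sq[OF q, of "v i"] orthonormal_basis_norm_sq[OF q, of "u i"] u[OF that] v1[OF that]
    by (simp add: h_def sum_subtractf)
  have hpre: "0 \<le> (\<Sum>j<k. h i j)" if "i < n" "k \<le> ?d" for i k
  proof -
    have nB: "(norm (B *v u i))\<^sup>2 = (\<Sum>j<?d. (a j)\<^sup>2 * (u i \<bullet> q j)\<^sup>2)"
      using orthonormal_basis_norm_sq[OF q, of "B *v u i"] by (simp add: Bq power_mult_distrib)
    have "(\<Sum>j<k. (u i \<bullet> q j)\<^sup>2)
       \<le> (\<Sum>j<k. (a j)\<^sup>2 * (u i \<bullet> q j)\<^sup>2) / (\<Sum>j<?d. (a j)\<^sup>2 * (u i \<bullet> q j)\<^sup>2)"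
    proof (rule reweighting_prefix_sum_mono)
      show "(\<Sum>j<?d. (u i \<bullet> q j)\<^sup>2) = 1"
        using orthonormal_basis_norm_sq[OF q, of "u i"] u[OF that(1)] by simp
      show "0 < (\<Sum>j<?d. (a j)\<^sup>2 * (u i \<bullet> q j)\<^sup>2)"
        using Bu[OF that(1)] by (simp add: nB[symmetric])
      show "(a j)\<^sup>2 \<le> (a i)\<^sup>2" if "i \<le> j" "j < ?d" for i j
        using amono[OF that] apos[OF that(2)] by (intro power_mono) auto
    qed (use that in auto)
    also have "\<dots> = (\<Sum>j<k. (v i \<bullet> q j)\<^sup>2)"
      unfolding nB[symmetric] sum_divide_distrib
      using that by (intro sum.cong) (simp_all add: v_def Bq power_divide power_mult_distrib)
    finally show ?thesis by (simp add: h_def sum_subtractf)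
  qed
  have dist_le: "(norm (u i - v i))\<^sup>2 \<le> 2 * (\<Sum>k<?d. \<Sum>j<k. h i j)" if "i < n" for i
  proof -
    have "(norm (u i - v i))\<^sup>2 = (\<Sum>j<?d. (u i \<bullet> q j - v i \<bullet> q j)\<^sup>2)"
      using orthonormal_basis_norm_sq[OF q, of "u i - v i"] by (simp add: inner_diff_left)
    also have "\<dots> \<le> (\<Sum>j<?d. \<bar>h i j\<bar>)"
    proof (rule sum_mono)
      fix j assume "j \<in> {..<?d}"
      then have j: "j < ?d" by simp
      define x y where "x = u i \<bullet> q j" and "y = v i \<bullet> q j"
      have "y = (a j / norm (B *v u i)) * x"
        by (simp add: x_def y_def v_def Bq[OF j])
      then have "x * y = (a j / norm (B *v u i)) * (x * x)"
        by simp
      \<comment> \<open>Positivity of B enters here: coordinates in its eigenbasis keep their sign,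
        and for numbers without opposite signs (x - y)^2 <= |x^2 - y^2|.\<close>
      then have "0 \<le> x * y"
        using apos[OF j] by (simp only:) (intro mult_nonneg_nonneg[OF _ zero_le_square], simp)
      then have "\<bar>x - y\<bar> \<le> \<bar>y + x\<bar>"
        by (auto simp: zero_le_mult_iff)
      then have "(x - y)\<^sup>2 \<le> \<bar>y + x\<bar> * \<bar>x - y\<bar>"
        using mult_right_mono[of "\<bar>x - y\<bar>" "\<bar>y + x\<bar>" "\<bar>x - y\<bar>"] by (simp add: power2_eq_square)
      also have "\<dots> = \<bar>(y + x) * (y - x)\<bar>"
        by (simp add: abs_mult abs_minus_commute)
      also have "(y + x) * (y - x) = y\<^sup>2 - x\<^sup>2"
        by (simp add: power2_eq_square algebra_simps)
      finally show "(u i \<bullet> q j - v i \<bullet> q j)\<^sup>2 \<le> \<bar>h i j\<bar>"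
        by (simp add: h_def x_def y_def)
    qed
    also have "\<dots> \<le> 2 * (\<Sum>k<?d. \<Sum>j<k. h i j)"
      using hpre[OF that] hsum[OF that] by (rule sum_abs_diff_le_prefix_sums)
    finally show ?thesis .
  qed
  define M where "M = (?d / real n) *\<^sub>R (\<Sum>i<n. outer (u i)) - mat 1"
  have Mq: "(M *v w) \<bullet> w = (?d / real n) * (\<Sum>i<n. (u i \<bullet> w)\<^sup>2) - (norm w)\<^sup>2" for w
  proof -
    have "(\<Sum>i<n. outer (u i)) *v w = (\<Sum>i<n. (u i \<bullet> w) *\<^sub>R u i)"
      by (induction n) (simp_all add: matrix_vector_mult_add_rdistrib outer_mult_vec)
    moreover have "(\<Sum>i<n. (u i \<bullet> w) *\<^sub>R u i) \<bullet> w = (\<Sum>i<n. (u i \<bullet> w)\<^sup>2)"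
      by (simp add: inner_sum_left power2_eq_square)
    ultimately show ?thesis
      by (simp add: M_def matrix_vector_mult_diff_rdistrib scaleR_matrix_vector_assoc[symmetric]
          inner_diff_left dot_square_norm)
  qed
  \<comment> \<open>The target carries exactly n / d in every direction, so the total shift along
    \<open>q j\<close> is determined by the initial deviation M alone.\<close>
  have hj: "(\<Sum>i<n. h i j) = (real n / ?d) * (- ((M *v q j) \<bullet> q j))" if "j < ?d" for j
  proof -
    have "(\<Sum>i<n. (v i \<bullet> q j)\<^sup>2) = real n / ?d"
      using tight[OF qn[OF that]] by (simp add: field_simps)
    moreover have "(real n / ?d) * ((M *v q j) \<bullet> q j) = (\<Sum>i<n. (u i \<bullet> q j)\<^sup>2) - real n / ?d"
      using n by (simp add: Mq qn[OF that] field_simps)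
    ultimately show ?thesis by (simp add: h_def sum_subtractf)
  qed
  have "(\<Sum>i<n. (norm (u i - v i))\<^sup>2) \<le> (\<Sum>i<n. 2 * (\<Sum>k<?d. \<Sum>j<k. h i j))"
    using dist_le by (intro sum_mono) auto
  also have "\<dots> = 2 * (\<Sum>k<?d. \<Sum>j<k. \<Sum>i<n. h i j)"
  proof -
    have "(\<Sum>i<n. \<Sum>k<?d. \<Sum>j<k. h i j) = (\<Sum>k<?d. \<Sum>i<n. \<Sum>j<k. h i j)"
      by (rule sum.swap)
    also have "\<dots> = (\<Sum>k<?d. \<Sum>j<k. \<Sum>i<n. h i j)"
      by (rule sum.cong[OF refl], rule sum.swap)
    finally show ?thesis by (simp only: sum_distrib_left[symmetric])
  qed
  \<comment> \<open>Every prefix is bounded by the full sum of absolute values; the number d of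
    prefixes then cancels the factor 1 / d.\<close>
  also have "(\<Sum>k<?d. \<Sum>j<k. \<Sum>i<n. h i j) \<le> (\<Sum>k<?d. (real n / ?d) * (sqrt ?d * norm M))"
  proof (rule sum_mono)
    fix k assume "k \<in> {..<?d}"
    have "(\<Sum>j<k. \<Sum>i<n. h i j) \<le> (\<Sum>j<k. (real n / ?d) * \<bar>(M *v q j) \<bullet> q j\<bar>)"
    proof (intro sum_mono)
      fix j assume "j \<in> {..<k}"
      then have "j < ?d" using \<open>k \<in> {..<?d}\<close> by simp
      show "(\<Sum>i<n. h i j) \<le> (real n / ?d) * \<bar>(M *v q j) \<bullet> q j\<bar>"
        unfolding hj[OF \<open>j < ?d\<close>] by (rule mult_left_mono) auto
    qed
    also have "\<dots> \<le> (\<Sum>j<?d. (real n / ?d) * \<bar>(M *v q j) \<bullet> q j\<bar>)"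
      using \<open>k \<in> {..<?d}\<close> by (intro sum_mono2) auto
    also have "\<dots> \<le> (real n / ?d) * (sqrt ?d * norm M)"
      unfolding sum_distrib_left[symmetric]
      by (intro mult_left_mono sum_orthonormal_quadratic_form_le[OF q]) auto
    finally show "(\<Sum>j<k. \<Sum>i<n. h i j) \<le> (real n / ?d) * (sqrt ?d * norm M)" .
  qed
  also have "(\<Sum>k<?d. (real n / ?d) * (sqrt ?d * norm M)) = real n * (sqrt ?d * norm M)"
    by simp
  finally have "(\<Sum>i<n. (norm (u i - v i))\<^sup>2) \<le> 2 * sqrt ?d * real n * norm M"
    by (simp add: mult_ac)
  with v1 tight show thesis
    unfolding M_def by (rule that)
qed

section \<open>Distance to the equal-norm Parseval frames\<close>

text \<open>A finite union of proper subspaces is a null set, whereas a ball is not. Normalising the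
  point found moves it by at most its distance to u, hence the radius \<eta> / 2, and does not bring
  it into a subspace.\<close>

lemma exists_close_unit_avoiding:
  fixes u :: "real^'d"
  assumes "finite F" "\<And>S. S \<in> F \<Longrightarrow> subspace S \<and> dim S < CARD('d)" "norm u = 1" "0 < \<eta>"
  shows "\<exists>p. norm p = 1 \<and> norm (p - u) < \<eta> \<and> (\<forall>S\<in>F. p \<notin> S)"
proof -
  have "negligible (\<Union>F)"
    using assms(1,2) by (intro negligible_Union) (auto intro: negligible_lowdim)
  then have "negligible (insert 0 (\<Union>F))"
    by simp
  moreover have "\<not> negligible (ball u (\<eta> / 2))"
    using assms(4) by (intro open_not_negligible) auto
  ultimately obtain z where z: "z \<in> ball u (\<eta> / 2)" "z \<notin> insert 0 (\<Union>F)"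
    by (metis negligible_subset subsetI)
  define p where "p = (1 / norm z) *\<^sub>R z"
  have "z \<noteq> 0" using z(2) by auto
  have "norm (p - z) = \<bar>norm z - norm u\<bar>"
  proof -
    have "p - z = ((1 - norm z) / norm z) *\<^sub>R z"
      using \<open>z \<noteq> 0\<close> by (simp add: p_def diff_divide_distrib scaleR_diff_left)
    then have "norm (p - z) = \<bar>1 - norm z\<bar>"
      using \<open>z \<noteq> 0\<close> by simp
    then show ?thesis using assms(3) by simp
  qed
  also have "\<dots> \<le> norm (z - u)"
    by (rule norm_triangle_ineq3)
  finally have "norm (p - u) \<le> norm (z - u) + norm (z - u)"
    using norm_triangle_ineq[of "p - z" "z - u"] by simp
  also have "\<dots> < \<eta>"
    using z(1) by (simp add: dist_norm norm_minus_commute)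
  finally have "norm (p - u) < \<eta>" .
  moreover have "p \<notin> S" if "S \<in> F" for S
  proof
    assume "p \<in> S"
    then have "norm z *\<^sub>R p \<in> S"
      using assms(2)[OF that] by (simp add: subspace_scale)
    then show False using z(2) that \<open>z \<noteq> 0\<close> by (auto simp: p_def)
  qed
  moreover have "norm p = 1" using \<open>z \<noteq> 0\<close> by (simp add: p_def)
  ultimately show ?thesis by blast
qed

text \<open>The vectors are perturbed one after another, each avoiding the finitely many spans of
  fewer than d of its predecessors. Injectivity is carried along because independence of an image
  set does not exclude repeated vectors.\<close>

lemma general_position_dense:
  fixes u :: "nat \<Rightarrow> real^'d"
  assumes u: "\<And>i. i < n \<Longrightarrow> norm (u i) = 1" and "0 < \<eta>"
  shows "\<exists>u'. general_position n u' \<and> (\<forall>i<n. norm (u' i) = 1 \<and> norm (u' i - u i) < \<eta>)"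
proof -
  let ?d = "CARD('d)"
  have "\<exists>u'. (\<forall>i<m. norm (u' i) = 1 \<and> norm (u' i - u i) < \<eta>) \<and>
      (\<forall>I\<subseteq>{..<m}. card I \<le> ?d \<longrightarrow> inj_on u' I \<and> independent (u' ` I))" if "m \<le> n" for m
    using that
  proof (induction m)
    case 0
    then show ?case by (auto simp: independent_empty)
  next
    case (Suc m)
    then obtain u' where u': "\<And>i. i < m \<Longrightarrow> norm (u' i) = 1 \<and> norm (u' i - u i) < \<eta>"
      "\<And>I. I \<subseteq> {..<m} \<Longrightarrow> card I \<le> ?d \<Longrightarrow> inj_on u' I \<and> independent (u' ` I)"
      by auto
    define F where "F = (\<lambda>I. span (u' ` I)) ` {I. I \<subseteq> {..<m} \<and> card I < ?d}"
    have "finite F" by (simp add: F_def)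
    moreover have "subspace S \<and> dim S < ?d" if S: "S \<in> F" for S
    proof -
      obtain I where I: "S = span (u' ` I)" "I \<subseteq> {..<m}" "card I < ?d"
        using S by (auto simp: F_def)
      have "finite I" using I(2) finite_subset by blast
      then have "dim (u' ` I) \<le> card I"
        by (metis card_image_le dim_le_card' finite_imageI le_trans)
      then show ?thesis using I by simp
    qed
    ultimately obtain p where p: "norm p = 1" "norm (p - u m) < \<eta>" "\<And>S. S \<in> F \<Longrightarrow> p \<notin> S"
      using exists_close_unit_avoiding[of F "u m" \<eta>] u[of m] Suc.prems \<open>0 < \<eta>\<close> by auto
    let ?u = "u'(m := p)"
    have "inj_on ?u I \<and> independent (?u ` I)" if I: "I \<subseteq> {..<Suc m}" "card I \<le> ?d" for I
    proof (cases "m \<in> I")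
      case False
      then have "I \<subseteq> {..<m}" using I(1) by (auto simp: less_Suc_eq)
      moreover have "inj_on ?u I = inj_on u' I" "?u ` I = u' ` I"
        using False by (auto intro!: inj_on_cong image_cong)
      ultimately show ?thesis using u'(2) I(2) by simp
    next
      case True
      define J where "J = I - {m}"
      have J: "J \<subseteq> {..<m}" "I = insert m J" "m \<notin> J"
        using True I(1) by (auto simp: J_def less_Suc_eq)
      then have "finite J" using finite_subset by blast
      then have "card J < ?d" using I(2) J by simp
      then have "p \<notin> span (u' ` J)"
        using p(3) J(1) by (auto simp: F_def)
      moreover have "inj_on u' J" "independent (u' ` J)"
        using u'(2)[OF J(1)] \<open>card J < ?d\<close> by auto
      moreover have "?u ` J = u' ` J" "inj_on ?u J = inj_on u' J"
        using J(3) by (auto intro!: inj_on_cong image_cong)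
      ultimately show ?thesis
        using J(2,3) by (auto simp: independent_insertI span_base)
    qed
    moreover have "\<forall>i<Suc m. norm (?u i) = 1 \<and> norm (?u i - u i) < \<eta>"
      using u'(1) p by (auto simp: less_Suc_eq)
    ultimately show ?case by blast
  qed
  then obtain u' where u': "\<And>i. i < n \<Longrightarrow> norm (u' i) = 1 \<and> norm (u' i - u i) < \<eta>"
      "\<And>I. I \<subseteq> {..<n} \<Longrightarrow> card I \<le> ?d \<Longrightarrow> inj_on u' I \<and> independent (u' ` I)"
    by blast
  have "det (\<chi> j. u' (\<sigma> j)) \<noteq> 0" if \<sigma>: "inj \<sigma>" "range \<sigma> \<subseteq> {..<n}" for \<sigma> :: "'d \<Rightarrow> nat"
  proof -
    let ?U = "\<chi> j. u' (\<sigma> j)"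
    have "inj_on u' (range \<sigma>)" "independent (u' ` range \<sigma>)"
      using u'(2)[OF \<sigma>(2)] \<sigma>(1) by (auto simp: card_image)
    then have inj: "inj (u' \<circ> \<sigma>)" and ind: "independent (range (u' \<circ> \<sigma>))"
      using \<sigma>(1) by (auto intro: comp_inj_on simp: image_comp)
    have "\<forall>i. c i = 0" if c: "(\<Sum>i\<in>UNIV. c i *s row i ?U) = 0" for c
    proof -
      \<comment> \<open>Transports the coefficients from indices to vectors, since independence is a
        statement about a set of vectors and row independence one about indices.\<close>
      let ?g = "\<lambda>v. c (the_inv_into UNIV (u' \<circ> \<sigma>) v)"
      have g: "?g ((u' \<circ> \<sigma>) i) = c i" for i
        using inj by (simp add: the_inv_into_f_f del: o_apply)
      have "(\<Sum>v\<in>range (u' \<circ> \<sigma>). ?g v *\<^sub>R v) = (\<Sum>i\<in>UNIV. c i *\<^sub>R (u' \<circ> \<sigma>) i)"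
        unfolding sum.reindex[OF inj] o_def[of "\<lambda>v. ?g v *\<^sub>R v" "u' \<circ> \<sigma>"] by (simp only: g)
      also have "\<dots> = 0"
        using c by (simp add: row_def scalar_mult_eq_scaleR)
      finally have "?g v = 0" if "v \<in> range (u' \<circ> \<sigma>)" for v
        using independentD[OF ind, of "range (u' \<circ> \<sigma>)" ?g v] that by simp
      then show ?thesis by (metis g rangeI)
    qed
    then have "\<exists>B. ?U ** B = mat 1"
      by (simp add: matrix_right_invertible_independent_rows)
    then show ?thesis
      by (metis det_I det_mul mult_zero_left zero_neq_one)
  qed
  then show ?thesis
    using u'(1) by (auto simp: general_position_def)
qed

text \<open>For unit vectors u this is the deviation from the identity of the frame operator of the
  rescaled vectors sqrt (d / n) u, to be measured in the Frobenius norm.\<close>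

definition gram_deviation :: "nat \<Rightarrow> (nat \<Rightarrow> real^'d) \<Rightarrow> real^'d^'d" where
  "gram_deviation n u = (CARD('d) / real n) *\<^sub>R (\<Sum>i<n. outer (u i)) - mat 1"

lemma norm_outer_product: "norm (\<chi> i j. (x :: real^'d) $ i * (y :: real^'d) $ j) = norm x * norm y"
proof -
  have "(\<chi> i j. x $ i * y $ j) = (\<chi> i. x $ i *\<^sub>R y)"
    by (simp add: vec_eq_iff)
  then have "norm (\<chi> i j. x $ i * y $ j) = L2_set (\<lambda>i. \<bar>x $ i\<bar> * norm y) UNIV"
    by (simp add: norm_vec_def[of "\<chi> i. x $ i *\<^sub>R y"])
  also have "\<dots> = norm x * norm y"
    by (simp add: L2_set_left_distrib[symmetric] norm_vec_def[of x])
  finally show ?thesis .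
qed

lemma norm_outer: "norm (outer x) = (norm x)\<^sup>2"
  by (simp add: outer_def norm_outer_product power2_eq_square)

lemma norm_outer_diff_le: "norm (outer x - outer y) \<le> (norm x + norm y) * norm (x - y)"
proof -
  have "outer x - outer y = (\<chi> i j. x $ i * (x - y) $ j) + (\<chi> i j. (x - y) $ i * y $ j)"
    by (simp add: outer_def vec_eq_iff algebra_simps)
  also have "norm \<dots> \<le> norm x * norm (x - y) + norm (x - y) * norm y"
    by (rule order.trans[OF norm_triangle_ineq]) (simp only: norm_outer_product order.refl)
  finally show ?thesis by (simp add: algebra_simps)
qed

lemma norm_gram_deviation_perturb:
  fixes u v :: "nat \<Rightarrow> real^'d"
  assumes "\<And>i. i < n \<Longrightarrow> norm (u i) = 1" "\<And>i. i < n \<Longrightarrow> norm (v i) = 1"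
    and "\<And>i. i < n \<Longrightarrow> norm (v i - u i) \<le> \<eta>" and "0 < n"
  shows "norm (gram_deviation n v) \<le> norm (gram_deviation n u) + 2 * real CARD('d) * \<eta>"
proof -
  have "gram_deviation n v - gram_deviation n u
     = (CARD('d) / real n) *\<^sub>R (\<Sum>i<n. outer (v i) - outer (u i))"
    by (simp add: gram_deviation_def sum_subtractf scaleR_diff_right)
  also have "norm \<dots> \<le> (CARD('d) / real n) * (\<Sum>i<n. norm (outer (v i) - outer (u i)))"
    by (simp add: divide_right_mono mult_left_mono norm_sum)
  also have "\<dots> \<le> (CARD('d) / real n) * (\<Sum>i<n. 2 * \<eta>)"
  proof (intro mult_left_mono sum_mono)
    fix i assume "i \<in> {..<n}"
    then show "norm (outer (v i) - outer (u i)) \<le> 2 * \<eta>"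
      using norm_outer_diff_le[of "v i" "u i"] assms(1-3)[of i] by auto
  qed simp
  also have "\<dots> = 2 * real CARD('d) * \<eta>"
    using \<open>0 < n\<close> by simp
  finally show ?thesis
    using norm_triangle_ineq2[of "gram_deviation n v" "gram_deviation n u"] by linarith
qed

section \<open>Frame operators, spanning, and the frame distance\<close>

lemma frame_operator_eq_sum_outer: "frame_operator n x = (\<Sum>i<n. outer (x i))"
  unfolding frame_operator_def
  by (intro sum.cong refl)
     (simp add: outer_def vec_eq_iff matrix_matrix_mult_def columnvector_def rowvector_def)

lemma frame_operator_mult_vec: "frame_operator n x *v w = (\<Sum>i<n. (x i \<bullet> w) *\<^sub>R x i)"
  unfolding frame_operator_eq_sum_outer
  by (induction n) (simp_all add: matrix_vector_mult_add_rdistrib outer_mult_vec)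

lemma frame_operator_inner: "(frame_operator n x *v w) \<bullet> z = (\<Sum>i<n. (x i \<bullet> w) * (x i \<bullet> z))"
  by (simp add: frame_operator_mult_vec inner_sum_left)

text \<open>Homogeneity extends the hypothesis to all w, and polarisation recovers the bilinear form
  from its quadratic form.\<close>

lemma frame_operator_eq_mat_1I:
  fixes y :: "nat \<Rightarrow> real^'d"
  assumes "\<And>w. norm w = 1 \<Longrightarrow> (\<Sum>i<n. (y i \<bullet> w)\<^sup>2) = 1"
  shows "frame_operator n y = mat 1"
proof -
  have quad: "(\<Sum>i<n. (y i \<bullet> w)\<^sup>2) = (norm w)\<^sup>2" for w
  proof (cases "w = 0")
    case False
    have "(\<Sum>i<n. (y i \<bullet> w)\<^sup>2) / (norm w)\<^sup>2 = (\<Sum>i<n. (y i \<bullet> ((1 / norm w) *\<^sub>R w))\<^sup>2)"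
      by (simp add: power_divide sum_divide_distrib)
    also have "\<dots> = 1"
      using False by (intro assms) simp
    finally show ?thesis using False by simp
  qed simp
  have "(frame_operator n y *v w) \<bullet> z = w \<bullet> z" for w z
  proof -
    have "4 * ((frame_operator n y *v w) \<bullet> z) = (\<Sum>i<n. (y i \<bullet> (w + z))\<^sup>2) - (\<Sum>i<n. (y i \<bullet> (w - z))\<^sup>2)"
      unfolding frame_operator_inner sum_distrib_left sum_subtractf[symmetric]
      by (intro sum.cong refl) (simp add: inner_add_right inner_diff_right power2_eq_square algebra_simps)
    also have "\<dots> = 4 * (w \<bullet> z)"
      unfolding quad power2_norm_eq_inner
      by (simp add: inner_add_left inner_add_right inner_diff_left inner_diff_right inner_commute)
    finally show ?thesis by simp
  qed
  then have "frame_operator n y *v w = w" for w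
    by (metis vector_eq_ldot inner_commute)
  then show ?thesis by (simp add: matrix_eq)
qed

lemma frames_if_frame_operator_inner_pos:
  fixes x :: "nat \<Rightarrow> real^'d"
  assumes "x \<in> extensional {..<n}" and "\<And>w. w \<noteq> 0 \<Longrightarrow> 0 < (frame_operator n x *v w) \<bullet> w"
  shows "x \<in> frames n"
proof -
  have "dim (x ` {..<n}) = DIM(real^'d)"
  proof (rule ccontr)
    assume "dim (x ` {..<n}) \<noteq> DIM(real^'d)"
    then have "dim (x ` {..<n}) < DIM(real^'d)"
      using dim_subset_UNIV[of "x ` {..<n}"] by linarith
    then obtain w where w: "w \<noteq> 0" "\<And>y. y \<in> span (x ` {..<n}) \<Longrightarrow> orthogonal w y"
      using orthogonal_to_subspace_exists by blast
    then have "x i \<bullet> w = 0" if "i < n" for i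
      using w(2)[OF span_base[of "x i"]] that by (auto simp: orthogonal_def inner_commute)
    then have "(frame_operator n x *v w) \<bullet> w = 0"
      by (simp add: frame_operator_inner)
    with assms(2)[OF w(1)] show False by simp
  qed
  then have "span (x ` {..<n}) = UNIV"
    by (simp only: dim_eq_full)
  with assms(1) show ?thesis by (simp add: frames_def)
qed

lemma frame_dist_eq_L2_set: "frame_dist n x y = L2_set (\<lambda>i. norm (x i - y i)) {..<n}"
  by (simp add: frame_dist_def L2_set_def)

lemma frame_dist_triangle: "frame_dist n x z \<le> frame_dist n x y + frame_dist n y z"
proof -
  have "frame_dist n x z \<le> L2_set (\<lambda>i. norm (x i - y i) + norm (y i - z i)) {..<n}"
    unfolding frame_dist_eq_L2_set
    using norm_triangle_ineq[of "x i - y i" "y i - z i" for i] by (intro L2_set_mono) auto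
  also have "\<dots> \<le> frame_dist n x y + frame_dist n y z"
    unfolding frame_dist_eq_L2_set by (rule L2_set_triangle_ineq)
  finally show ?thesis .
qed

lemma frame_dist_commute: "frame_dist n x y = frame_dist n y x"
  by (simp add: frame_dist_def norm_minus_commute)

text \<open>With \<rho> the target length, | |x| - \<rho> | \<rho> is at most | |x|^2 - \<rho>^2 |,
  and this is at most \<epsilon> \<rho>^2 on the shell.\<close>

lemma shell_normalisation_close:
  fixes x :: "real^'d" and \<epsilon> :: real
  assumes "x \<in> shell \<epsilon> n" "0 \<le> \<epsilon>" "0 < n" "x \<noteq> 0"
  shows "(norm (x - sqrt (CARD('d) / real n) *\<^sub>R (1 / norm x) *\<^sub>R x))\<^sup>2 \<le> \<epsilon>\<^sup>2 * CARD('d) / real n"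
proof -
  define \<rho> where "\<rho> = sqrt (CARD('d) / real n)"
  have \<rho>: "\<rho> > 0" "\<rho>\<^sup>2 = CARD('d) / real n" using \<open>0 < n\<close> by (auto simp: \<rho>_def)
  have "x - \<rho> *\<^sub>R (1 / norm x) *\<^sub>R x = ((norm x - \<rho>) / norm x) *\<^sub>R x"
    using \<open>x \<noteq> 0\<close> by (simp add: diff_divide_distrib scaleR_diff_left)
  then have "norm (x - \<rho> *\<^sub>R (1 / norm x) *\<^sub>R x) = \<bar>norm x - \<rho>\<bar>"
    using \<open>x \<noteq> 0\<close> by simp
  moreover have "\<bar>norm x - \<rho>\<bar> \<le> \<epsilon> * \<rho>"
  proof -
    have "\<bar>norm x - \<rho>\<bar> * \<rho> \<le> \<bar>norm x - \<rho>\<bar> * (norm x + \<rho>)"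
      by (intro mult_left_mono) auto
    also have "\<dots> = \<bar>(norm x - \<rho>) * (norm x + \<rho>)\<bar>"
      using \<rho>(1) by (simp add: abs_mult)
    also have "(norm x - \<rho>) * (norm x + \<rho>) = (norm x)\<^sup>2 - \<rho>\<^sup>2"
      by (simp add: power2_eq_square algebra_simps)
    also have "\<bar>(norm x)\<^sup>2 - \<rho>\<^sup>2\<bar> \<le> \<epsilon> * \<rho>\<^sup>2"
    proof -
      have "(1 - \<epsilon>) * \<rho>\<^sup>2 \<le> (norm x)\<^sup>2" "(norm x)\<^sup>2 \<le> (1 + \<epsilon>) * \<rho>\<^sup>2"
        using assms(1) unfolding shell_def \<rho>(2) by auto
      then show ?thesis by (auto simp: abs_le_iff algebra_simps)
    qed
    finally show ?thesis using \<rho>(1) by (simp add: power2_eq_square)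
  qed
  ultimately have "(norm (x - \<rho> *\<^sub>R (1 / norm x) *\<^sub>R x))\<^sup>2 \<le> (\<epsilon> * \<rho>)\<^sup>2"
    by (intro power_mono) (simp_all only: norm_ge_zero)
  then show ?thesis
    by (simp add: \<rho>_def[symmetric] power_mult_distrib \<rho>(2))
qed

text \<open>Three moves are added by the triangle inequality: equalising lengths costs \<epsilon>
  sqrt d, perturbing into general position costs sqrt d \<eta>, and passing to radial isotropic
  position costs the root of 2 d sqrt d times the deviation. The deviation 10 \<epsilon>^2 / sqrt d
  contributes 20 \<epsilon>^2 d under that root.\<close>

lemma exists_ENP_frame_close:
  fixes x :: "nat \<Rightarrow> real^'d"
  assumes n: "CARD('d) < n" and \<epsilon>: "0 < \<epsilon>" "\<epsilon> < 1"
    and x: "\<And>i. i < n \<Longrightarrow> x i \<in> shell \<epsilon> n"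
    and dev: "norm (gram_deviation n (\<lambda>i. (1 / norm (x i)) *\<^sub>R x i)) \<le> 10 * \<epsilon>\<^sup>2 / sqrt CARD('d)"
  shows "\<exists>y\<in>ENP_frames n. frame_dist n x y < (sqrt 20 + sqrt 2) * \<epsilon> * sqrt CARD('d)"
proof -
  let ?d = "real CARD('d)"
  have d: "?d > 0" and n0: "n > 0" using n by auto
  define \<rho> where "\<rho> = sqrt (?d / real n)"
  have \<rho>: "\<rho> > 0" "\<rho>\<^sup>2 = ?d / real n" using n0 by (auto simp: \<rho>_def)
  have xnz: "x i \<noteq> 0" if "i < n" for i
  proof
    assume "x i = 0"
    then have "(1 - \<epsilon>) * (?d / real n) \<le> 0"
      using x[OF that] by (simp add: shell_def)
    moreover have "0 < (1 - \<epsilon>) * (?d / real n)"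
      using \<epsilon> n0 d by (intro mult_pos_pos divide_pos_pos) auto
    ultimately show False by linarith
  qed
  define u where "u i = (1 / norm (x i)) *\<^sub>R x i" for i
  have u: "norm (u i) = 1" if "i < n" for i
    using xnz[OF that] by (simp add: u_def)
  text \<open>Perturbing \<open>u\<close> into general position costs an arbitrarily small \<open>\<eta>\<close>, absorbed by
    \<open>sqrt 2 > 1\<close>.\<close>
  have "((\<lambda>\<eta>. sqrt (4 * ?d\<^sup>2 * sqrt ?d * \<eta>) + sqrt ?d * \<eta>) \<longlongrightarrow> sqrt (4 * ?d\<^sup>2 * sqrt ?d * 0) + sqrt ?d * 0) (at_right 0)"
    by (intro tendsto_intros)
  then have "\<forall>\<^sub>F \<eta> in at_right 0. sqrt (4 * ?d\<^sup>2 * sqrt ?d * \<eta>) + sqrt ?d * \<eta> < (sqrt 2 - 1) * \<epsilon> * sqrt ?d"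
    using \<epsilon> by (intro order_tendstoD(2)) auto
  then have "\<forall>\<^sub>F \<eta> in at_right 0. 0 < \<eta> \<and> sqrt (4 * ?d\<^sup>2 * sqrt ?d * \<eta>) + sqrt ?d * \<eta> < (sqrt 2 - 1) * \<epsilon> * sqrt ?d"
    using eventually_at_right_less by (rule eventually_conj[rotated])
  then obtain \<eta> where \<eta>: "0 < \<eta>" "sqrt (4 * ?d\<^sup>2 * sqrt ?d * \<eta>) + sqrt ?d * \<eta> < (sqrt 2 - 1) * \<epsilon> * sqrt ?d"
    using eventually_happens'[OF trivial_limit_at_right_real] by blast
  obtain u' where u': "general_position n u'" "\<And>i. i < n \<Longrightarrow> norm (u' i) = 1"
    "\<And>i. i < n \<Longrightarrow> norm (u' i - u i) < \<eta>"
    using general_position_dense[of n u \<eta>] u \<eta>(1) by blast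
  obtain v where v: "\<And>i. i < n \<Longrightarrow> norm (v i) = 1"
    "\<And>w. norm w = 1 \<Longrightarrow> ?d * (\<Sum>i<n. (v i \<bullet> w)\<^sup>2) = real n"
    "(\<Sum>i<n. (norm (u' i - v i))\<^sup>2) \<le> 2 * sqrt ?d * real n * norm (gram_deviation n u')"
    using radial_isotropic_close[OF u'(1) n u'(2)] unfolding gram_deviation_def by blast
  \<comment> \<open>Scaling by \<rho> turns tightness with constant n / d into S = I; the value
    outside the index range makes y extensional.\<close>
  define y where "y i = (if i < n then \<rho> *\<^sub>R v i else undefined)" for i
  have "(\<Sum>i<n. (y i \<bullet> w)\<^sup>2) = 1" if "norm w = 1" for w
  proof -
    have "(\<Sum>i<n. (y i \<bullet> w)\<^sup>2) = (?d / real n) * (\<Sum>i<n. (v i \<bullet> w)\<^sup>2)"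
      by (simp add: y_def power_mult_distrib \<rho>(2) sum_distrib_left)
    then show ?thesis using v(2)[OF that] n0 by simp
  qed
  then have S: "frame_operator n y = mat 1"
    by (rule frame_operator_eq_mat_1I)
  then have "y \<in> frames n"
    by (intro frames_if_frame_operator_inner_pos) (auto simp: y_def extensional_def)
  moreover have "(norm (y i))\<^sup>2 = ?d / real n" if "i < n" for i
    using that v(1)[OF that] \<rho> by (simp add: y_def)
  ultimately have "y \<in> ENP_frames n"
    using S by (simp add: ENP_frames_def)
  define z where "z i = \<rho> *\<^sub>R u i" for i
  define z' where "z' i = \<rho> *\<^sub>R u' i" for i
  have "frame_dist n x z \<le> \<epsilon> * sqrt ?d"
    unfolding frame_dist_def
  proof (rule real_le_lsqrt)
    have "(\<Sum>i<n. (norm (x i - z i))\<^sup>2) \<le> (\<Sum>i<n. \<epsilon>\<^sup>2 * ?d / real n)"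
      using shell_normalisation_close[OF x _ n0 xnz] \<epsilon>
      by (intro sum_mono) (simp add: z_def u_def \<rho>_def)
    also have "\<dots> = (\<epsilon> * sqrt ?d)\<^sup>2"
      using n0 by (simp add: power_mult_distrib)
    finally show "(\<Sum>i<n. (norm (x i - z i))\<^sup>2) \<le> (\<epsilon> * sqrt ?d)\<^sup>2" .
  qed (use \<epsilon> in auto)
  moreover have "frame_dist n z z' \<le> sqrt ?d * \<eta>"
    unfolding frame_dist_def
  proof (rule real_le_lsqrt)
    have "(\<Sum>i<n. (norm (z i - z' i))\<^sup>2) \<le> (\<Sum>i<n. (?d / real n) * \<eta>\<^sup>2)"
    proof (rule sum_mono)
      fix i assume "i \<in> {..<n}"
      then have "(norm (u i - u' i))\<^sup>2 \<le> \<eta>\<^sup>2"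
        using u'(3)[of i] by (intro power_mono) (auto simp: norm_minus_commute)
      moreover have "z i - z' i = \<rho> *\<^sub>R (u i - u' i)"
        by (simp add: z_def z'_def scaleR_diff_right)
      ultimately show "(norm (z i - z' i))\<^sup>2 \<le> (?d / real n) * \<eta>\<^sup>2"
        by (simp add: power_mult_distrib \<rho>(2) divide_right_mono mult_left_mono)
    qed
    also have "\<dots> = (sqrt ?d * \<eta>)\<^sup>2"
      using n0 by (simp add: power_mult_distrib)
    finally show "(\<Sum>i<n. (norm (z i - z' i))\<^sup>2) \<le> (sqrt ?d * \<eta>)\<^sup>2" .
  qed (use \<eta> in auto)
  moreover have "frame_dist n z' y \<le> sqrt 20 * \<epsilon> * sqrt ?d + sqrt (4 * ?d\<^sup>2 * sqrt ?d * \<eta>)"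
  proof -
    have "(\<Sum>i<n. (norm (z' i - y i))\<^sup>2) = (?d / real n) * (\<Sum>i<n. (norm (u' i - v i))\<^sup>2)"
      unfolding sum_distrib_left
      by (intro sum.cong refl) (simp add: z'_def y_def scaleR_diff_right[symmetric] power_mult_distrib \<rho>(2))
    also have "\<dots> \<le> (?d / real n) * (2 * sqrt ?d * real n * norm (gram_deviation n u'))"
      by (intro mult_left_mono v(3)) simp
    also have "\<dots> = 2 * ?d * sqrt ?d * norm (gram_deviation n u')"
      using n0 by simp
    also have "\<dots> \<le> 2 * ?d * sqrt ?d * (10 * \<epsilon>\<^sup>2 / sqrt ?d + 2 * ?d * \<eta>)"
    proof (rule mult_left_mono)
      have "norm (gram_deviation n u') \<le> norm (gram_deviation n u) + 2 * ?d * \<eta>"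
        using u u' n0 by (intro norm_gram_deviation_perturb) (auto simp: less_imp_le)
      then show "norm (gram_deviation n u') \<le> 10 * \<epsilon>\<^sup>2 / sqrt ?d + 2 * ?d * \<eta>"
        using dev unfolding u_def by linarith
    qed simp
    also have "\<dots> = 20 * \<epsilon>\<^sup>2 * ?d + 4 * ?d\<^sup>2 * sqrt ?d * \<eta>"
      using d by (simp add: field_simps power2_eq_square)
    finally have "frame_dist n z' y \<le> sqrt (20 * \<epsilon>\<^sup>2 * ?d + 4 * ?d\<^sup>2 * sqrt ?d * \<eta>)"
      by (simp add: frame_dist_def)
    also have "\<dots> \<le> sqrt (20 * \<epsilon>\<^sup>2 * ?d) + sqrt (4 * ?d\<^sup>2 * sqrt ?d * \<eta>)"
      using \<eta>(1) by (intro sqrt_add_le_add_sqrt) auto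
    also have "sqrt (20 * \<epsilon>\<^sup>2 * ?d) = sqrt 20 * \<epsilon> * sqrt ?d"
      using \<epsilon> by (simp add: real_sqrt_mult)
    finally show ?thesis .
  qed
  ultimately have "frame_dist n x y \<le> \<epsilon> * sqrt ?d + sqrt ?d * \<eta> + (sqrt 20 * \<epsilon> * sqrt ?d + sqrt (4 * ?d\<^sup>2 * sqrt ?d * \<eta>))"
    using frame_dist_triangle[of n x y z] frame_dist_triangle[of n z y z'] by linarith
  also have "\<dots> < \<epsilon> * sqrt ?d + sqrt 20 * \<epsilon> * sqrt ?d + (sqrt 2 - 1) * \<epsilon> * sqrt ?d"
    using \<eta>(2) by linarith
  also have "\<dots> = (sqrt 20 + sqrt 2) * \<epsilon> * sqrt ?d"
    by (simp add: algebra_simps)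
  finally show ?thesis using \<open>y \<in> ENP_frames n\<close> by blast
qed

section \<open>Moments of the uniform measure on the shell\<close>

lemma shell_measurable [measurable]: "(shell \<epsilon> n :: (real^'d) set) \<in> sets borel"
proof -
  have "closed (shell \<epsilon> n :: (real^'d) set)"
    unfolding shell_def by (intro closed_Collect_conj closed_Collect_le continuous_intros)
  then show ?thesis by simp
qed

lemma sets_shell_measure [simp, measurable_cong]: "sets (shell_measure \<epsilon> n :: (real^'d) measure) = sets borel"
  by (simp add: shell_measure_def)

lemma space_shell_measure [simp]: "space (shell_measure \<epsilon> n :: (real^'d) measure) = UNIV"
  by (simp add: shell_measure_def)

lemma emeasure_annulus:
  fixes a b :: real
  assumes "0 \<le> a" "a \<le> b"
  shows "emeasure lborel {x :: 'a::euclidean_space. a \<le> (norm x)\<^sup>2 \<and> (norm x)\<^sup>2 \<le> b}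
     = ennreal (unit_ball_vol (real DIM('a)) * (sqrt b ^ DIM('a) - sqrt a ^ DIM('a)))"
proof -
  have "{x :: 'a. a \<le> (norm x)\<^sup>2 \<and> (norm x)\<^sup>2 \<le> b} = cball 0 (sqrt b) - ball 0 (sqrt a)"
  proof -
    have "c \<le> (norm x)\<^sup>2 \<longleftrightarrow> sqrt c \<le> norm x" "(norm x)\<^sup>2 \<le> c \<longleftrightarrow> norm x \<le> sqrt c" for c :: real and x :: 'a
      using real_sqrt_le_iff[of c "(norm x)\<^sup>2"] real_sqrt_le_iff[of "(norm x)\<^sup>2" c] by simp_all
    then show ?thesis by auto
  qed
  also have "emeasure lborel \<dots> = emeasure lborel (cball (0::'a) (sqrt b)) - emeasure lborel (ball (0::'a) (sqrt a))"
  proof (rule emeasure_Diff)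
    show "ball (0::'a) (sqrt a) \<subseteq> cball 0 (sqrt b)"
      using order.trans[OF less_imp_le real_sqrt_le_mono[OF assms(2)]] by (auto simp del: real_sqrt_le_iff)
  qed (use assms in \<open>auto simp: emeasure_ball\<close>)
  also have "\<dots> = ennreal (unit_ball_vol (real DIM('a)) * (sqrt b ^ DIM('a) - sqrt a ^ DIM('a)))"
    using assms by (simp add: emeasure_cball emeasure_ball right_diff_distrib ennreal_minus[symmetric])
  finally show ?thesis .
qed

text \<open>Changing the sign of one coordinate will make the off-diagonal second moments
  vanish.\<close>

lemma lborel_reflect:
  "distr lborel borel (\<lambda>x :: real^'d. \<chi> i. if i = k then - x $ i else x $ i) = lborel"
proof -
  define c :: "real^'d \<Rightarrow> real" where "c = (\<lambda>b. if b = axis k 1 then -1 else 1)"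
  have "(\<Sum>j\<in>Basis. (c j * (x \<bullet> j)) *\<^sub>R j) = (\<chi> i. if i = k then - x $ i else x $ i)" for x :: "real^'d"
  proof -
    have "(\<Sum>j\<in>Basis. (c j * (x \<bullet> j)) *\<^sub>R j) \<bullet> b = (\<chi> i. if i = k then - x $ i else x $ i) \<bullet> b"
      if b: "b \<in> Basis" for b
    proof -
      obtain i where i: "b = axis i 1" using b by (auto simp: Basis_vec_def)
      have "(\<Sum>j\<in>Basis. (c j * (x \<bullet> j)) *\<^sub>R j) \<bullet> b = c b * (x \<bullet> b)"
        using b by (simp add: inner_sum_left inner_Basis if_distrib sum.delta cong: if_cong)
      then show ?thesis
        by (simp add: i c_def inner_axis axis_eq_axis)
    qed
    then show ?thesis by (rule euclidean_eqI)
  qed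
  then have "lborel = density (distr lborel borel (\<lambda>x :: real^'d. \<chi> i. if i = k then - x $ i else x $ i)) (\<lambda>_. 1)"
    using lborel_affine_euclidean[of c 0] by (simp add: c_def if_distrib prod.If_cases cong: if_cong)
  then show ?thesis by (simp add: density_1)
qed

text \<open>Exchanging two coordinates will make the diagonal second moments equal. Boxes determine
  Lebesgue measure, and the swap permutes their side lengths.\<close>

lemma lborel_swap:
  fixes j k :: "'d::finite"
  shows "distr lborel borel (\<lambda>x :: real^'d. \<chi> i. x $ (Transposition.transpose j k i)) = lborel"
proof (rule lborel_eqI[symmetric])
  let ?T = "\<lambda>x :: real^'d. \<chi> i. x $ (Transposition.transpose j k i)"
  fix l u :: "real^'d" assume le: "\<And>b. b \<in> Basis \<Longrightarrow> l \<bullet> b \<le> u \<bullet> b"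
  then have le': "l $ i \<le> u $ i" for i
    using le[of "axis i 1"] by (simp add: inner_axis)
  have [measurable]: "?T \<in> borel \<rightarrow>\<^sub>M borel"
    by (intro borel_measurable_continuous_onI continuous_intros)
  have basis: "(\<Prod>b\<in>Basis. g \<bullet> b) = (\<Prod>i\<in>UNIV. g $ i)" for g :: "real^'d"
  proof -
    have "(Basis :: (real^'d) set) = range (\<lambda>i. axis i 1)"
      by (auto simp: Basis_vec_def)
    then have "(\<Prod>b\<in>Basis. g \<bullet> b) = (\<Prod>b\<in>range (\<lambda>i. axis i 1). g \<bullet> b)"
      by (simp only:)
    then show ?thesis
      by (subst (asm) prod.reindex) (auto simp: inj_on_def axis_eq_axis inner_axis)
  qed
  have "?T -` box l u = box (?T l) (?T u)"
  proof (rule set_eqI)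
    fix x
    have all_iff: "(\<forall>i. P (Transposition.transpose j k i)) \<longleftrightarrow> (\<forall>i. P i)" for P
      by (metis transpose_involutory)
    show "x \<in> ?T -` box l u \<longleftrightarrow> x \<in> box (?T l) (?T u)"
      using all_iff[of "\<lambda>i. ?T l $ i < x $ i \<and> x $ i < ?T u $ i"] by (simp add: mem_box_cart)
  qed
  then have "emeasure (distr lborel borel ?T) (box l u) = emeasure lborel (box (?T l) (?T u))"
    by (simp add: emeasure_distr)
  also have "\<dots> = ennreal (\<Prod>b\<in>Basis. (?T u - ?T l) \<bullet> b)"
    by (rule emeasure_lborel_box) (auto simp: Basis_vec_def inner_axis le')
  also have "(\<Prod>b\<in>Basis. (?T u - ?T l) \<bullet> b) = (\<Prod>i\<in>UNIV. (u - l) $ (Transposition.transpose j k i))"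
    by (simp add: basis)
  also have "\<dots> = (\<Prod>i\<in>UNIV. (u - l) $ i)"
    by (rule prod.reindex_bij_betw) simp
  also have "\<dots> = (\<Prod>b\<in>Basis. (u - l) \<bullet> b)"
    by (simp add: basis)
  finally show "emeasure (distr lborel borel ?T) (box l u) = (\<Prod>b\<in>Basis. (u - l) \<bullet> b)" .
qed simp

lemma integral_shell_measure_isometry:
  fixes T :: "real^'d \<Rightarrow> real^'d" and h :: "real^'d \<Rightarrow> real"
  assumes T: "distr lborel borel T = lborel" and [measurable]: "T \<in> borel \<rightarrow>\<^sub>M borel"
    and norm: "\<And>x. norm (T x) = norm x" and [measurable]: "h \<in> borel_measurable borel"
  shows "(\<integral>x. h (T x) \<partial>shell_measure \<epsilon> n) = (\<integral>x. h x \<partial>shell_measure \<epsilon> n)"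
proof -
  let ?g = "\<lambda>x :: real^'d. indicator (shell \<epsilon> n) x / emeasure lborel (shell \<epsilon> n :: (real^'d) set) :: ennreal"
  have "shell_measure \<epsilon> n = density (distr lborel borel T) ?g"
    by (simp add: T shell_measure_def uniform_measure_def)
  also have "\<dots> = distr (density lborel (\<lambda>x. ?g (T x))) borel T"
    by (rule density_distr) measurable
  also have "(\<lambda>x. ?g (T x)) = ?g"
    by (simp add: fun_eq_iff indicator_def shell_def norm)
  finally have "shell_measure \<epsilon> n = distr (shell_measure \<epsilon> n) borel T"
    unfolding shell_measure_def uniform_measure_def .
  then have "(\<integral>x. h x \<partial>shell_measure \<epsilon> n) = (\<integral>x. h x \<partial>distr (shell_measure \<epsilon> n) borel T)"
    by (rule arg_cong)
  also have "\<dots> = (\<integral>x. h (T x) \<partial>shell_measure \<epsilon> n)"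
    by (rule integral_distr) measurable
  finally show ?thesis ..
qed

text \<open>Tangent line at t = 1 of t^(d/2) with t = y^2, a convex function because d >= 2.\<close>

lemma pow_ge_affine_square:
  fixes y :: real
  assumes "1 \<le> y" "2 \<le> d"
  shows "1 + real d / 2 * (y\<^sup>2 - 1) \<le> y ^ d"
  using assms(2)
proof (induction d rule: dec_induct)
  case base
  show ?case by simp
next
  case (step d)
  have "0 \<le> (y - 1)\<^sup>2 * (real d * (y + 1) / 2 - 1 / 2)"
  proof (rule mult_nonneg_nonneg)
    have "1 * 1 \<le> real d * (y + 1)"
      using assms(1) step by (intro mult_mono) auto
    then show "0 \<le> real d * (y + 1) / 2 - 1 / 2" by simp
  qed simp
  also have "\<dots> = y * (1 + real d / 2 * (y\<^sup>2 - 1)) - (1 + real (Suc d) / 2 * (y\<^sup>2 - 1))"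
    by (simp add: field_simps power2_eq_square)
  finally have "1 + real (Suc d) / 2 * (y\<^sup>2 - 1) \<le> y * (1 + real d / 2 * (y\<^sup>2 - 1))"
    by simp
  also have "\<dots> \<le> y * y ^ d"
    using step assms(1) by (intro mult_left_mono) auto
  finally show ?case by simp
qed

text \<open>The constant 3 is the binomial coefficient (3 choose 2), the smallest quadratic
  coefficient occurring for e >= 3.\<close>

lemma pow_ge_quadratic:
  fixes z :: real
  assumes "0 \<le> z" "3 \<le> e"
  shows "1 + real e * z + 3 * z\<^sup>2 \<le> (1 + z) ^ e"
  using assms(2)
proof (induction e rule: dec_induct)
  case base
  show ?case using assms(1) by (simp add: power3_eq_cube power2_eq_square algebra_simps)
next
  case (step e)
  have "0 \<le> real e * z\<^sup>2 + 3 * z * z\<^sup>2"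
    using assms(1) by simp
  also have "\<dots> = (1 + z) * (1 + real e * z + 3 * z\<^sup>2) - (1 + real (Suc e) * z + 3 * z\<^sup>2)"
    by (simp add: power2_eq_square algebra_simps)
  finally have "1 + real (Suc e) * z + 3 * z\<^sup>2 \<le> (1 + z) * (1 + real e * z + 3 * z\<^sup>2)"
    by simp
  also have "\<dots> \<le> (1 + z) * (1 + z) ^ e"
    using step assms(1) by (intro mult_left_mono) auto
  finally show ?case by simp
qed

text \<open>The Hermite-Hadamard inequality for \<open>t \<mapsto> t\<^bsup>d/2\<^esup>\<close> on the interval from \<open>1\<close> to \<open>y\<^sup>2\<close>.\<close>

lemma pow_hermite_hadamard:
  fixes y :: real
  assumes "1 \<le> y" "2 \<le> d"
  shows "4 * (y ^ (d + 2) - 1) \<le> real (d + 2) * (y\<^sup>2 - 1) * (y ^ d + 1)"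
  using assms(2)
proof (induction d rule: dec_induct)
  case base
  show ?case by (simp add: power2_eq_square power4_eq_xxxx algebra_simps)
next
  case (step d)
  define z where "z = y - 1"
  have y: "y = 1 + z" and z: "0 \<le> z" using assms(1) by (auto simp: z_def)
  have "1 + real (Suc d) * z + 3 * z\<^sup>2 \<le> y ^ Suc d"
    unfolding y using z step by (intro pow_ge_quadratic) auto
  then have "(2 + z) * (2 - z + 3 * z\<^sup>2) \<le> (2 + z) * (y ^ Suc d + 1 - real (d + 2) * z)"
    using z by (intro mult_left_mono) (auto simp: algebra_simps)
  moreover have "4 \<le> (2 + z) * (2 - z + 3 * z\<^sup>2)"
  proof -
    have "0 \<le> 5 * z\<^sup>2 + 3 * (z * z\<^sup>2)" using z by simp
    then show ?thesis by (simp add: power2_eq_square algebra_simps)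
  qed
  ultimately have "0 \<le> z * ((2 + z) * (y ^ Suc d + 1 - real (d + 2) * z) - 4)"
    using z by (intro mult_nonneg_nonneg) linarith+
  \<comment> \<open>The defect for d + 1 is y times the defect for d plus a remainder, and the
    remainder is nonnegative by the quadratic lower bound on the power.\<close>
  moreover have "real (Suc d + 2) * (y\<^sup>2 - 1) * (y ^ Suc d + 1) - 4 * (y ^ (Suc d + 2) - 1)
      = y * (real (d + 2) * (y\<^sup>2 - 1) * (y ^ d + 1) - 4 * (y ^ (d + 2) - 1))
        + z * ((2 + z) * (y ^ Suc d + 1 - real (d + 2) * z) - 4)"
    by (simp add: z_def power2_eq_square algebra_simps)
  moreover have "0 \<le> y * (real (d + 2) * (y\<^sup>2 - 1) * (y ^ d + 1) - 4 * (y ^ (d + 2) - 1))"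
    using step assms(1) by (intro mult_nonneg_nonneg) auto
  ultimately show ?case by linarith
qed

section \<open>Total mass of the shell and isotropy of its radial second moments\<close>

lemma emeasure_shell:
  fixes \<epsilon> :: real
  assumes "0 < \<epsilon>" "\<epsilon> < 1" "0 < n"
  shows "emeasure lborel (shell \<epsilon> n :: (real^'d) set) = ennreal (unit_ball_vol CARD('d) *
    (sqrt ((1 + \<epsilon>) * (CARD('d) / real n)) ^ CARD('d) - sqrt ((1 - \<epsilon>) * (CARD('d) / real n)) ^ CARD('d)))"
    and "0 < unit_ball_vol CARD('d) *
    (sqrt ((1 + \<epsilon>) * (CARD('d) / real n)) ^ CARD('d) - sqrt ((1 - \<epsilon>) * (CARD('d) / real n)) ^ CARD('d))"
proof -
  have "0 < CARD('d) / real n" using \<open>0 < n\<close> by simp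
  then have le: "0 \<le> (1 - \<epsilon>) * (CARD('d) / real n)"
    and less: "(1 - \<epsilon>) * (CARD('d) / real n) < (1 + \<epsilon>) * (CARD('d) / real n)"
    using assms by (auto intro!: mult_strict_right_mono simp del: times_divide_eq_right)
  then show "emeasure lborel (shell \<epsilon> n :: (real^'d) set) = ennreal (unit_ball_vol CARD('d) *
    (sqrt ((1 + \<epsilon>) * (CARD('d) / real n)) ^ CARD('d) - sqrt ((1 - \<epsilon>) * (CARD('d) / real n)) ^ CARD('d)))"
    unfolding shell_def using emeasure_annulus[where 'a = "real^'d", OF le less_imp_le[OF less]] by simp
  have "sqrt ((1 - \<epsilon>) * (CARD('d) / real n)) ^ CARD('d) < sqrt ((1 + \<epsilon>) * (CARD('d) / real n)) ^ CARD('d)"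
    using le less by (intro power_strict_mono) (auto simp del: times_divide_eq_right)
  then show "0 < unit_ball_vol CARD('d) *
    (sqrt ((1 + \<epsilon>) * (CARD('d) / real n)) ^ CARD('d) - sqrt ((1 - \<epsilon>) * (CARD('d) / real n)) ^ CARD('d))"
    by (intro mult_pos_pos) auto
qed

lemma prob_space_shell_measure:
  fixes \<epsilon> :: real
  assumes "0 < \<epsilon>" "\<epsilon> < 1" "0 < n"
  shows "prob_space (shell_measure \<epsilon> n :: (real^'d) measure)"
  unfolding shell_measure_def
  using emeasure_shell[where 'd = 'd, OF assms] by (intro prob_space_uniform_measure) auto

lemma AE_shell_measure: "AE x in (shell_measure \<epsilon> n :: (real^'d) measure). x \<in> shell \<epsilon> n"
  unfolding shell_measure_def by (rule AE_uniform_measureI) auto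

lemma shell_norm_bounds:
  fixes x :: "real^'d" and \<epsilon> :: real
  assumes "x \<in> shell \<epsilon> n" "0 < \<epsilon>" "\<epsilon> < 1" "0 < n"
  shows "x \<noteq> 0" "(norm x)\<^sup>2 \<le> (1 + \<epsilon>) * (CARD('d) / real n)"
proof -
  have "0 < (1 - \<epsilon>) * (CARD('d) / real n)"
    using assms by (intro mult_pos_pos divide_pos_pos) auto
  then show "x \<noteq> 0" "(norm x)\<^sup>2 \<le> (1 + \<epsilon>) * (CARD('d) / real n)"
    using assms(1) by (auto simp: shell_def)
qed

lemma integral_radial_offdiagonal:
  fixes r :: "real \<Rightarrow> real" and j k :: "'d::finite"
  assumes [measurable]: "r \<in> borel_measurable borel" and "j \<noteq> k"
  shows "(\<integral>x. r (norm x) * (x $ j * x $ k) \<partial>(shell_measure \<epsilon> n :: (real^'d) measure)) = 0"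
proof -
  let ?T = "\<lambda>x :: real^'d. \<chi> i. if i = j then - x $ i else x $ i"
  have [measurable]: "?T \<in> borel \<rightarrow>\<^sub>M borel"
  proof (rule borel_measurable_continuous_onI)
    show "continuous_on UNIV ?T"
          proof (rule continuous_on_vec_lambda)
      show "continuous_on UNIV (\<lambda>x :: real^'d. if i = j then - x $ i else x $ i)" for i
        by (cases "i = j") (auto intro!: continuous_intros)
    qed
  qed
  have norm: "norm (?T x) = norm x" for x
    by (simp add: norm_vec_def L2_set_def) (intro arg_cong[where f = sqrt] sum.cong, auto)
  have "(\<integral>x. r (norm (?T x)) * (?T x $ j * ?T x $ k) \<partial>(shell_measure \<epsilon> n :: (real^'d) measure))
      = (\<integral>x. r (norm x) * (x $ j * x $ k) \<partial>(shell_measure \<epsilon> n))"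
    by (rule integral_shell_measure_isometry[OF lborel_reflect _ norm]) measurable
  then show ?thesis
    using \<open>j \<noteq> k\<close> unfolding norm by simp
qed

lemma integral_radial_diagonal:
  fixes r :: "real \<Rightarrow> real" and j k :: "'d::finite"
  assumes [measurable]: "r \<in> borel_measurable borel"
  shows "(\<integral>x. r (norm x) * (x $ j * x $ j) \<partial>(shell_measure \<epsilon> n :: (real^'d) measure))
    = (\<integral>x. r (norm x) * (x $ k * x $ k) \<partial>(shell_measure \<epsilon> n))"
proof -
  let ?T = "\<lambda>x :: real^'d. \<chi> i. x $ (Transposition.transpose j k i)"
  have [measurable]: "?T \<in> borel \<rightarrow>\<^sub>M borel"
    by (intro borel_measurable_continuous_onI continuous_intros)
  have norm: "norm (?T x) = norm x" for x
  proof -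
    have "(\<Sum>i\<in>UNIV. (norm (x $ (Transposition.transpose j k i)))\<^sup>2) = (\<Sum>i\<in>UNIV. (norm (x $ i))\<^sup>2)"
      by (rule sum.reindex_bij_betw) simp
    then show ?thesis by (simp add: norm_vec_def L2_set_def)
  qed
  have "(\<integral>x. r (norm (?T x)) * (?T x $ k * ?T x $ k) \<partial>(shell_measure \<epsilon> n :: (real^'d) measure))
      = (\<integral>x. r (norm x) * (x $ k * x $ k) \<partial>(shell_measure \<epsilon> n))"
    by (rule integral_shell_measure_isometry[OF lborel_swap _ norm]) measurable
  then show ?thesis
    unfolding norm by simp
qed

lemma norm_power2_vec: "(norm (x :: real^'d))\<^sup>2 = (\<Sum>j\<in>UNIV. x $ j * x $ j)"
  by (simp add: power2_norm_eq_inner inner_vec_def)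

text \<open>By the two symmetries the matrix of radially weighted second moments is a multiple of
  the identity, and its trace gives the multiple. The weight r covers both the normalised vectors (r
  t = 1 / t^2) and the vectors themselves (r = 1).\<close>

lemma integral_radial_quadratic:
  fixes r :: "real \<Rightarrow> real" and \<epsilon> :: real
  assumes "0 < \<epsilon>" "\<epsilon> < 1" "0 < n"
    and [measurable]: "r \<in> borel_measurable borel"
    and bound: "\<And>x :: real^'d. x \<in> shell \<epsilon> n \<Longrightarrow> \<bar>r (norm x)\<bar> * (norm x)\<^sup>2 \<le> K"
  defines "c \<equiv> (\<integral>x. r (norm x) * (norm x)\<^sup>2 \<partial>(shell_measure \<epsilon> n :: (real^'d) measure)) / CARD('d)"
  shows "(\<integral>x. r (norm x) * ((G *v x) \<bullet> x) \<partial>(shell_measure \<epsilon> n :: (real^'d) measure)) = c * (\<Sum>j\<in>UNIV. G $ j $ j)"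
    and "integrable (shell_measure \<epsilon> n) (\<lambda>x :: real^'d. r (norm x) * ((G *v x) \<bullet> x))"
proof -
  let ?M = "shell_measure \<epsilon> n :: (real^'d) measure"
  interpret prob_space ?M using assms(1-3) by (rule prob_space_shell_measure)
  have int: "integrable ?M (\<lambda>x. r (norm x) * (x $ j * x $ k))" for j k
  proof (rule integrable_const_bound[where B = K])
    show "AE x in ?M. norm (r (norm x) * (x $ j * x $ k)) \<le> K"
      using AE_shell_measure
    proof eventually_elim
      case (elim x)
      have "\<bar>x $ j\<bar> * \<bar>x $ k\<bar> \<le> norm x * norm x"
        by (intro mult_mono component_le_norm_cart) auto
      then have "\<bar>r (norm x)\<bar> * (\<bar>x $ j\<bar> * \<bar>x $ k\<bar>) \<le> \<bar>r (norm x)\<bar> * (norm x)\<^sup>2"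
        by (intro mult_left_mono) (auto simp: power2_eq_square)
      with bound[OF elim] show ?case by (simp add: abs_mult)
    qed
  qed measurable
  have expand: "r (norm x) * ((G *v x) \<bullet> x) = (\<Sum>j\<in>UNIV. \<Sum>k\<in>UNIV. G $ j $ k * (r (norm x) * (x $ j * x $ k)))" for x
    by (simp add: inner_vec_def matrix_vector_mult_def sum_distrib_left sum_distrib_right mult_ac)
  show "integrable ?M (\<lambda>x. r (norm x) * ((G *v x) \<bullet> x))"
    unfolding expand using int by (intro Bochner_Integration.integrable_sum integrable_mult_right)
  have diag: "(\<integral>x. r (norm x) * (x $ j * x $ j) \<partial>?M) = c" for j
  proof -
    have "(\<integral>x. r (norm x) * (norm x)\<^sup>2 \<partial>?M) = (\<Sum>k\<in>UNIV. \<integral>x. r (norm x) * (x $ k * x $ k) \<partial>?M)"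
      using int by (simp add: norm_power2_vec sum_distrib_left Bochner_Integration.integral_sum)
    also have "\<dots> = (\<Sum>k\<in>(UNIV :: 'd set). \<integral>x. r (norm x) * (x $ j * x $ j) \<partial>?M)"
      by (intro sum.cong refl integral_radial_diagonal) measurable
    finally show ?thesis by (simp add: c_def)
  qed
  have "(\<integral>x. r (norm x) * ((G *v x) \<bullet> x) \<partial>?M)
     = (\<Sum>j\<in>UNIV. \<Sum>k\<in>UNIV. G $ j $ k * (\<integral>x. r (norm x) * (x $ j * x $ k) \<partial>?M))"
    unfolding expand using int by (simp add: Bochner_Integration.integral_sum)
  also have "\<dots> = (\<Sum>j\<in>UNIV. \<Sum>k\<in>UNIV. if j = k then G $ j $ j * c else 0)"
    using integral_radial_offdiagonal[of r] diag by (intro sum.cong refl) auto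
  also have "\<dots> = c * (\<Sum>j\<in>UNIV. G $ j $ j)"
    by (simp add: sum_distrib_left mult.commute)
  finally show "(\<integral>x. r (norm x) * ((G *v x) \<bullet> x) \<partial>?M) = c * (\<Sum>j\<in>UNIV. G $ j $ j)" .
qed

text \<open>Layer cake: the defect \<open>b - (norm x)\<^sup>2\<close> is the length of the set of levels above \<open>(norm x)\<^sup>2\<close>.\<close>

lemma nn_integral_annulus_defect:
  fixes a b :: real
  assumes "0 < a" "a \<le> b"
  shows "(\<integral>\<^sup>+x. ennreal (b - (norm x)\<^sup>2) * indicator {x :: 'a::euclidean_space. a \<le> (norm x)\<^sup>2 \<and> (norm x)\<^sup>2 \<le> b} x \<partial>lborel)
     = ennreal (unit_ball_vol (real DIM('a)) *
        (2 / (real DIM('a) + 2) * (sqrt b ^ (DIM('a) + 2) - sqrt a ^ (DIM('a) + 2)) - (b - a) * sqrt a ^ DIM('a)))"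
proof -
  let ?d = "DIM('a)"
  let ?C = "unit_ball_vol (real ?d)"
  let ?A = "\<lambda>t. {x :: 'a. a \<le> (norm x)\<^sup>2 \<and> (norm x)\<^sup>2 \<le> t}"
  have [measurable]: "?A t \<in> sets borel" for t
    by measurable
  \<comment> \<open>Integrating out t gives the defect; integrating out x gives the volume of a
    smaller annulus.\<close>
  let ?g = "\<lambda>x t. indicator (?A b) x * indicator {(norm x)\<^sup>2..b} t :: ennreal"
  have "(\<integral>\<^sup>+x. ennreal (b - (norm x)\<^sup>2) * indicator (?A b) x \<partial>lborel)
     = (\<integral>\<^sup>+x. (\<integral>\<^sup>+t. ?g x t \<partial>lborel) \<partial>lborel)"
    by (intro nn_integral_cong) (auto simp: nn_integral_cmult split: split_indicator)
  also have "\<dots> = (\<integral>\<^sup>+t. (\<integral>\<^sup>+x. ?g x t \<partial>lborel) \<partial>lborel)"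
  proof (rule lborel_pair.Fubini')
    have "(\<lambda>(t, x). ?g x t) = (\<lambda>p. indicator {p :: real \<times> 'a. a \<le> (norm (snd p))\<^sup>2 \<and> (norm (snd p))\<^sup>2 \<le> b
        \<and> (norm (snd p))\<^sup>2 \<le> fst p \<and> fst p \<le> b} p)"
      by (auto simp: fun_eq_iff split: split_indicator)
    also have "\<dots> \<in> borel_measurable (lborel \<Otimes>\<^sub>M lborel)"
      by measurable
    finally show "(\<lambda>(t, x). ?g x t) \<in> borel_measurable (lborel \<Otimes>\<^sub>M lborel)" .
  qed
  also have "\<dots> = (\<integral>\<^sup>+t. ennreal (?C * (sqrt t ^ ?d - sqrt a ^ ?d)) * indicator {a..b} t \<partial>lborel)"
  proof (rule nn_integral_cong)
    fix t :: real
    show "(\<integral>\<^sup>+x. ?g x t \<partial>lborel) = ennreal (?C * (sqrt t ^ ?d - sqrt a ^ ?d)) * indicator {a..b} t"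
    proof (cases "t \<in> {a..b}")
      case True
      then have "(\<lambda>x. ?g x t) = indicator (?A t)"
        by (auto simp: fun_eq_iff split: split_indicator)
      then show ?thesis
        using True assms emeasure_annulus[where 'a = 'a, of a t] by simp
    next
      case False
      then have "(\<lambda>x. ?g x t) = (\<lambda>x. 0)"
        by (auto simp: fun_eq_iff split: split_indicator)
      then show ?thesis using False by simp
    qed
  qed
  also have "\<dots> = ennreal ((?C * (2 / (real ?d + 2) * sqrt b ^ (?d + 2) - b * sqrt a ^ ?d))
      - (?C * (2 / (real ?d + 2) * sqrt a ^ (?d + 2) - a * sqrt a ^ ?d)))"
  proof (rule nn_integral_FTC_Icc)
    show "((\<lambda>t. ?C * (2 / (real ?d + 2) * sqrt t ^ (?d + 2) - t * sqrt a ^ ?d)) has_real_derivative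
        ?C * (sqrt t ^ ?d - sqrt a ^ ?d)) (at t)" if "t \<in> {a..b}" for t
    proof -
      have "t > 0" using that assms by simp
      have "((\<lambda>t. sqrt t ^ (?d + 2)) has_real_derivative
          real (?d + 2) * (inverse (sqrt t) / 2 * sqrt t ^ (?d + 1))) (at t)"
        using DERIV_power[OF DERIV_real_sqrt[OF \<open>t > 0\<close>], of "?d + 2"] by simp
      moreover have "real (?d + 2) * (inverse (sqrt t) / 2 * sqrt t ^ (?d + 1)) = (real ?d + 2) / 2 * sqrt t ^ ?d"
        using \<open>t > 0\<close> by (simp add: field_simps)
      ultimately have D: "((\<lambda>t. sqrt t ^ (?d + 2)) has_real_derivative (real ?d + 2) / 2 * sqrt t ^ ?d) (at t)"
        by (simp only:)
      have "((\<lambda>t. ?C * (2 / (real ?d + 2) * sqrt t ^ (?d + 2) - t * sqrt a ^ ?d)) has_real_derivative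
        ?C * (2 / (real ?d + 2) * ((real ?d + 2) / 2 * sqrt t ^ ?d) - 1 * sqrt a ^ ?d)) (at t)"
        by (intro DERIV_cmult DERIV_diff D DERIV_cmult_right DERIV_ident)
      then show ?thesis by simp
    qed
    show "0 \<le> ?C * (sqrt t ^ ?d - sqrt a ^ ?d)" if "t \<in> {a..b}" for t
      using that assms by (auto intro!: mult_nonneg_nonneg power_mono)
  qed (use assms in auto)
  also have "(?C * (2 / (real ?d + 2) * sqrt b ^ (?d + 2) - b * sqrt a ^ ?d))
      - (?C * (2 / (real ?d + 2) * sqrt a ^ (?d + 2) - a * sqrt a ^ ?d))
     = ?C * (2 / (real ?d + 2) * (sqrt b ^ (?d + 2) - sqrt a ^ (?d + 2)) - (b - a) * sqrt a ^ ?d)"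
    by (simp add: algebra_simps)
  finally show ?thesis .
qed

text \<open>Here p and q are the outer and inner radii, and V and I are the volume and the
  integrated defect up to the volume of the unit ball. Homogeneity reduces everything to y = p / q:
  the lower bound is then \<open>pow_ge_affine_square\<close>, the upper bound
  \<open>pow_hermite_hadamard\<close>.\<close>

lemma shell_defect_bounds:
  fixes p q :: real
  assumes "0 < q" "q \<le> p" "2 \<le> d"
  defines "V \<equiv> p ^ d - q ^ d"
    and "I \<equiv> 2 / (real d + 2) * (p ^ (d + 2) - q ^ (d + 2)) - (p\<^sup>2 - q\<^sup>2) * q ^ d"
  shows "2 * (p\<^sup>2 - q\<^sup>2) / (real d + 2) * V \<le> I" "I \<le> (p\<^sup>2 - q\<^sup>2) / 2 * V"
proof -
  define y where "y = p / q"
  have y: "1 \<le> y" and p: "p = y * q" using assms(1,2) by (auto simp: y_def)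
  have V: "V = (y ^ d - 1) * q ^ d"
    by (simp add: V_def p power_mult_distrib algebra_simps)
  have I: "I = (2 / (real d + 2) * (y ^ (d + 2) - 1) - (y\<^sup>2 - 1)) * q ^ (d + 2)"
  proof -
    define c where "c = 2 / (real d + 2)"
    show ?thesis
      unfolding I_def c_def[symmetric] by (simp add: p power_mult_distrib power_add power2_eq_square algebra_simps)
  qed
  have pq: "p\<^sup>2 - q\<^sup>2 = (y\<^sup>2 - 1) * q\<^sup>2"
    by (simp add: p power_mult_distrib algebra_simps)
  have "2 * (y\<^sup>2 - 1) / (real d + 2) * (y ^ d - 1) \<le> 2 / (real d + 2) * (y ^ (d + 2) - 1) - (y\<^sup>2 - 1)"
  proof -
    define c where "c = 2 / (real d + 2)"
    have c: "c * (1 + real d / 2) = 1" by (simp add: c_def field_simps)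
    have "c * (y ^ (d + 2) - 1) - (y\<^sup>2 - 1) - c * (y\<^sup>2 - 1) * (y ^ d - 1)
        = c * (y ^ d - (1 + real d / 2 * (y\<^sup>2 - 1))) + (c * (1 + real d / 2) - 1) * (y\<^sup>2 - 1)"
      by (simp add: power_add power2_eq_square algebra_simps)
    then have "2 / (real d + 2) * (y ^ (d + 2) - 1) - (y\<^sup>2 - 1) - 2 * (y\<^sup>2 - 1) / (real d + 2) * (y ^ d - 1)
        = 2 / (real d + 2) * (y ^ d - (1 + real d / 2 * (y\<^sup>2 - 1)))"
      unfolding c by (simp add: c_def)
    moreover have "0 \<le> 2 / (real d + 2) * (y ^ d - (1 + real d / 2 * (y\<^sup>2 - 1)))"
      using pow_ge_affine_square[OF y \<open>2 \<le> d\<close>] by (intro mult_nonneg_nonneg) auto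
    ultimately show ?thesis by linarith
  qed
  then have "2 * (y\<^sup>2 - 1) / (real d + 2) * (y ^ d - 1) * q ^ (d + 2)
      \<le> (2 / (real d + 2) * (y ^ (d + 2) - 1) - (y\<^sup>2 - 1)) * q ^ (d + 2)"
    using assms(1) by (intro mult_right_mono) auto
  then show "2 * (p\<^sup>2 - q\<^sup>2) / (real d + 2) * V \<le> I"
    unfolding V I pq by (simp add: power_add mult_ac power2_eq_square)
  have "2 / (real d + 2) * (y ^ (d + 2) - 1) - (y\<^sup>2 - 1) \<le> (y\<^sup>2 - 1) / 2 * (y ^ d - 1)"
    using pow_hermite_hadamard[OF y \<open>2 \<le> d\<close>] by (simp add: field_simps)
  then have "(2 / (real d + 2) * (y ^ (d + 2) - 1) - (y\<^sup>2 - 1)) * q ^ (d + 2)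
     \<le> (y\<^sup>2 - 1) / 2 * (y ^ d - 1) * q ^ (d + 2)"
    using assms(1) by (intro mult_right_mono) auto
  then show "I \<le> (p\<^sup>2 - q\<^sup>2) / 2 * V"
    unfolding V I pq by (simp add: power_add mult_ac power2_eq_square)
qed

text \<open>The mean of the frame operator is m times the identity. The mean defect b - |x|^2 is I /
  V; being at most half the width of the shell it puts m at or above the centre 1, and its lower
  bound keeps m away from the outer boundary by 4 \<epsilon> / (d + 2), which is the room left for
  the upper tail.\<close>

lemma shell_second_moment_bounds:
  fixes \<epsilon> :: real
  assumes \<epsilon>: "0 < \<epsilon>" "\<epsilon> < 1" and n: "0 < n" and d: "2 \<le> CARD('d)"
  defines "m \<equiv> real n / CARD('d) * (\<integral>x. (norm x)\<^sup>2 \<partial>(shell_measure \<epsilon> n :: (real^'d) measure))"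
  shows "1 \<le> m" "m \<le> 1 + \<epsilon> - 4 * \<epsilon> / (CARD('d) + 2)"
proof -
  let ?d = "CARD('d)"
  let ?M = "shell_measure \<epsilon> n :: (real^'d) measure"
  interpret prob_space ?M using \<epsilon> n by (rule prob_space_shell_measure)
  define b a where "b = (1 + \<epsilon>) * (?d / real n)" and "a = (1 - \<epsilon>) * (?d / real n)"
  have dn: "?d / real n > 0" using n by simp
  have a: "0 < a" and ab: "a \<le> b" "b - a = 2 * \<epsilon> * (?d / real n)"
    using \<epsilon> dn unfolding a_def b_def
    by (auto intro!: mult_pos_pos mult_right_mono simp: algebra_simps simp del: times_divide_eq_right)
  have shell: "shell \<epsilon> n = {x :: real^'d. a \<le> (norm x)\<^sup>2 \<and> (norm x)\<^sup>2 \<le> b}"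
    by (simp add: shell_def a_def b_def)
  define C V I where "C = unit_ball_vol ?d" and "V = sqrt b ^ ?d - sqrt a ^ ?d"
    and "I = 2 / (real ?d + 2) * (sqrt b ^ (?d + 2) - sqrt a ^ (?d + 2)) - ((sqrt b)\<^sup>2 - (sqrt a)\<^sup>2) * sqrt a ^ ?d"
  have I: "2 * ((sqrt b)\<^sup>2 - (sqrt a)\<^sup>2) / (real ?d + 2) * V \<le> I" "I \<le> ((sqrt b)\<^sup>2 - (sqrt a)\<^sup>2) / 2 * V"
    unfolding V_def I_def using a ab d by (intro shell_defect_bounds; simp)+
  have sq: "(sqrt b)\<^sup>2 = b" "(sqrt a)\<^sup>2 = a" using a ab by auto
  have vol: "emeasure lborel (shell \<epsilon> n :: (real^'d) set) = ennreal (C * V)" and CV: "0 < C * V"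
    using emeasure_shell[where 'd = 'd, OF \<epsilon> n] by (auto simp: C_def V_def a_def b_def)
  have "C > 0" by (simp add: C_def)
  then have V: "V > 0" using CV by (simp add: zero_less_mult_iff)
  have "0 \<le> 2 * (b - a) / (real ?d + 2) * V"
    using ab(1) V by (intro mult_nonneg_nonneg divide_nonneg_nonneg) auto
  then have I0: "0 \<le> I" using I(1) unfolding sq by linarith
  have "(\<integral>\<^sup>+x. ennreal (b - (norm x)\<^sup>2) \<partial>?M)
     = (\<integral>\<^sup>+x. ennreal (b - (norm x)\<^sup>2) * indicator (shell \<epsilon> n) (x :: real^'d) \<partial>lborel) / ennreal (C * V)"
    unfolding shell_measure_def vol[symmetric] by (rule nn_integral_uniform_measure) measurable
  also have "\<dots> = ennreal (C * I) / ennreal (C * V)"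
    unfolding shell using nn_integral_annulus_defect[where 'a = "real^'d", OF a ab(1)]
    by (simp add: C_def I_def sq)
  also have "\<dots> = ennreal (I / V)"
    using \<open>C > 0\<close> V I0 by (simp add: divide_ennreal)
  finally have nn: "(\<integral>\<^sup>+x. ennreal (b - (norm x)\<^sup>2) \<partial>?M) = ennreal (I / V)" .
  have le: "AE x in ?M. (norm x)\<^sup>2 \<le> b"
    using AE_shell_measure by eventually_elim (simp add: shell)
  have int: "integrable ?M (\<lambda>x. (norm x)\<^sup>2)"
    by (rule integrable_const_bound[where B = b]) (use le in auto)
  have "(\<integral>x. b - (norm x)\<^sup>2 \<partial>?M) = enn2real (\<integral>\<^sup>+x. ennreal (b - (norm x)\<^sup>2) \<partial>?M)"
    using le by (intro integral_eq_nn_integral) auto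
  also have "\<dots> = I / V" using I0 V by (simp add: nn)
  finally have "b - (\<integral>x. (norm x)\<^sup>2 \<partial>?M) = I / V"
    using int prob_space by simp
  then have "m = real n / ?d * (b - I / V)"
    by (simp add: m_def)
  also have "\<dots> = (1 + \<epsilon>) - real n / ?d * (I / V)"
    using n by (simp add: b_def right_diff_distrib)
  finally have m: "m = (1 + \<epsilon>) - real n / ?d * (I / V)" .
  have "I / V \<le> (b - a) / 2" "2 * (b - a) / (real ?d + 2) \<le> I / V"
    using I V unfolding sq by (auto simp: pos_divide_le_eq pos_le_divide_eq)
  then have "real n / ?d * (I / V) \<le> real n / ?d * ((b - a) / 2)"
    "real n / ?d * (2 * (b - a) / (real ?d + 2)) \<le> real n / ?d * (I / V)"
    by (intro mult_left_mono; simp)+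
  moreover have "real n / ?d * ((b - a) / 2) = \<epsilon>" "real n / ?d * (2 * (b - a) / (real ?d + 2)) = 4 * \<epsilon> / (real ?d + 2)"
    using n by (simp_all add: ab(2))
  ultimately show "1 \<le> m" "m \<le> 1 + \<epsilon> - 4 * \<epsilon> / (?d + 2)"
    unfolding m by (simp_all add: add.commute)
qed

section \<open>Upper tail of the frame operator\<close>

text \<open>The Loewner order S <= b I, written as an intersection of closed half-spaces, from which
  measurability is immediate.\<close>

definition quadratic_form_le :: "real \<Rightarrow> (real^'d^'d) set" where
  "quadratic_form_le b = {S. \<forall>w. (S *v w) \<bullet> w \<le> b * (w \<bullet> w)}"

lemma continuous_on_matrix_vector_mult_left:
  "continuous_on A (\<lambda>S :: real^'d^'d. S *v w)"
  unfolding matrix_vector_mult_def by (intro continuous_intros)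

lemma quadratic_form_le_measurable [measurable]: "(quadratic_form_le b :: (real^'d^'d) set) \<in> sets borel"
proof -
  have "closed (quadratic_form_le b :: (real^'d^'d) set)"
    unfolding quadratic_form_le_def
    by (intro closed_Collect_all closed_Collect_le continuous_intros continuous_on_matrix_vector_mult_left)
  then show ?thesis by simp
qed

lemma continuous_on_outer: "continuous_on A outer"
  unfolding outer_def by (intro continuous_intros)

lemma outer_measurable [measurable]: "outer \<in> borel \<rightarrow>\<^sub>M borel"
  by (rule borel_measurable_continuous_onI[OF continuous_on_outer])

lemma matrix_add_outer: "(*v) (S + outer x) = rank_one_add ((*v) S) x"
  by (simp add: fun_eq_iff rank_one_add_def matrix_vector_mult_add_rdistrib outer_mult_vec)

text \<open>Truncation at degree N of the trace of exp (a S). Finite sums make measurability and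
  rearrangement elementary; the limit in N is taken only once the bound is scalar.\<close>

definition trace_exp :: "real \<Rightarrow> nat \<Rightarrow> real^'d^'d \<Rightarrow> real" where
  "trace_exp a N S = (\<Sum>p\<le>N. a ^ p / fact p * trace_of ((*v) S ^^ p))"

lemma trace_exp_measurable: "trace_exp a N \<in> borel_measurable borel"
proof -
  have "continuous_on UNIV (\<lambda>S :: real^'d^'d. ((*v) S ^^ p) w)" for p w
  proof (induction p)
    case (Suc p)
    have "continuous_on UNIV (\<lambda>S :: real^'d^'d. S *v g S)" if "continuous_on UNIV g" for g
      unfolding matrix_vector_mult_def by (intro continuous_intros that)
    from this[OF Suc] have "continuous_on UNIV (\<lambda>S :: real^'d^'d. S *v (((*v) S ^^ p) w))" .
    then show ?case by simp
  qed simp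
  then have "continuous_on UNIV (trace_exp a N :: real^'d^'d \<Rightarrow> real)"
    unfolding trace_exp_def trace_of_def by (intro continuous_intros)
  then show ?thesis by (rule borel_measurable_continuous_onI)
qed

text \<open>The index pairs (i, p - 1 - i) are distinct and stay inside the rectangle on the right;
  all terms are nonnegative.\<close>

lemma sum_cauchy_triangle_le:
  fixes a b :: "nat \<Rightarrow> real"
  assumes "\<And>i. 0 \<le> a i" "\<And>i. 0 \<le> b i"
  shows "(\<Sum>p\<le>N. \<Sum>i<p. a i * b (p - Suc i)) \<le> (\<Sum>i<N. a i) * (\<Sum>k\<le>N. b k)"
proof -
  have "(\<Sum>p\<le>N. \<Sum>i<p. a i * b (p - Suc i)) = (\<Sum>p\<le>N. \<Sum>i | i \<in> {..<N} \<and> i < p. a i * b (p - Suc i))"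
    by (intro sum.cong refl) auto
  also have "\<dots> = (\<Sum>i<N. \<Sum>p | p \<in> {..N} \<and> i < p. a i * b (p - Suc i))"
    by (rule sum.swap_restrict) auto
  also have "\<dots> \<le> (\<Sum>i<N. a i * (\<Sum>k\<le>N. b k))"
  proof (rule sum_mono)
    fix i
    let ?P = "{p. p \<in> {..N} \<and> i < p}"
    have "(\<Sum>p\<in>?P. b (p - Suc i)) = (\<Sum>k\<in>(\<lambda>p. p - Suc i) ` ?P. b k)"
      by (subst sum.reindex) (auto simp: inj_on_def)
    also have "\<dots> \<le> (\<Sum>k\<le>N. b k)"
      using assms by (intro sum_mono2) auto
    finally show "(\<Sum>p\<in>?P. a i * b (p - Suc i)) \<le> a i * (\<Sum>k\<le>N. b k)"
      using assms by (simp add: sum_distrib_left[symmetric] mult_left_mono)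
  qed
  also have "\<dots> = (\<Sum>i<N. a i) * (\<Sum>k\<le>N. b k)"
    by (simp add: sum_distrib_right)
  finally show ?thesis .
qed

lemma sum_exp_tail_le:
  fixes a R :: real
  assumes "0 \<le> a" "0 < R"
  shows "(\<Sum>i<N. a ^ Suc i * R ^ i / fact (Suc i)) \<le> (exp (a * R) - 1) / R"
proof -
  have "R * (\<Sum>i<N. a ^ Suc i * R ^ i / fact (Suc i)) + 1 = (\<Sum>i<Suc N. (a * R) ^ i / fact i)"
    by (subst sum.lessThan_Suc_shift) (simp add: sum_distrib_left power_mult_distrib mult_ac)
  also have "\<dots> \<le> exp (a * R)"
  proof -
    have "(\<lambda>i. (a * R) ^ i / fact i) sums exp (a * R)"
      using exp_converges[of "a * R"] by (simp add: divide_inverse mult.commute)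
    then show ?thesis
      using assms by (intro sum_le_suminf[THEN order.trans] eq_refl[OF sums_unique[symmetric]])
         (auto simp: sums_iff)
  qed
  finally show ?thesis using assms(2) by (simp add: field_simps)
qed

text \<open>The mean of the rank-one Golden-Thompson inequality: |x|^2 is replaced by R, and
  \<open>iso\<close>, saying that the second moment matrix is c times the identity, turns the
  quadratic forms into traces. What remains is a truncated Cauchy product of (exp (a R) - 1) / R and
  the trace series of S.\<close>

lemma trace_exp_rank_one_step:
  fixes M :: "(real^'d) measure" and S :: "real^'d^'d"
  assumes "prob_space M" and R: "AE x in M. (norm x)\<^sup>2 \<le> R" "0 < R" and "0 \<le> c" "0 \<le> a"
    and iso: "\<And>g. linear g \<Longrightarrow> integrable M (\<lambda>x. g x \<bullet> x) \<and> (\<integral>x. g x \<bullet> x \<partial>M) = c * trace_of g"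
    and S: "psd_op ((*v) S)"
  shows "(\<integral>\<^sup>+x. ennreal (trace_exp a N (S + outer x)) \<partial>M)
    \<le> ennreal ((1 + c / R * (exp (a * R) - 1)) * trace_exp a N S)"
proof -
  interpret prob_space M by fact
  let ?S = "(*v) S"
  have lin: "linear (?S ^^ k)" for k
    by (intro linear_funpow) simp
  note int = iso[OF lin, THEN conjunct1] and int_eq = iso[OF lin, THEN conjunct2]
  define t where "t k = trace_of (?S ^^ k)" for k
  have t: "0 \<le> t k" for k unfolding t_def by (rule trace_of_funpow_nonneg[OF S])
  define h where "h x = (\<Sum>p\<le>N. a ^ p / fact p * (t p +
      (\<Sum>i<p. real (p choose Suc i) * R ^ i * ((?S ^^ (p - Suc i)) x \<bullet> x))))" for x
  have h_int: "integrable M h"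
    unfolding h_def using int by (intro Bochner_Integration.integrable_sum integrable_mult_right integrable_add) auto
  have "(\<integral>\<^sup>+x. ennreal (trace_exp a N (S + outer x)) \<partial>M) \<le> ennreal (\<integral>x. h x \<partial>M)"
  proof (rule nn_integral_le_integral_bound[OF _ h_int])
    show "AE x in M. 0 \<le> trace_exp a N (S + outer x) \<and> trace_exp a N (S + outer x) \<le> h x"
      using R(1)
    proof eventually_elim
      case (elim x)
      have "0 \<le> trace_exp a N (S + outer x)"
        unfolding trace_exp_def matrix_add_outer
        using trace_of_funpow_nonneg[OF rank_one_add_psd_op[OF S]] \<open>0 \<le> a\<close>
        by (intro sum_nonneg mult_nonneg_nonneg) auto
      moreover have "trace_exp a N (S + outer x) \<le> h x"
        unfolding trace_exp_def matrix_add_outer h_def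
      proof (intro sum_mono mult_left_mono)
        fix p
        have "trace_of (rank_one_add ?S x ^^ p)
          \<le> t p + (\<Sum>i<p. real (p choose Suc i) * (x \<bullet> x) ^ i * ((?S ^^ (p - Suc i)) x \<bullet> x))"
          unfolding t_def by (rule trace_of_rank_one_add_funpow[OF S])
        also have "\<dots> \<le> t p + (\<Sum>i<p. real (p choose Suc i) * R ^ i * ((?S ^^ (p - Suc i)) x \<bullet> x))"
          using elim psd_op_funpow_nonneg[OF S]
          by (intro add_left_mono sum_mono mult_right_mono mult_left_mono power_mono)
             (auto simp: power2_norm_eq_inner)
        finally show "trace_of (rank_one_add ?S x ^^ p) \<le> \<dots>" .
      qed (use \<open>0 \<le> a\<close> in auto)
      ultimately show ?case by blast
    qed
  qed
  also have "(\<integral>x. h x \<partial>M) = (\<Sum>p\<le>N. a ^ p / fact p * (t p + (\<Sum>i<p. real (p choose Suc i) * R ^ i * (c * t (p - Suc i)))))"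
    unfolding h_def using int int_eq
    by (subst Bochner_Integration.integral_sum;
        intro integrable_mult_right integrable_add Bochner_Integration.integrable_sum sum.cong refl)
       (auto simp: Bochner_Integration.integral_sum prob_space t_def)
  also have "\<dots> = trace_exp a N S
      + c * (\<Sum>p\<le>N. \<Sum>i<p. (a ^ Suc i * R ^ i / fact (Suc i)) * (a ^ (p - Suc i) / fact (p - Suc i) * t (p - Suc i)))"
  proof -
    have "a ^ p / fact p * (real (p choose Suc i) * R ^ i * (c * t (p - Suc i)))
      = c * ((a ^ Suc i * R ^ i / fact (Suc i)) * (a ^ (p - Suc i) / fact (p - Suc i) * t (p - Suc i)))"
      if "i < p" for i p
    proof -
      have "a ^ p = a ^ Suc i * a ^ (p - Suc i)"
        using that by (simp only: power_add[symmetric]) simp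
      \<comment> \<open>Cancelling p! splits each term into one factor for i and one for p - 1 - i,
        which is the shape of a Cauchy product.\<close>
      moreover have "real (p choose Suc i) / fact p = 1 / (fact (Suc i) * fact (p - Suc i))"
        using that by (simp add: binomial_fact)
      ultimately show ?thesis
        by (simp add: divide_inverse mult_ac del: fact_Suc power_Suc)
    qed
    then show ?thesis
      by (simp add: trace_exp_def t_def[symmetric] distrib_left sum.distrib sum_distrib_left del: fact_Suc power_Suc)
  qed
  also have "\<dots> \<le> trace_exp a N S + c * ((exp (a * R) - 1) / R * trace_exp a N S)"
  proof -
    have "(\<Sum>p\<le>N. \<Sum>i<p. (a ^ Suc i * R ^ i / fact (Suc i)) * (a ^ (p - Suc i) / fact (p - Suc i) * t (p - Suc i)))
       \<le> (\<Sum>i<N. a ^ Suc i * R ^ i / fact (Suc i)) * (\<Sum>k\<le>N. a ^ k / fact k * t k)"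
      using \<open>0 \<le> a\<close> R(2) t
      by (intro sum_cauchy_triangle_le[of "\<lambda>i. a ^ Suc i * R ^ i / fact (Suc i)" "\<lambda>k. a ^ k / fact k * t k"]) auto
    also have "\<dots> \<le> (exp (a * R) - 1) / R * trace_exp a N S"
      unfolding trace_exp_def t_def[symmetric]
      using \<open>0 \<le> a\<close> R(2) t by (intro mult_right_mono sum_exp_tail_le sum_nonneg) auto
    finally show ?thesis using \<open>0 \<le> c\<close> by (intro add_left_mono mult_left_mono)
  qed
  also have "\<dots> = (1 + c / R * (exp (a * R) - 1)) * trace_exp a N S"
    by (simp add: algebra_simps add_divide_distrib diff_divide_distrib)
  finally show ?thesis by (simp add: ennreal_leI)
qed

lemma psd_op_sum_outer: "psd_op ((*v) (\<Sum>i<n::nat. outer (x i :: real^'d)))"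
proof (induction n)
  case 0
  show ?case by (simp add: psd_op_def linear_iff)
next
  case (Suc n)
  then show ?case by (simp add: matrix_add_outer rank_one_add_psd_op)
qed

text \<open>Outside the order interval some eigenvalue exceeds b, and the remaining ones contribute
  nonnegative powers.\<close>

lemma trace_of_funpow_ge:
  fixes S :: "real^'d^'d"
  assumes S: "psd_op ((*v) S)" and "S \<notin> quadratic_form_le b" "0 \<le> b"
  shows "b ^ p \<le> trace_of ((*v) S ^^ p)"
proof (rule psd_op_eigenbasis[OF S])
  let ?d = "DIM(real^'d)"
  fix q :: "nat \<Rightarrow> real^'d" and l
  assume q: "orthonormal_basis q" "\<And>i. i < ?d \<Longrightarrow> S *v q i = l i *\<^sub>R q i"
    and "\<And>i j. i \<le> j \<Longrightarrow> j < ?d \<Longrightarrow> l j \<le> l i"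
    and q': "\<And>i. i < ?d \<Longrightarrow> 0 \<le> l i"
    "\<And>k x. ((*v) S ^^ k) x \<bullet> x = (\<Sum>i<?d. l i ^ k * (x \<bullet> q i)\<^sup>2)"
  have "\<exists>j<?d. b < l j"
  proof (rule ccontr)
    assume "\<not> (\<exists>j<?d. b < l j)"
    then have l_le: "l j \<le> b" if "j < ?d" for j using that by force
    have "(S *v w) \<bullet> w \<le> b * (w \<bullet> w)" for w
    proof -
      have "(S *v w) \<bullet> w = (\<Sum>i<?d. l i * (w \<bullet> q i)\<^sup>2)"
        using q'(2)[of 1 w] by simp
      also have "\<dots> \<le> (\<Sum>i<?d. b * (w \<bullet> q i)\<^sup>2)"
        using l_le by (intro sum_mono mult_right_mono) auto
      also have "\<dots> = b * (norm w)\<^sup>2"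
        by (simp only: orthonormal_basis_norm_sq[OF q(1), of w] sum_distrib_left)
      finally show ?thesis by (simp only: power2_norm_eq_inner)
    qed
    with assms(2) show False by (simp add: quadratic_form_le_def)
  qed
  then obtain j where j: "j < ?d" "b < l j" by blast
  have "b ^ p \<le> l j ^ p" using j assms(3) by (intro power_mono) auto
  also have "\<dots> \<le> (\<Sum>i<?d. l i ^ p)"
    using q'(1) j by (intro member_le_sum) auto
  also have "\<dots> = trace_of ((*v) S ^^ p)"
    using trace_of_funpow[OF _ q(1,2)] by simp
  finally show ?thesis .
qed

text \<open>Each summand multiplies the mean of the truncated trace exponential by at most q,
  starting from trace d at S = 0; Markov's inequality then compares it with the truncated series of
  exp (a b). The one-step bound needs S positive semidefinite, so the potential argument runs inside
  that cone.\<close>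

theorem matrix_chernoff:
  fixes M :: "(real^'d) measure"
  assumes "prob_space M" and sets [measurable_cong]: "sets M = sets borel"
    and R: "AE x in M. (norm x)\<^sup>2 \<le> R" "0 < R" and "0 \<le> c" "0 \<le> a" "0 \<le> b"
    and iso: "\<And>g. linear g \<Longrightarrow> integrable M (\<lambda>x. g x \<bullet> x) \<and> (\<integral>x. g x \<bullet> x \<partial>M) = c * trace_of g"
  shows "emeasure (\<Pi>\<^sub>M i\<in>{..<n}. M)
      {x \<in> space (\<Pi>\<^sub>M i\<in>{..<n}. M). (\<Sum>i<n. outer (x i)) \<notin> quadratic_form_le b}
    \<le> ennreal (real CARD('d) * (1 + c / R * (exp (a * R) - 1)) ^ n / exp (a * b))"
proof -
  interpret prob_space M by fact
  interpret P: prob_space "\<Pi>\<^sub>M i\<in>{..<n}. M"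
    by (rule prob_space_PiM) (rule \<open>prob_space M\<close>)
  let ?P = "\<Pi>\<^sub>M i\<in>{..<n}. M"
  let ?A = "{x \<in> space ?P. (\<Sum>i<n. outer (x i)) \<notin> quadratic_form_le b}"
  define q where "q = 1 + c / R * (exp (a * R) - 1)"
  have "1 \<le> exp (a * R)" using R(2) \<open>0 \<le> a\<close> by simp
  then have q: "0 \<le> q" using R(2) \<open>0 \<le> c\<close> by (simp add: q_def)
  have bound: "emeasure ?P ?A \<le> ennreal (real CARD('d) * q ^ n / (\<Sum>p\<le>N. (a * b) ^ p / fact p))" for N
  proof -
    define \<Phi> where "\<Phi> k S = ennreal (q ^ (n - k) * trace_exp a N S)" for k and S :: "real^'d^'d"
    have "(\<integral>\<^sup>+x. \<Phi> n (\<Sum>i<n. outer (x i)) \<partial>?P) \<le> \<Phi> 0 0"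
    proof (rule nn_integral_PiM_potential_le[where C = "{S. psd_op ((*v) S)}"])
      show "prob_space M" by fact
      show "outer \<in> borel_measurable M" by measurable
      show "\<Phi> k \<in> borel_measurable borel" for k
        unfolding \<Phi>_def using trace_exp_measurable[of a N] by measurable
      show "0 \<in> {S :: real^'d^'d. psd_op ((*v) S)}"
        using psd_op_sum_outer[where n = 0] by simp
      show "S + outer x \<in> {S. psd_op ((*v) S)}" if "S \<in> {S. psd_op ((*v) S)}" for S and x :: "real^'d"
        using that by (simp add: matrix_add_outer rank_one_add_psd_op)
      fix k and S :: "real^'d^'d" assume "k < n" and S: "S \<in> {S. psd_op ((*v) S)}"
      then have nk: "n - k = Suc (n - Suc k)" by simp
      have "(\<integral>\<^sup>+x. \<Phi> (Suc k) (S + outer x) \<partial>M)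
          = ennreal (q ^ (n - Suc k)) * (\<integral>\<^sup>+x. ennreal (trace_exp a N (S + outer x)) \<partial>M)"
      proof -
        note trace_exp_measurable [measurable]
        have "(\<lambda>x. ennreal (trace_exp a N (S + outer x))) \<in> borel_measurable M"
          by measurable
        then show ?thesis
          using q by (simp add: \<Phi>_def ennreal_mult' nn_integral_cmult)
      qed
      also have "\<dots> \<le> ennreal (q ^ (n - Suc k)) * ennreal (q * trace_exp a N S)"
        unfolding q_def using S
        by (intro mult_left_mono trace_exp_rank_one_step[OF \<open>prob_space M\<close> R \<open>0 \<le> c\<close> \<open>0 \<le> a\<close> iso]) auto
      also have "\<dots> = \<Phi> k S"
        using q by (subst ennreal_mult'[symmetric]) (auto simp: \<Phi>_def nk mult_ac)
      finally show "(\<integral>\<^sup>+x. \<Phi> (Suc k) (S + outer x) \<partial>M) \<le> \<Phi> k S" .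
    qed
    moreover have "trace_exp a N (0 :: real^'d^'d) = real CARD('d)"
    proof -
      have "trace_of ((*v) (0 :: real^'d^'d) ^^ p) = (if p = 0 then real CARD('d) else 0)" for p
        by (cases p) (simp_all add: trace_of_def sum_constant)
      then have "trace_exp a N (0 :: real^'d^'d) = (\<Sum>p\<le>N. a ^ p / fact p * (if p = 0 then real CARD('d) else 0))"
        by (simp only: trace_exp_def)
      also have "\<dots> = (\<Sum>p\<le>N. if p = 0 then real CARD('d) else 0)"
        by (intro sum.cong) auto
      finally show ?thesis by simp
    qed
    ultimately have "(\<integral>\<^sup>+x. ennreal (trace_exp a N (\<Sum>i<n. outer (x i))) \<partial>?P) \<le> ennreal (real CARD('d) * q ^ n)"
      by (simp add: \<Phi>_def mult.commute)
    then show ?thesis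
    proof (rule emeasure_le_of_nn_integral)
      show "?A \<in> sets ?P" by measurable
      fix x assume "x \<in> ?A"
      then have "b ^ p \<le> trace_of ((*v) (\<Sum>i<n. outer (x i)) ^^ p)" for p
        using \<open>0 \<le> b\<close> by (intro trace_of_funpow_ge psd_op_sum_outer) auto
      then have "(\<Sum>p\<le>N. a ^ p / fact p * b ^ p) \<le> trace_exp a N (\<Sum>i<n. outer (x i))"
        unfolding trace_exp_def using \<open>0 \<le> a\<close> by (intro sum_mono mult_left_mono) auto
      then show "(\<Sum>p\<le>N. (a * b) ^ p / fact p) \<le> trace_exp a N (\<Sum>i<n. outer (x i))"
        by (simp add: power_mult_distrib)
    next
      have "(1 :: real) = (\<Sum>p\<le>0. (a * b) ^ p / fact p)" by simp
      also have "\<dots> \<le> (\<Sum>p\<le>N. (a * b) ^ p / fact p)"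
        using \<open>0 \<le> a\<close> \<open>0 \<le> b\<close> by (intro sum_mono2) auto
      finally show "0 < (\<Sum>p\<le>N. (a * b) ^ p / fact p)" by linarith
    qed (use q in auto)
  qed
  \<comment> \<open>The event does not depend on N, so N may tend to infinity in the bound.\<close>
  have "P.prob ?A \<le> real CARD('d) * q ^ n / exp (a * b)"
  proof (rule LIMSEQ_le_const)
    have "(\<lambda>N. \<Sum>p\<le>N. (a * b) ^ p / fact p) \<longlonglongrightarrow> exp (a * b)"
      using exp_converges[of "a * b"] by (simp add: sums_def_le divide_inverse mult.commute)
    then show "(\<lambda>N. real CARD('d) * q ^ n / (\<Sum>p\<le>N. (a * b) ^ p / fact p)) \<longlonglongrightarrow> real CARD('d) * q ^ n / exp (a * b)"
      by (intro tendsto_intros) auto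
    show "\<exists>N0. \<forall>N\<ge>N0. P.prob ?A \<le> real CARD('d) * q ^ n / (\<Sum>p\<le>N. (a * b) ^ p / fact p)"
    proof (intro exI allI impI)
      fix N
      have "0 \<le> real CARD('d) * q ^ n / (\<Sum>p\<le>N. (a * b) ^ p / fact p)"
        using q \<open>0 \<le> a\<close> \<open>0 \<le> b\<close> by (intro divide_nonneg_nonneg mult_nonneg_nonneg sum_nonneg) auto
      then show "P.prob ?A \<le> real CARD('d) * q ^ n / (\<Sum>p\<le>N. (a * b) ^ p / fact p)"
        using bound[of N] by (simp add: P.emeasure_eq_measure)
    qed
  qed
  then show ?thesis
    unfolding q_def[symmetric] by (simp add: P.emeasure_eq_measure ennreal_leI)
qed

section \<open>Measurability\<close>

lemma inner_outer: "G \<bullet> outer x = (G *v x) \<bullet> x"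
  by (simp add: inner_vec_def outer_def matrix_vector_mult_def sum_distrib_left sum_distrib_right mult_ac)

lemma inner_mat_1: "(G :: real^'d^'d) \<bullet> mat 1 = (\<Sum>j\<in>UNIV. G $ j $ j)"
  by (simp add: inner_vec_def mat_def if_distrib sum.delta cong: if_cong)

lemma norm_mat_1: "(norm (mat 1 :: real^'d^'d))\<^sup>2 = real CARD('d)"
  unfolding power2_norm_eq_inner inner_mat_1 by (simp add: mat_def)

lemma norm_matrix_vector_mult_le:
  fixes M :: "real^'d^'d"
  shows "norm (M *v w) \<le> norm M * norm w"
proof -
  have "norm (M *v w) \<le> L2_set (\<lambda>r. norm (M $ r) * norm w) UNIV"
    unfolding norm_vec_def[of "M *v w"] matrix_vector_mul_component
    using Cauchy_Schwarz_ineq2 by (intro L2_set_mono) auto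
  also have "\<dots> = norm M * norm w"
    by (simp add: L2_set_left_distrib[symmetric] norm_vec_def[of M])
  finally show ?thesis .
qed

lemma trace_of_matrix: "trace_of ((*v) (G :: real^'d^'d)) = (\<Sum>j\<in>UNIV. G $ j $ j)"
proof -
  have B: "(Basis :: (real^'d) set) = range (\<lambda>i. axis i 1)"
    by (auto simp: Basis_vec_def)
  have "trace_of ((*v) G) = (\<Sum>b\<in>range (\<lambda>i. axis i 1). (G *v b) \<bullet> b)"
    unfolding trace_of_def B ..
  also have "\<dots> = (\<Sum>j\<in>UNIV. (G *v axis j 1) \<bullet> axis j 1)"
    by (subst sum.reindex) (auto simp: inj_on_def axis_eq_axis)
  also have "\<dots> = (\<Sum>j\<in>UNIV. G $ j $ j)"
    by (simp add: inner_axis matrix_vector_mul_component)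
  finally show ?thesis .
qed

text \<open>In an eigenbasis the bound on the quadratic form says that every eigenvalue has modulus
  at most e.\<close>

lemma self_adjoint_onorm_le:
  fixes f :: "'a::euclidean_space \<Rightarrow> 'a"
  assumes "linear f" and "\<And>x y. f x \<bullet> y = x \<bullet> f y" and bound: "\<And>x. \<bar>f x \<bullet> x\<bar> \<le> e * (x \<bullet> x)"
  shows "onorm f \<le> e"
proof (rule self_adjoint_eigenbasis[OF assms(1,2)])
  fix q :: "nat \<Rightarrow> 'a" and l
  assume q: "orthonormal_basis q" "\<And>i. i < DIM('a) \<Longrightarrow> f (q i) = l i *\<^sub>R q i"
    and "\<And>i j. i \<le> j \<Longrightarrow> j < DIM('a) \<Longrightarrow> l j \<le> l i"
  have l: "\<bar>l i\<bar> \<le> e" if "i < DIM('a)" for i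
    using bound[of "q i"] q that by (simp add: orthonormal_basis_def)
  obtain b :: 'a where "b \<in> Basis" using nonempty_Basis by blast
  then have "0 \<le> e" using bound[of b] by simp
  show "onorm f \<le> e"
  proof (rule onorm_le)
    fix x
    have "(norm (f x))\<^sup>2 = (\<Sum>i<DIM('a). (l i)\<^sup>2 * (x \<bullet> q i)\<^sup>2)"
      unfolding orthonormal_basis_norm_sq[OF q(1), of "f x"]
      by (intro sum.cong refl) (simp add: assms(2) q(2) power_mult_distrib)
    also have "\<dots> \<le> (\<Sum>i<DIM('a). e\<^sup>2 * (x \<bullet> q i)\<^sup>2)"
      using l by (intro sum_mono mult_right_mono) (auto simp: abs_le_square_iff[symmetric] \<open>0 \<le> e\<close>)
    also have "\<dots> = (e * norm x)\<^sup>2"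
      by (simp only: power_mult_distrib orthonormal_basis_norm_sq[OF q(1), of x] sum_distrib_left)
    finally show "norm (f x) \<le> e * norm x"
      by (rule power2_le_imp_le) (simp add: \<open>0 \<le> e\<close>)
  qed
qed

lemma nearly_ENP_framesI:
  fixes x :: "nat \<Rightarrow> real^'d" and \<epsilon> :: real
  assumes "x \<in> extensional {..<n}" and "\<And>i. i < n \<Longrightarrow> x i \<in> shell \<epsilon> n" and "\<epsilon> < 1"
    and lo: "\<And>w. (1 - \<epsilon>) * (w \<bullet> w) \<le> (frame_operator n x *v w) \<bullet> w"
    and hi: "\<And>w. (frame_operator n x *v w) \<bullet> w \<le> (1 + \<epsilon>) * (w \<bullet> w)"
  shows "x \<in> nearly_ENP_frames \<epsilon> n"
proof -
  let ?T = "frame_operator n x - mat 1"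
  have "x \<in> frames n"
  proof (rule frames_if_frame_operator_inner_pos[OF assms(1)])
    fix w :: "real^'d" assume "w \<noteq> 0"
    then have "0 < (1 - \<epsilon>) * (w \<bullet> w)" using \<open>\<epsilon> < 1\<close> by simp
    then show "0 < (frame_operator n x *v w) \<bullet> w" using lo[of w] by linarith
  qed
  moreover have "onorm ((*v) ?T) \<le> \<epsilon>"
  proof (rule self_adjoint_onorm_le)
    show "(?T *v v) \<bullet> w = v \<bullet> (?T *v w)" for v w
    proof -
      have "v \<bullet> (frame_operator n x *v w) = (frame_operator n x *v v) \<bullet> w"
        by (simp add: inner_commute[of v "frame_operator n x *v w"] frame_operator_inner mult.commute)
      then show ?thesis
        by (simp add: matrix_vector_mult_diff_rdistrib inner_diff_left inner_diff_right)
    qed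
    show "\<bar>(?T *v w) \<bullet> w\<bar> \<le> \<epsilon> * (w \<bullet> w)" for w
      using lo[of w] hi[of w]
      by (simp add: matrix_vector_mult_diff_rdistrib inner_diff_left abs_le_iff algebra_simps)
  qed simp
  ultimately show ?thesis
    using assms(2) by (simp add: nearly_ENP_frames_def nearly_parseval_def nearly_equal_norm_def)
qed

text \<open>For \<epsilon> < 1 near-Parsevality already makes the frame operator positive definite,
  hence the vectors spanning. The set is therefore cut out by closed conditions; the operator norm
  bound is read as a bound for every w.\<close>

lemma nearly_ENP_frames_measurable:
  fixes \<epsilon> :: real
  assumes "\<epsilon> < 1"
  shows "(nearly_ENP_frames \<epsilon> n :: (nat \<Rightarrow> real^'d) set) \<in> sets (\<Pi>\<^sub>M i\<in>{..<n}. shell_measure \<epsilon> n)"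
proof -
  let ?P = "\<Pi>\<^sub>M i\<in>{..<n}. shell_measure \<epsilon> n :: (real^'d) measure"
  define K where "K = {M :: real^'d^'d. \<forall>w. norm (M *v w) \<le> \<epsilon> * norm w}"
  have "closed K"
    unfolding K_def
    by (intro closed_Collect_all closed_Collect_le continuous_intros continuous_on_matrix_vector_mult_left)
  then have [measurable]: "K \<in> sets borel" by simp
  have onorm: "onorm ((*v) M) \<le> \<epsilon> \<longleftrightarrow> M \<in> K" for M :: "real^'d^'d"
  proof
    assume "onorm ((*v) M) \<le> \<epsilon>"
    then have "norm (M *v w) \<le> \<epsilon> * norm w" for w
      using onorm[of "(*v) M" w] by (meson matrix_vector_mul_bounded_linear mult_right_mono norm_ge_zero order.trans)
    then show "M \<in> K" by (simp add: K_def)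
  next
    assume "M \<in> K"
    then show "onorm ((*v) M) \<le> \<epsilon>"
      unfolding K_def by (intro onorm_le) auto
  qed
  have "x \<in> frames n" if "x \<in> extensional {..<n}" and K: "frame_operator n x - mat 1 \<in> K" for x :: "nat \<Rightarrow> real^'d"
  proof (rule frames_if_frame_operator_inner_pos[OF that(1)])
    fix w :: "real^'d" assume "w \<noteq> 0"
    let ?T = "frame_operator n x - mat 1"
    have "\<bar>(?T *v w) \<bullet> w\<bar> \<le> norm (?T *v w) * norm w"
      by (rule Cauchy_Schwarz_ineq2)
    also have "\<dots> \<le> (\<epsilon> * norm w) * norm w"
      using K by (intro mult_right_mono) (auto simp: K_def)
    finally have "(w \<bullet> w) - \<epsilon> * (w \<bullet> w) \<le> (frame_operator n x *v w) \<bullet> w"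
      by (simp add: matrix_vector_mult_diff_rdistrib inner_diff_left dot_square_norm power2_eq_square mult_ac)
    moreover have "0 < (1 - \<epsilon>) * (w \<bullet> w)"
      using \<open>w \<noteq> 0\<close> assms by simp
    ultimately show "0 < (frame_operator n x *v w) \<bullet> w"
      by (simp add: algebra_simps)
  qed
  then have "nearly_ENP_frames \<epsilon> n
     = {x \<in> space ?P. (\<forall>i\<in>{..<n}. x i \<in> shell \<epsilon> n) \<and> (\<Sum>i<n. outer (x i)) - mat 1 \<in> K}"
    by (auto simp: nearly_ENP_frames_def nearly_parseval_def nearly_equal_norm_def onorm space_PiM
        frame_operator_eq_sum_outer PiE_def frames_def)
  also have "\<dots> \<in> sets ?P"
    by measurable
  finally show ?thesis .
qed

lemma frame_dist_nonneg: "0 \<le> frame_dist n x y"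
  by (simp add: frame_dist_def sum_nonneg)

text \<open>Y may be uncountable, so the union of open balls around it is rewritten as a countable
  union with centres in a dense countable set and rational radii.\<close>

lemma exists_frame_dist_less_measurable:
  fixes Y :: "(nat \<Rightarrow> real^'d) set"
  assumes [measurable_cong]: "sets M = sets borel"
  shows "{x \<in> space (\<Pi>\<^sub>M i\<in>{..<n}. M). \<exists>y\<in>Y. frame_dist n x y < r} \<in> sets (\<Pi>\<^sub>M i\<in>{..<n}. M)"
proof -
  let ?P = "\<Pi>\<^sub>M i\<in>{..<n}. M"
  obtain D :: "(real^'d) set" where D: "countable D" "\<And>X. open X \<Longrightarrow> X \<noteq> {} \<Longrightarrow> \<exists>d\<in>D. d \<in> X"
    using countable_dense_setE[where 'a = "real^'d"] by metis
  define Z where "Z = (\<Pi>\<^sub>E i\<in>{..<n}. D)"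
  define I where "I = {(z, q). z \<in> Z \<and> q \<in> \<rat> \<and> (\<exists>y\<in>Y. frame_dist n z y < q)}"
  have "countable Z" unfolding Z_def using D(1) by (intro countable_PiE) auto
  then have "countable (Z \<times> \<rat>)" using countable_rat by blast
  then have "countable I"
    by (rule countable_subset[rotated]) (auto simp: I_def)
  have "{x \<in> space ?P. \<exists>y\<in>Y. frame_dist n x y < r}
     = (\<Union>p\<in>I. {x \<in> space ?P. frame_dist n x (fst p) + snd p < r})"
  proof safe
    fix x y assume x: "x \<in> space ?P" and y: "y \<in> Y" "frame_dist n x y < r"
    \<comment> \<open>A third of the slack: the centre z is within \<delta> of y, and the radius q
      lies between \<delta> and 2 \<delta>, which together use less than 3 \<delta>.\<close>
    define \<delta> where "\<delta> = (r - frame_dist n x y) / 3"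
    have "\<delta> > 0" using y(2) by (simp add: \<delta>_def)
    have "0 < \<delta> / (real n + 1)" using \<open>\<delta> > 0\<close> by (intro divide_pos_pos) auto
    then have "\<exists>d\<in>D. dist d (y i) < \<delta> / (real n + 1)" for i
      using D(2)[of "ball (y i) (\<delta> / (real n + 1))"] by (auto simp: dist_commute not_le)
    then obtain z0 where z0: "\<And>i. z0 i \<in> D" "\<And>i. dist (z0 i) (y i) < \<delta> / (real n + 1)"
      by metis
    define z where "z = restrict z0 {..<n}"
    have "frame_dist n z y \<le> (\<Sum>i<n. norm (z i - y i))"
      unfolding frame_dist_eq_L2_set by (rule L2_set_le_sum) simp
    also have "\<dots> \<le> (\<Sum>i<n. \<delta> / (real n + 1))"
      using z0(2) by (intro sum_mono less_imp_le) (auto simp: z_def dist_norm)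
    also have "\<dots> < \<delta>"
      using \<open>\<delta> > 0\<close> by (simp add: field_simps)
    finally have zy: "frame_dist n z y < \<delta>" .
    obtain q where q: "q \<in> \<rat>" "\<delta> < q" "q < 2 * \<delta>"
      using Rats_dense_in_real[of \<delta> "2 * \<delta>"] \<open>\<delta> > 0\<close> by auto
    have "frame_dist n x z + q < r"
      using frame_dist_triangle[of n x z y] frame_dist_commute[of n y z] zy q(3)
      by (simp add: \<delta>_def field_simps)
    moreover have "(z, q) \<in> I"
      using z0(1) q zy y(1) by (force simp: I_def Z_def z_def)
    ultimately show "x \<in> (\<Union>p\<in>I. {x \<in> space ?P. frame_dist n x (fst p) + snd p < r})"
      using x by force
  next
    fix x z q assume "x \<in> space ?P" "(z, q) \<in> I" "frame_dist n x (fst (z, q)) + snd (z, q) < r"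
    then obtain y where "y \<in> Y" "frame_dist n z y < q" "frame_dist n x z + q < r"
      by (auto simp: I_def)
    then show "\<exists>y\<in>Y. frame_dist n x y < r"
      using frame_dist_triangle[of n x y z] by (intro bexI[of _ y]) auto
  qed
  also have "\<dots> \<in> sets ?P"
  proof (rule sets.countable_UN''[OF \<open>countable I\<close>])
    show "{x \<in> space ?P. frame_dist n x (fst p) + snd p < r} \<in> sets ?P" for p
      unfolding frame_dist_def by measurable
  qed
  finally show ?thesis .
qed

text \<open>The infimum need not be attained, so the condition is expressed through the strict
  inequalities with C + 1 / (m + 1), a countable intersection of sets of the preceding form.\<close>

lemma INF_frame_dist_measurable:
  fixes Y :: "(nat \<Rightarrow> real^'d) set"
  assumes M: "sets M = sets borel"
  shows "{x \<in> space (\<Pi>\<^sub>M i\<in>{..<n}. M). (INF y\<in>Y. (frame_dist n x y)\<^sup>2) \<le> C} \<in> sets (\<Pi>\<^sub>M i\<in>{..<n}. M)"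
proof (cases "Y = {}")
  case False
  let ?P = "\<Pi>\<^sub>M i\<in>{..<n}. M"
  have bdd: "bdd_below ((\<lambda>y. (frame_dist n x y)\<^sup>2) ` Y)" for x
    by (rule bdd_belowI[of _ 0]) auto
  have "(INF y\<in>Y. (frame_dist n x y)\<^sup>2) \<le> C \<longleftrightarrow> (\<forall>m::nat. \<exists>y\<in>Y. frame_dist n x y < sqrt (C + 1 / real (Suc m)))" for x
  proof -
    have "(INF y\<in>Y. (frame_dist n x y)\<^sup>2) \<le> C \<longleftrightarrow> (\<forall>m::nat. (INF y\<in>Y. (frame_dist n x y)\<^sup>2) < C + 1 / real (Suc m))"
    proof
      assume "(INF y\<in>Y. (frame_dist n x y)\<^sup>2) \<le> C"
      then show "\<forall>m::nat. (INF y\<in>Y. (frame_dist n x y)\<^sup>2) < C + 1 / real (Suc m)"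
        by (auto intro: order.strict_trans1)
    next
      assume *: "\<forall>m::nat. (INF y\<in>Y. (frame_dist n x y)\<^sup>2) < C + 1 / real (Suc m)"
      show "(INF y\<in>Y. (frame_dist n x y)\<^sup>2) \<le> C"
      proof (rule field_le_epsilon)
        fix e :: real assume "0 < e"
        then obtain m where "1 / real (Suc m) < e"
          using reals_Archimedean[of e] by (auto simp: inverse_eq_divide)
        then show "(INF y\<in>Y. (frame_dist n x y)\<^sup>2) \<le> C + e"
          using *[rule_format, of m] by linarith
      qed
    qed
    also have "\<dots> \<longleftrightarrow> (\<forall>m::nat. \<exists>y\<in>Y. (frame_dist n x y)\<^sup>2 < C + 1 / real (Suc m))"
      using cINF_less_iff[OF False bdd] by simp
    also have "\<dots> \<longleftrightarrow> (\<forall>m::nat. \<exists>y\<in>Y. frame_dist n x y < sqrt (C + 1 / real (Suc m)))"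
      \<comment> \<open>\<open>sqrt\<close> is strictly increasing on all reals here, so the sign of
        C does not matter.\<close>
      using real_sqrt_less_iff[of "(frame_dist n x y)\<^sup>2" for y] by (simp add: frame_dist_nonneg)
    finally show ?thesis .
  qed
  then have "{x \<in> space ?P. (INF y\<in>Y. (frame_dist n x y)\<^sup>2) \<le> C}
     = (\<Inter>m::nat. {x \<in> space ?P. \<exists>y\<in>Y. frame_dist n x y < sqrt (C + 1 / real (Suc m))})"
    by auto
  also have "\<dots> \<in> sets ?P"
    using exists_frame_dist_less_measurable[OF M] by (intro sets.countable_INT) auto
  finally show ?thesis .
\<comment> \<open>For empty Y the infimum is one fixed real, and the set is empty or the whole
  space.\<close>
qed simp

section \<open>Concentration of the frame operator\<close>

lemma AE_PiM_shell_measure: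
  fixes \<epsilon> :: real
  assumes "0 < \<epsilon>" "\<epsilon> < 1" "0 < n"
  shows "AE x in (\<Pi>\<^sub>M i\<in>{..<n}. shell_measure \<epsilon> n :: (real^'d) measure). \<forall>i<n. x i \<in> shell \<epsilon> n"
proof -
  have "AE x in (\<Pi>\<^sub>M i\<in>{..<n}. shell_measure \<epsilon> n :: (real^'d) measure). \<forall>i\<in>{..<n}. x i \<in> shell \<epsilon> n"
  proof (rule AE_finite_allI)
    fix i assume "i \<in> {..<n}"
    then show "AE x in (\<Pi>\<^sub>M i\<in>{..<n}. shell_measure \<epsilon> n :: (real^'d) measure). x i \<in> shell \<epsilon> n"
      using prob_space_shell_measure[OF assms] AE_shell_measure
      by (intro AE_PiM_component[where P = "\<lambda>v. v \<in> shell \<epsilon> n"]) auto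
  qed simp
  then show ?thesis by (rule eventually_mono) auto
qed

text \<open>The deviation is a sum of the centred matrices (d/n) u u^T - I/n, of Frobenius norm at
  most (d + sqrt d) / n <= 2 d / n. Hoeffding's bound with B = 2 d / n has the exponent n t^2 / (8
  d^2).\<close>

lemma gram_deviation_concentration:
  fixes \<epsilon> t :: real
  assumes \<epsilon>: "0 < \<epsilon>" "\<epsilon> < 1" and n: "0 < n" and "0 \<le> t"
  shows "emeasure (\<Pi>\<^sub>M i\<in>{..<n}. shell_measure \<epsilon> n :: (real^'d) measure)
      {x \<in> space (\<Pi>\<^sub>M i\<in>{..<n}. shell_measure \<epsilon> n). t \<le> norm (gram_deviation n (\<lambda>i. (1 / norm (x i)) *\<^sub>R x i))}
    \<le> ennreal (2 * exp (- real n * t\<^sup>2 / (8 * (real CARD('d))\<^sup>2)))"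
proof -
  let ?d = "real CARD('d)"
  let ?M = "shell_measure \<epsilon> n :: (real^'d) measure"
  interpret prob_space ?M using \<epsilon> n by (rule prob_space_shell_measure)
  define f where "f x = (?d / real n) *\<^sub>R outer ((1 / norm x) *\<^sub>R x) - (1 / real n) *\<^sub>R mat 1" for x :: "real^'d"
  have d1: "1 \<le> ?d" by (simp add: Suc_le_eq)
  have [measurable]: "f \<in> borel_measurable ?M"
    unfolding f_def by measurable
  have bound: "AE x in ?M. norm (f x) \<le> 2 * ?d / real n"
    using AE_shell_measure
  proof eventually_elim
    case (elim x)
    have "norm (f x) \<le> ?d / real n * 1 + 1 / real n * norm (mat 1 :: real^'d^'d)"
      unfolding f_def using shell_norm_bounds(1)[OF elim \<epsilon> n]
      by (intro order.trans[OF norm_triangle_ineq4]) (simp add: norm_outer)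
    moreover have "norm (mat 1 :: real^'d^'d) \<le> ?d"
    proof (rule power2_le_imp_le)
      show "(norm (mat 1 :: real^'d^'d))\<^sup>2 \<le> ?d\<^sup>2"
        unfolding norm_mat_1 using d1 by (simp add: power2_eq_square)
    qed simp
    then have "1 / real n * norm (mat 1 :: real^'d^'d) \<le> 1 / real n * ?d"
      by (intro mult_left_mono) auto
    ultimately show ?case by simp
  qed
  have mean: "(\<integral>x. G \<bullet> f x \<partial>?M) = 0" for G
  proof -
    let ?tr = "\<Sum>j\<in>UNIV. G $ j $ j"
    \<comment> \<open>The radial weight 1 / t^2 describes normalised vectors; it times |x|^2 is
      constantly 1 on the shell.\<close>
    have K: "\<bar>1 / (norm x)\<^sup>2\<bar> * (norm x)\<^sup>2 \<le> 1" if "x \<in> shell \<epsilon> n" for x :: "real^'d"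
      using shell_norm_bounds(1)[OF that \<epsilon> n] by simp
    have "(\<integral>x. 1 / (norm x)\<^sup>2 * (norm x)\<^sup>2 \<partial>?M) = (\<integral>x. 1 \<partial>?M)"
    proof (rule integral_cong_AE)
      show "AE x in ?M. 1 / (norm x)\<^sup>2 * (norm x)\<^sup>2 = (1 :: real)"
        using AE_shell_measure
      proof eventually_elim
        case (elim x)
        then show ?case using shell_norm_bounds(1)[OF elim \<epsilon> n] by simp
      qed
    qed measurable
    then have "(\<integral>x. 1 / (norm x)\<^sup>2 * (norm x)\<^sup>2 \<partial>?M) = 1"
      using prob_space by simp
    then have eq: "(\<integral>x. 1 / (norm x)\<^sup>2 * ((G *v x) \<bullet> x) \<partial>?M) = 1 / ?d * ?tr"
      and int: "integrable ?M (\<lambda>x. 1 / (norm x)\<^sup>2 * ((G *v x) \<bullet> x))"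
      using integral_radial_quadratic[of \<epsilon> n "\<lambda>t. 1 / t\<^sup>2" 1 G, OF \<epsilon> n _ K] by simp_all
    have "G \<bullet> f x = (?d / real n) * (1 / (norm x)\<^sup>2 * ((G *v x) \<bullet> x)) - 1 / real n * ?tr" for x
      by (simp add: f_def inner_diff_right inner_outer inner_mat_1 matrix_vector_mult_scaleR power2_eq_square)
    then have "(\<integral>x. G \<bullet> f x \<partial>?M) = (?d / real n) * (1 / ?d * ?tr) - 1 / real n * ?tr"
      using eq int prob_space by (simp del: times_divide_eq_left times_divide_eq_right)
    then show ?thesis by simp
  qed
  have sum: "(\<Sum>i<n. f (x i)) = gram_deviation n (\<lambda>i. (1 / norm (x i)) *\<^sub>R x i)" for x
    using n by (simp add: f_def gram_deviation_def sum_subtractf scaleR_sum_right sum_constant_scaleR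
        del: sum_constant)
  have "emeasure (\<Pi>\<^sub>M i\<in>{..<n}. ?M) {x \<in> space (\<Pi>\<^sub>M i\<in>{..<n}. ?M). t \<le> norm (\<Sum>i<n. f (x i))}
    \<le> ennreal (2 * exp (- t\<^sup>2 / (2 * real n * (2 * ?d / real n)\<^sup>2)))"
    using bound mean n \<open>0 \<le> t\<close> by (intro PiM_norm_sum_hoeffding) auto
  moreover have "- t\<^sup>2 / (2 * real n * (2 * ?d / real n)\<^sup>2) = - real n * t\<^sup>2 / (8 * ?d\<^sup>2)"
    using n by (simp add: power2_eq_square field_simps)
  ultimately show ?thesis by (simp only: sum)
qed

text \<open>The first two Taylor terms; the difference of the two sides has derivative x^2 / (1 -
  x).\<close>

lemma ln_one_minus_le:
  fixes g :: real
  assumes "0 \<le> g" "g < 1"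
  shows "ln (1 - g) \<le> - g - g\<^sup>2 / 2"
proof -
  let ?h = "\<lambda>x. - x - x\<^sup>2 / 2 - ln (1 - x)"
  have "?h 0 \<le> ?h g"
  proof (rule DERIV_nonneg_imp_nondecreasing[OF assms(1)])
    fix x assume x: "0 \<le> x" "x \<le> g"
    then have "x < 1" using assms by simp
    then have "(?h has_real_derivative (- 1 - x + 1 / (1 - x))) (at x)"
      by (auto intro!: derivative_eq_intros)
    moreover have "- 1 - x + 1 / (1 - x) = x\<^sup>2 / (1 - x)"
      using \<open>x < 1\<close> by (simp add: power2_eq_square divide_simps) (simp add: algebra_simps)
    then have "0 \<le> - 1 - x + 1 / (1 - x)"
      using \<open>x < 1\<close> by (simp only:) simp
    ultimately show "\<exists>y. (?h has_real_derivative y) (at x) \<and> 0 \<le> y" by blast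
  qed
  then show ?thesis by simp
qed

lemma integral_shell_quadratic_form:
  fixes g :: "real^'d \<Rightarrow> real^'d" and \<epsilon> :: real
  assumes \<epsilon>: "0 < \<epsilon>" "\<epsilon> < 1" and n: "0 < n" and "linear g"
  shows "integrable (shell_measure \<epsilon> n) (\<lambda>x. g x \<bullet> x)"
    and "(\<integral>x. g x \<bullet> x \<partial>shell_measure \<epsilon> n)
      = (\<integral>x. (norm x)\<^sup>2 \<partial>(shell_measure \<epsilon> n :: (real^'d) measure)) / CARD('d) * trace_of g"
proof -
  have g: "g x = matrix g *v x" for x
    using assms(4) by (simp add: matrix_works)
  have K: "\<bar>1\<bar> * (norm x)\<^sup>2 \<le> (1 + \<epsilon>) * (CARD('d) / real n)" if "x \<in> shell \<epsilon> n" for x :: "real^'d"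
    using shell_norm_bounds(2)[OF that \<epsilon> n] by simp
  have tr: "trace_of g = (\<Sum>j\<in>UNIV. matrix g $ j $ j)"
  proof -
    have "(*v) (matrix g) = g" by (rule ext) (rule g[symmetric])
    then show ?thesis using trace_of_matrix[of "matrix g"] by simp
  qed
  show "integrable (shell_measure \<epsilon> n) (\<lambda>x. g x \<bullet> x)"
    "(\<integral>x. g x \<bullet> x \<partial>shell_measure \<epsilon> n)
      = (\<integral>x. (norm x)\<^sup>2 \<partial>(shell_measure \<epsilon> n :: (real^'d) measure)) / CARD('d) * trace_of g"
    using integral_radial_quadratic[of \<epsilon> n "\<lambda>_. 1" _ "matrix g", OF \<epsilon> n _ K] unfolding tr
    by (simp_all add: g[symmetric])
qed

text \<open>The number g is the relative gap between the mean and the threshold: m <= (1 +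
  \<epsilon>) (1 - g). The Chernoff parameter \<theta> = - ln (1 - g) gives the exponent (n/d) (g +
  ln (1 - g)) <= - (n/d) g^2 / 2, and g >= \<epsilon>^2 / d brings it to the form - n \<epsilon>^4 /
  (2 d^3) of the theorem.\<close>

lemma frame_operator_upper_tail:
  fixes \<epsilon> :: real
  assumes \<epsilon>: "0 < \<epsilon>" "\<epsilon> < 1" and n: "0 < n" and d: "2 \<le> CARD('d)"
  shows "emeasure (\<Pi>\<^sub>M i\<in>{..<n}. shell_measure \<epsilon> n :: (real^'d) measure)
      {x \<in> space (\<Pi>\<^sub>M i\<in>{..<n}. shell_measure \<epsilon> n). (\<Sum>i<n. outer (x i)) \<notin> quadratic_form_le (1 + \<epsilon>)}
    \<le> ennreal (real CARD('d) * exp (- (real n * \<epsilon> ^ 4) / (2 * real CARD('d) ^ 3)))"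
proof -
  let ?d = "real CARD('d)"
  let ?M = "shell_measure \<epsilon> n :: (real^'d) measure"
  define s where "s = (\<integral>x. (norm x)\<^sup>2 \<partial>?M)"
  define R where "R = (1 + \<epsilon>) * (?d / real n)"
  define g where "g = 4 * \<epsilon> / ((?d + 2) * (1 + \<epsilon>))"
  define \<theta> where "\<theta> = - ln (1 - g)"
  have d2: "2 \<le> ?d" using d by simp
  have "4 * \<epsilon> < (?d + 2) * (1 + \<epsilon>)"
  proof -
    have "4 * \<epsilon> < 4 * (1 + \<epsilon>)" by simp
    also have "\<dots> \<le> (?d + 2) * (1 + \<epsilon>)"
      using d2 \<epsilon> by (intro mult_right_mono) auto
    finally show ?thesis .
  qed
  then have g: "0 < g" "g < 1" using \<epsilon> d2 by (auto simp: g_def)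
  have R: "0 < R" using \<epsilon> n by (simp add: R_def)
  have \<theta>: "0 \<le> \<theta>" "exp \<theta> = 1 / (1 - g)"
    using g by (auto simp: \<theta>_def exp_minus divide_inverse)
  have s0: "0 \<le> s" by (simp add: s_def)
  have m: "real n / ?d * s \<le> (1 + \<epsilon>) * (1 - g)"
  proof -
    have "(1 + \<epsilon>) * g = 4 * \<epsilon> / (?d + 2)"
      using \<epsilon> by (simp add: g_def)
    then have "(1 + \<epsilon>) * (1 - g) = 1 + \<epsilon> - 4 * \<epsilon> / (?d + 2)"
      by (simp add: right_diff_distrib)
    then show ?thesis
      using shell_second_moment_bounds(2)[where 'd = 'd, OF \<epsilon> n d] by (simp add: s_def add.commute)
  qed
  have "emeasure (\<Pi>\<^sub>M i\<in>{..<n}. ?M)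
      {x \<in> space (\<Pi>\<^sub>M i\<in>{..<n}. ?M). (\<Sum>i<n. outer (x i)) \<notin> quadratic_form_le (1 + \<epsilon>)}
    \<le> ennreal (?d * (1 + (s / ?d) / R * (exp ((\<theta> / R) * R) - 1)) ^ n / exp ((\<theta> / R) * (1 + \<epsilon>)))"
  proof (rule matrix_chernoff)
    show "prob_space ?M" using \<epsilon> n by (rule prob_space_shell_measure)
    show "AE x in ?M. (norm x)\<^sup>2 \<le> R"
      using AE_shell_measure
    proof eventually_elim
      case (elim x)
      then show ?case using shell_norm_bounds(2)[OF elim \<epsilon> n] by (simp add: R_def)
    qed
    show "integrable ?M (\<lambda>x. f x \<bullet> x) \<and> (\<integral>x. f x \<bullet> x \<partial>?M) = s / ?d * trace_of f" if "linear f" for f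
      using integral_shell_quadratic_form[OF \<epsilon> n that] by (simp add: s_def)
  qed (use R \<theta> s0 \<epsilon> in auto)
  also have "\<dots> \<le> ennreal (?d * exp (- (real n * \<epsilon> ^ 4) / (2 * ?d ^ 3)))"
  proof (rule ennreal_leI)
    let ?y = "(s / ?d) / R * (exp \<theta> - 1)"
    have "0 \<le> ?y" using s0 R \<theta>(1) by simp
    then have "(1 + ?y) ^ n \<le> exp ?y ^ n"
      by (intro power_mono exp_ge_add_one_self) auto
    also have "\<dots> = exp (real n * ?y)"
      by (rule exp_of_nat_mult[symmetric])
    also have "real n * ?y \<le> real n / ?d * g"
    proof -
      \<comment> \<open>The factor in the middle is m / (1 + \<epsilon>), at most 1 - g, and this
        cancels the denominator of exp \<theta> - 1 = g / (1 - g).\<close>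
      have "real n * ?y = (real n / ?d) * (real n / ?d * s / (1 + \<epsilon>)) * (g / (1 - g))"
        using n g \<epsilon> unfolding \<theta>(2) R_def by (simp add: field_simps)
      also have "\<dots> \<le> (real n / ?d) * (1 - g) * (g / (1 - g))"
        using m \<epsilon> g by (intro mult_right_mono mult_left_mono) (auto simp: pos_divide_le_eq mult_ac)
      also have "\<dots> = real n / ?d * g" using g by simp
      finally show ?thesis .
    qed
    finally have "(1 + ?y) ^ n \<le> exp (real n / ?d * g)" by simp
    moreover have "(\<theta> / R) * (1 + \<epsilon>) = real n / ?d * \<theta>"
    proof -
      have "(\<theta> / (b * q)) * b = \<theta> / q" if "b \<noteq> 0" for b q :: real
        using that by simp
      from this[of "1 + \<epsilon>"] show ?thesis using \<epsilon> by (simp add: R_def)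
    qed
    ultimately have "?d * (1 + ?y) ^ n / exp ((\<theta> / R) * (1 + \<epsilon>)) \<le> ?d * exp (real n / ?d * g) / exp (real n / ?d * \<theta>)"
      by (simp add: divide_right_mono)
    also have "\<dots> = ?d * exp (real n / ?d * (g + ln (1 - g)))"
    proof -
      have "exp (k * g) / exp (k * \<theta>) = exp (k * (g + ln (1 - g)))" for k
        by (simp add: exp_diff[symmetric] \<theta>_def distrib_left)
      then show ?thesis by (simp only: times_divide_eq_right[symmetric])
    qed
    also have "\<dots> \<le> ?d * exp (- (real n * \<epsilon> ^ 4) / (2 * ?d ^ 3))"
    proof -
      \<comment> \<open>Amounts to (d + 2) \<epsilon> (1 + \<epsilon>) <= 4 d, which follows from d
        + 2 <= 2 d and \<epsilon> (1 + \<epsilon>) <= 2.\<close>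
      have "\<epsilon>\<^sup>2 / ?d \<le> g"
      proof -
        have "(?d + 2) * (\<epsilon> * (1 + \<epsilon>)) \<le> (2 * ?d) * 2"
        proof (rule mult_mono)
          show "\<epsilon> * (1 + \<epsilon>) \<le> 2" using \<epsilon> mult_mono[of \<epsilon> 1 "1 + \<epsilon>" 2] by auto
        qed (use d2 \<epsilon> in auto)
        then have "\<epsilon> * ((?d + 2) * (\<epsilon> * (1 + \<epsilon>))) \<le> \<epsilon> * (4 * ?d)"
          using \<epsilon> by (intro mult_left_mono) auto
        then show ?thesis
          using \<epsilon> d2 by (simp add: g_def pos_divide_le_eq pos_le_divide_eq power2_eq_square mult_ac)
      qed
      then have "(\<epsilon>\<^sup>2 / ?d)\<^sup>2 \<le> g\<^sup>2"
        by (intro power_mono) auto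
      moreover have "g + ln (1 - g) \<le> - (g\<^sup>2 / 2)"
        using ln_one_minus_le[of g] g by simp
      ultimately have "g + ln (1 - g) \<le> - ((\<epsilon>\<^sup>2 / ?d)\<^sup>2 / 2)" by linarith
      then have "real n / ?d * (g + ln (1 - g)) \<le> real n / ?d * - ((\<epsilon>\<^sup>2 / ?d)\<^sup>2 / 2)"
        by (intro mult_left_mono) auto
      also have "\<dots> = - (real n * \<epsilon> ^ 4) / (2 * ?d ^ 3)"
        by (simp add: power_divide power2_eq_square power3_eq_cube power4_eq_xxxx)
      finally show ?thesis by simp
    qed
    finally show "?d * (1 + (s / ?d) / R * (exp ((\<theta> / R) * R) - 1)) ^ n / exp ((\<theta> / R) * (1 + \<epsilon>))
      \<le> ?d * exp (- (real n * \<epsilon> ^ 4) / (2 * ?d ^ 3))"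
      using R by simp
  qed
  finally show ?thesis .
qed

text \<open>Since the mean n c I is at least I, falling below 1 - \<epsilon> requires a deviation of
  at least \<epsilon> from the mean, to which Chebyshev's inequality applies in the Frobenius norm.
  The variance of a summand is at most R times the mean of |x|^2.\<close>

lemma frame_operator_lower_tail:
  fixes \<epsilon> :: real
  assumes \<epsilon>: "0 < \<epsilon>" "\<epsilon> < 1" and n: "0 < n" and d: "2 \<le> CARD('d)"
  defines "c \<equiv> (\<integral>x. (norm x)\<^sup>2 \<partial>(shell_measure \<epsilon> n :: (real^'d) measure)) / CARD('d)"
  shows "emeasure (\<Pi>\<^sub>M i\<in>{..<n}. shell_measure \<epsilon> n :: (real^'d) measure)
      {x \<in> space (\<Pi>\<^sub>M i\<in>{..<n}. shell_measure \<epsilon> n). \<epsilon> \<le> norm ((\<Sum>i<n. outer (x i)) - (real n * c) *\<^sub>R mat 1)}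
    \<le> ennreal (4 * real CARD('d) ^ 3 / ((CARD('d) + 2) * real n * \<epsilon>\<^sup>2))"
    and "1 \<le> real n * c"
proof -
  let ?d = "real CARD('d)"
  let ?M = "shell_measure \<epsilon> n :: (real^'d) measure"
  interpret prob_space ?M using \<epsilon> n by (rule prob_space_shell_measure)
  have d2: "2 \<le> ?d" using d by simp
  define R where "R = (1 + \<epsilon>) * (?d / real n)"
  have R: "0 < R" using \<epsilon> n by (simp add: R_def)
  have m: "1 \<le> real n * c" "real n * c \<le> 1 + \<epsilon> - 4 * \<epsilon> / (?d + 2)"
    using shell_second_moment_bounds[where 'd = 'd, OF \<epsilon> n d] by (simp_all add: c_def add.commute)
  then show "1 \<le> real n * c" by simp
  then have "0 < c" using n by (smt (verit) mult_nonneg_nonpos of_nat_0_le_iff)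
  have le: "AE x in ?M. (norm x)\<^sup>2 \<le> R"
    using AE_shell_measure
  proof eventually_elim
    case (elim x)
    then show ?case using shell_norm_bounds(2)[OF elim \<epsilon> n] by (simp add: R_def)
  qed
  have int2: "integrable ?M (\<lambda>x. (norm x)\<^sup>2)"
    by (rule integrable_const_bound[where B = R]) (use le in auto)
  have E2: "(\<integral>x. (norm x)\<^sup>2 \<partial>?M) = ?d * c" by (simp add: c_def)
  define f where "f x = outer x - c *\<^sub>R mat 1" for x :: "real^'d"
  have [measurable]: "f \<in> borel_measurable ?M"
    unfolding f_def by measurable
  have bound: "AE x in ?M. norm (f x) \<le> R + c * norm (mat 1 :: real^'d^'d)"
    using le
  proof eventually_elim
    case (elim x)
    then show ?case
      unfolding f_def using \<open>0 < c\<close>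
      by (intro order.trans[OF norm_triangle_ineq4]) (simp add: norm_outer)
  qed
  have mean: "(\<integral>x. G \<bullet> f x \<partial>?M) = 0" for G
    using integral_shell_quadratic_form[where g = "(*v) G", OF \<epsilon> n] prob_space
    by (simp add: f_def inner_diff_right inner_outer inner_mat_1 trace_of_matrix c_def)
  have nf: "(norm (f x))\<^sup>2 = (norm x)\<^sup>2 * (norm x)\<^sup>2 - 2 * c * (norm x)\<^sup>2 + c\<^sup>2 * ?d" for x
  proof -
    have "(norm (f x))\<^sup>2 = (norm (outer x))\<^sup>2 - 2 * c * (outer x \<bullet> mat 1) + c\<^sup>2 * (norm (mat 1 :: real^'d^'d))\<^sup>2"
      unfolding f_def power2_norm_eq_inner
      by (simp add: inner_diff_left inner_diff_right inner_commute power2_eq_square algebra_simps)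
    moreover have "outer x \<bullet> mat 1 = (norm x)\<^sup>2"
      by (simp add: inner_mat_1 norm_power2_vec outer_def)
    ultimately show ?thesis
      by (simp add: norm_outer norm_mat_1 power2_eq_square[of "(norm x)\<^sup>2"])
  qed
  have "(\<integral>x. (norm (f x))\<^sup>2 \<partial>?M) \<le> (\<integral>x. (R - 2 * c) * (norm x)\<^sup>2 + c\<^sup>2 * ?d \<partial>?M)"
  proof (rule integral_mono_AE)
    show "integrable ?M (\<lambda>x. (norm (f x))\<^sup>2)"
      by (rule integrable_const_bound[where B = "(R + c * norm (mat 1 :: real^'d^'d))\<^sup>2"])
         (use bound in \<open>auto elim!: eventually_mono intro: power_mono\<close>)
    show "AE x in ?M. (norm (f x))\<^sup>2 \<le> (R - 2 * c) * (norm x)\<^sup>2 + c\<^sup>2 * ?d"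
      using le
    proof eventually_elim
      case (elim x)
      then show ?case
        unfolding nf using mult_right_mono[OF elim, of "(norm x)\<^sup>2"] by (simp add: algebra_simps)
    qed
  qed (use int2 in auto)
  also have "\<dots> = (R - 2 * c) * (?d * c) + c\<^sup>2 * ?d"
    using int2 prob_space by (simp add: E2)
  also have "\<dots> \<le> R * (?d * c)"
    using \<open>0 < c\<close> by (simp add: power2_eq_square algebra_simps)
  finally have var: "(\<integral>x. (norm (f x))\<^sup>2 \<partial>?M) \<le> R * (?d * c)" .
  have sum: "(\<Sum>i<n. f (x i)) = (\<Sum>i<n. outer (x i)) - (real n * c) *\<^sub>R mat 1" for x
    by (simp add: f_def sum_subtractf sum_constant_scaleR del: sum_constant)
  have "emeasure (\<Pi>\<^sub>M i\<in>{..<n}. ?M) {x \<in> space (\<Pi>\<^sub>M i\<in>{..<n}. ?M). \<epsilon> \<le> norm (\<Sum>i<n. f (x i))}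
    \<le> ennreal (real n * (R * (?d * c)) / \<epsilon>\<^sup>2)"
    using bound mean var \<epsilon> by (intro PiM_norm_sum_chebyshev) auto
  also have "\<dots> \<le> ennreal (4 * ?d ^ 3 / ((?d + 2) * real n * \<epsilon>\<^sup>2))"
  proof (rule ennreal_leI)
    \<comment> \<open>The left side is nondecreasing in \<epsilon> because d >= 2; the right side is
      its value at \<epsilon> = 1.\<close>
    have "1 + \<epsilon> - 4 * \<epsilon> / (?d + 2) \<le> 2 * ?d / (?d + 2)"
    proof -
      have "\<epsilon> * (?d - 2) \<le> 1 * (?d - 2)"
        using \<epsilon> d2 by (intro mult_right_mono) auto
      then have "((1 + \<epsilon>) * (?d + 2) - 4 * \<epsilon>) / (?d + 2) \<le> 2 * ?d / (?d + 2)"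
        by (intro divide_right_mono) (auto simp: algebra_simps)
      then show ?thesis by (simp add: diff_divide_distrib)
    qed
    then have "(1 + \<epsilon>) * (real n * c) \<le> 2 * (2 * ?d / (?d + 2))"
      using \<epsilon> m by (intro mult_mono) auto
    then have "?d\<^sup>2 * ((1 + \<epsilon>) * (real n * c)) / (real n * \<epsilon>\<^sup>2) \<le> ?d\<^sup>2 * (2 * (2 * ?d / (?d + 2))) / (real n * \<epsilon>\<^sup>2)"
      by (intro divide_right_mono mult_left_mono) auto
    moreover have "real n * (R * (?d * c)) / \<epsilon>\<^sup>2 = ?d\<^sup>2 * ((1 + \<epsilon>) * (real n * c)) / (real n * \<epsilon>\<^sup>2)"
      using n by (simp add: R_def power2_eq_square field_simps)
    moreover have "?d\<^sup>2 * (2 * (2 * ?d / (?d + 2))) / (real n * \<epsilon>\<^sup>2) = 4 * ?d ^ 3 / ((?d + 2) * real n * \<epsilon>\<^sup>2)"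
      by (simp add: power2_eq_square power3_eq_cube mult_ac)
    ultimately show "real n * (R * (?d * c)) / \<epsilon>\<^sup>2 \<le> 4 * ?d ^ 3 / ((?d + 2) * real n * \<epsilon>\<^sup>2)" by simp
  qed
  finally show "emeasure (\<Pi>\<^sub>M i\<in>{..<n}. ?M)
      {x \<in> space (\<Pi>\<^sub>M i\<in>{..<n}. ?M). \<epsilon> \<le> norm ((\<Sum>i<n. outer (x i)) - (real n * c) *\<^sub>R mat 1)}
    \<le> ennreal (4 * ?d ^ 3 / ((CARD('d) + 2) * real n * \<epsilon>\<^sup>2))"
    by (simp add: sum add.commute)
qed

text \<open>The value 1/8 is 1 - 1/2 - 3/8. The hypothesis brings the upper tail d exp (- E) down to
  1/2, and the lower tail is at most 3/8.\<close>

lemma prob_nearly_ENP_frames_ge: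
  fixes \<epsilon> :: real
  assumes \<epsilon>: "0 < \<epsilon>" "\<epsilon> < 1" and n: "0 < n"
    and large: "ln (2 * real CARD('d)) \<le> real n * \<epsilon> ^ 4 / (2 * real CARD('d) ^ 3)"
  shows "1 / 8 \<le> measure (\<Pi>\<^sub>M i\<in>{..<n}. shell_measure \<epsilon> n :: (real^'d) measure) (nearly_ENP_frames \<epsilon> n)"
proof -
  let ?d = "real CARD('d)"
  let ?M = "shell_measure \<epsilon> n :: (real^'d) measure"
  let ?P = "\<Pi>\<^sub>M i\<in>{..<n}. ?M"
  interpret P: prob_space ?P
    using prob_space_shell_measure[OF \<epsilon> n] by (intro prob_space_PiM)
  have B [measurable]: "nearly_ENP_frames \<epsilon> n \<in> sets ?P"
    using nearly_ENP_frames_measurable[OF \<epsilon>(2)] .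
  note shell = AE_PiM_shell_measure[where 'd = 'd, OF \<epsilon> n]
  have space: "x \<in> extensional {..<n}" if "x \<in> space ?P" for x
    using that by (simp add: space_PiM PiE_def)
  consider "CARD('d) = 1" | "2 \<le> CARD('d)"
    using zero_less_card_finite[where 'a = 'd] by linarith
  then show ?thesis
  proof cases
    case 1
    then obtain a :: 'd where a: "UNIV = {a}"
      by (rule card_1_singletonE)
    \<comment> \<open>In dimension one S is the scalar sum of the squared lengths, so the length
      constraints alone give near-Parsevality. The moment bounds, which require d >= 2, do not apply
      here.\<close>
    have sq: "(v \<bullet> w)\<^sup>2 = (norm v)\<^sup>2 * (w \<bullet> w)" for v w :: "real^'d"
      unfolding power2_norm_eq_inner inner_vec_def a by (simp add: power2_eq_square mult_ac)
    have "x \<in> nearly_ENP_frames \<epsilon> n" if x: "x \<in> space ?P" "\<forall>i<n. x i \<in> shell \<epsilon> n" for x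
    proof (rule nearly_ENP_framesI[OF space[OF x(1)] _ \<epsilon>(2)])
      fix w :: "real^'d"
      have S: "(frame_operator n x *v w) \<bullet> w = (\<Sum>i<n. (norm (x i))\<^sup>2) * (w \<bullet> w)"
        by (simp add: frame_operator_inner power2_eq_square[symmetric] sq sum_distrib_right)
      have "(\<Sum>i<n. (1 - \<epsilon>) * (1 / real n)) \<le> (\<Sum>i<n. (norm (x i))\<^sup>2)"
        using x(2) 1 by (intro sum_mono) (simp add: shell_def)
      then show "(1 - \<epsilon>) * (w \<bullet> w) \<le> (frame_operator n x *v w) \<bullet> w"
        unfolding S using n by (intro mult_right_mono) auto
      have "(\<Sum>i<n. (norm (x i))\<^sup>2) \<le> (\<Sum>i<n. (1 + \<epsilon>) * (1 / real n))"
        using x(2) 1 by (intro sum_mono) (simp add: shell_def)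
      then show "(frame_operator n x *v w) \<bullet> w \<le> (1 + \<epsilon>) * (w \<bullet> w)"
        unfolding S using n by (intro mult_right_mono) auto
    qed (use x in auto)
    then have "AE x in ?P. x \<in> nearly_ENP_frames \<epsilon> n"
      using shell by (auto elim: AE_mp)
    then have "P.prob (nearly_ENP_frames \<epsilon> n) = 1"
      by (simp add: P.prob_eq_1)
    then show ?thesis by simp
  next
    case d: 2
    then have d2: "2 \<le> ?d" by simp
    define E where "E = real n * \<epsilon> ^ 4 / (2 * ?d ^ 3)"
    have E: "ln (2 * ?d) \<le> E" using large by (simp add: E_def)
    \<comment> \<open>For d >= 2 the hypothesis gives E >= ln 4 >= 4/3.\<close>
    have "4 / 3 \<le> 2 * ln (2 :: real)" using ln2_ge_two_thirds by simp
    also have "\<dots> = ln (2 * 2)" by (subst ln_mult) auto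
    also have "\<dots> \<le> ln (2 * ?d)" using d2 by (subst ln_le_cancel_iff) auto
    finally have E43: "4 / 3 \<le> E" using E by linarith
    define c where "c = (\<integral>x. (norm x)\<^sup>2 \<partial>?M) / ?d"
    let ?U = "{x \<in> space ?P. (\<Sum>i<n. outer (x i)) \<notin> quadratic_form_le (1 + \<epsilon>)}"
    let ?L = "{x \<in> space ?P. \<epsilon> \<le> norm ((\<Sum>i<n. outer (x i)) - (real n * c) *\<^sub>R mat 1)}"
    have [measurable]: "?U \<in> sets ?P" "?L \<in> sets ?P"
      by measurable
    have "P.prob ?U \<le> ?d * exp (- E)"
      using frame_operator_upper_tail[where 'd = 'd, OF \<epsilon> n d]
      by (simp add: P.emeasure_eq_measure E_def)
    also have "\<dots> \<le> ?d * exp (- ln (2 * ?d))"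
      using E by (intro mult_left_mono) auto
    also have "\<dots> = 1 / 2"
      using d2 by (simp add: exp_minus)
    finally have U: "P.prob ?U \<le> 1 / 2" .
    have "P.prob ?L \<le> 4 * ?d ^ 3 / ((?d + 2) * real n * \<epsilon>\<^sup>2)"
      using frame_operator_lower_tail(1)[where 'd = 'd, OF \<epsilon> n d]
      by (simp add: P.emeasure_eq_measure c_def add.commute)
    \<comment> \<open>Eliminates n in favour of E; then d + 2 >= 4, E >= 4/3 and \<epsilon> <= 1
      give 3/8.\<close>
    also have "\<dots> = 2 * \<epsilon>\<^sup>2 / ((?d + 2) * E)"
    proof (subst frac_eq_eq)
      have nE: "real n * \<epsilon> ^ 4 = 2 * ?d ^ 3 * E" by (simp add: E_def)
      have "4 * ?d ^ 3 * ((?d + 2) * E) = 2 * (?d + 2) * (2 * ?d ^ 3 * E)" by simp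
      also have "\<dots> = 2 * \<epsilon>\<^sup>2 * ((?d + 2) * real n * \<epsilon>\<^sup>2)"
        unfolding nE[symmetric] by (simp add: power4_eq_xxxx power2_eq_square)
      finally show "4 * ?d ^ 3 * ((?d + 2) * E) = 2 * \<epsilon>\<^sup>2 * ((?d + 2) * real n * \<epsilon>\<^sup>2)" .
      have "0 < ?d + 2" using d2 by linarith
      then show "(?d + 2) * real n * \<epsilon>\<^sup>2 \<noteq> 0" "(?d + 2) * E \<noteq> 0"
        using \<epsilon> n E43 by auto
    qed
    also have "\<dots> \<le> 2 * 1 / (4 * (4 / 3))"
      using \<epsilon> d2 E43 by (intro frac_le mult_mono power_le_one) (auto simp: abs_square_le_1)
    finally have L: "P.prob ?L \<le> 3 / 8" by simp
    have sub: "x \<in> nearly_ENP_frames \<epsilon> n"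
      if x: "x \<in> space ?P" "x \<notin> ?U" "x \<notin> ?L" "\<forall>i<n. x i \<in> shell \<epsilon> n" for x
    proof (rule nearly_ENP_framesI[OF space[OF x(1)] _ \<epsilon>(2)])
      let ?S = "\<Sum>i<n. outer (x i)"
      have S: "frame_operator n x = ?S" by (rule frame_operator_eq_sum_outer)
      fix w :: "real^'d"
      show "(frame_operator n x *v w) \<bullet> w \<le> (1 + \<epsilon>) * (w \<bullet> w)"
        using x(1,2) by (simp add: S quadratic_form_le_def)
      let ?T = "?S - (real n * c) *\<^sub>R mat 1"
      have "\<bar>(?T *v w) \<bullet> w\<bar> \<le> norm (?T *v w) * norm w"
        by (rule Cauchy_Schwarz_ineq2)
      also have "\<dots> \<le> (norm ?T * norm w) * norm w"
        by (intro mult_right_mono norm_matrix_vector_mult_le) auto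
      also have "\<dots> \<le> (\<epsilon> * norm w) * norm w"
        using x(1,3) by (intro mult_right_mono) auto
      also have "\<dots> = \<epsilon> * (w \<bullet> w)"
        by (simp add: dot_square_norm power2_eq_square)
      finally have "(?S *v w) \<bullet> w \<ge> (real n * c) * (w \<bullet> w) - \<epsilon> * (w \<bullet> w)"
        by (simp add: matrix_vector_mult_diff_rdistrib scaleR_matrix_vector_assoc[symmetric] inner_diff_left)
      moreover have "1 * (w \<bullet> w) \<le> (real n * c) * (w \<bullet> w)"
        using frame_operator_lower_tail(2)[where 'd = 'd, OF \<epsilon> n d]
        by (intro mult_right_mono) (auto simp: c_def)
      ultimately show "(1 - \<epsilon>) * (w \<bullet> w) \<le> (frame_operator n x *v w) \<bullet> w"
        by (simp add: S algebra_simps)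
    qed (use x in auto)
    have "1 = P.prob (space ?P)" by (simp add: P.prob_space)
    also have "\<dots> \<le> P.prob (nearly_ENP_frames \<epsilon> n \<union> (?U \<union> ?L))"
    proof (rule P.finite_measure_mono_AE)
      show "AE x in ?P. x \<in> space ?P \<longrightarrow> x \<in> nearly_ENP_frames \<epsilon> n \<union> (?U \<union> ?L)"
        using shell
      proof eventually_elim
        case (elim x)
        then show ?case using sub[of x] by blast
      qed
    qed measurable
    also have "\<dots> \<le> P.prob (nearly_ENP_frames \<epsilon> n) + P.prob (?U \<union> ?L)"
      by (intro measure_Un_le) measurable
    also have "P.prob (?U \<union> ?L) \<le> P.prob ?U + P.prob ?L"
      by (intro measure_Un_le) measurable
    finally show ?thesis using U L by linarith
  qed
qed

theorem theorem4p3: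
  fixes \<epsilon> :: real and d n :: nat
  assumes "d = CARD('d::finite)" and "0 < \<epsilon>" and "\<epsilon> < 1"
    and denominator_pos:
      "0 < 1 - 2 * real d * exp (- (6 * \<epsilon>\<^sup>2 * real n) / (5 * (real d + 2)\<^sup>2))"
  shows "\<P>(x in (nearly_ENP_measure \<epsilon> n :: (nat \<Rightarrow> real^'d) measure).
           (INF y\<in>ENP_frames n. (frame_dist n x y)\<^sup>2) \<le> (sqrt 20 + sqrt 2)\<^sup>2 * \<epsilon>\<^sup>2 * d)
         \<ge> 1 - 2 * real d * exp (- (real n * \<epsilon> ^ 4) / (2 * real d ^ 3)) /
               (1 - 2 * real d * exp (- (6 * \<epsilon>\<^sup>2 * real n) / (5 * (real d + 2)\<^sup>2)))"
proof -
  note \<epsilon> = assms(2,3)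
  define a where "a = 2 * real d * exp (- (real n * \<epsilon> ^ 4) / (2 * real d ^ 3))"
  define D where "D = 1 - 2 * real d * exp (- (6 * \<epsilon>\<^sup>2 * real n) / (5 * (real d + 2)\<^sup>2))"
  have D: "0 < D" "D \<le> 1" using denominator_pos by (simp_all add: D_def)
  define Q where "Q x \<longleftrightarrow> (INF y\<in>ENP_frames n. (frame_dist n x y)\<^sup>2) \<le> (sqrt 20 + sqrt 2)\<^sup>2 * \<epsilon>\<^sup>2 * d"
    for x :: "nat \<Rightarrow> real^'d"
  have "1 - a / D \<le> \<P>(x in nearly_ENP_measure \<epsilon> n. Q x)"
  proof (cases "1 \<le> a / D")
    \<comment> \<open>A nonpositive lower bound holds for every probability.\<close>
    case True
    then show ?thesis
      using measure_nonneg[of "nearly_ENP_measure \<epsilon> n"] by (smt (verit))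
  next
    case False
    then have "a < D" using D by (simp add: divide_le_eq)
    \<comment> \<open>This places the parameters in the regime E > ln (2 d).\<close>
    then have a1: "a < 1" using D by linarith
    define E where "E = real n * \<epsilon> ^ 4 / (2 * real d ^ 3)"
    have aE: "a = 2 * real d * exp (- E)" by (simp add: a_def E_def)
    have d1: "1 \<le> real d" using assms(1) by (simp add: Suc_le_eq)
    have "2 * real d < exp E"
      using a1 by (simp add: aE exp_minus field_simps)
    then have "ln (2 * real d) < ln (exp E)"
      using d1 by (subst ln_less_cancel_iff) auto
    then have E: "ln (2 * real d) < E" by simp
    have "2 / 3 \<le> ln (2 :: real)" by (rule ln2_ge_two_thirds)
    also have "\<dots> \<le> ln (2 * real d)" using d1 by (subst ln_le_cancel_iff) auto
    finally have E23: "2 / 3 < E" using E by linarith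
    have nE: "real n * \<epsilon> ^ 4 = 2 * real d ^ 3 * E"
      using d1 by (simp add: E_def)
    \<comment> \<open>The chain d <= d^3 < 2 E d^3 = n \<epsilon>^4 <= n uses E > 2/3 > 1/2; the
      minimisation of the potential needs the strict inequality.\<close>
    have dn: "d < n"
    proof -
      have "real d \<le> real d ^ 3"
        using power_increasing[of 1 3 "real d"] d1 by simp
      also have "\<dots> < real d ^ 3 * (2 * E)"
        using mult_strict_left_mono[of 1 "2 * E" "real d ^ 3"] E23 d1 by simp
      also have "\<dots> = real n * \<epsilon> ^ 4" by (simp add: nE)
      also have "\<dots> \<le> real n * 1"
        using \<epsilon> by (intro mult_left_mono power_le_one) auto
      finally show ?thesis by simp
    qed
    then have n: "0 < n" by simp
    let ?M = "shell_measure \<epsilon> n :: (real^'d) measure"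
    let ?P = "\<Pi>\<^sub>M i\<in>{..<n}. ?M"
    let ?B = "nearly_ENP_frames \<epsilon> n :: (nat \<Rightarrow> real^'d) set"
    interpret P: prob_space ?P
      using prob_space_shell_measure[OF \<epsilon> n] by (intro prob_space_PiM)
    have B [measurable]: "?B \<in> sets ?P"
      using nearly_ENP_frames_measurable[OF \<epsilon>(2)] .
    have pB: "1 / 8 \<le> P.prob ?B"
      using prob_nearly_ENP_frames_ge[where 'd = 'd, OF \<epsilon> n] E assms(1) by (simp add: E_def)
    define QS where "QS = {x \<in> space ?P. Q x}"
    have QS [measurable]: "QS \<in> sets ?P"
      unfolding QS_def Q_def by (intro INF_frame_dist_measurable) simp
    define t where "t = 10 * \<epsilon>\<^sup>2 / sqrt (real d)"
    let ?A = "{x \<in> space ?P. t \<le> norm (gram_deviation n (\<lambda>i. (1 / norm (x i)) *\<^sub>R x i))}"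
    have A [measurable]: "?A \<in> sets ?P"
      unfolding gram_deviation_def by measurable
    have "real n * t\<^sup>2 / (8 * (real d)\<^sup>2) = 25 * E"
      using d1 by (simp add: t_def E_def power_divide power_mult_distrib power2_eq_square power3_eq_cube
          power4_eq_xxxx field_simps)
    then have pA: "P.prob ?A \<le> 2 * exp (- (25 * E))"
      using gram_deviation_concentration[where 'd = 'd, OF \<epsilon> n, of t] assms(1) \<epsilon>
      by (simp add: P.emeasure_eq_measure t_def)
    have "?B \<subseteq> QS \<union> ?A"
    proof
      fix x assume x: "x \<in> ?B"
      then have space: "x \<in> space ?P"
        using sets.sets_into_space[OF B] by blast
      show "x \<in> QS \<union> ?A"
      proof (cases "x \<in> ?A")
        case False
        have "\<And>i. i < n \<Longrightarrow> x i \<in> shell \<epsilon> n"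
          using x by (simp add: nearly_ENP_frames_def nearly_equal_norm_def)
        then obtain y where y: "y \<in> ENP_frames n"
          "frame_dist n x y < (sqrt 20 + sqrt 2) * \<epsilon> * sqrt (real d)"
          using exists_ENP_frame_close[of n \<epsilon> x] dn \<epsilon> False space assms(1) by (auto simp: t_def)
        have "(INF y\<in>ENP_frames n. (frame_dist n x y)\<^sup>2) \<le> (frame_dist n x y)\<^sup>2"
          using y(1) by (intro cINF_lower bdd_belowI[of _ 0]) auto
        also have "\<dots> \<le> ((sqrt 20 + sqrt 2) * \<epsilon> * sqrt (real d))\<^sup>2"
          using y(2) by (intro power_mono) (auto simp: frame_dist_nonneg)
        also have "\<dots> = (sqrt 20 + sqrt 2)\<^sup>2 * \<epsilon>\<^sup>2 * d"
          by (simp add: power_mult_distrib)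
        finally show ?thesis using space by (simp add: QS_def Q_def)
      qed simp
    qed
    then have "?B \<subseteq> (?B \<inter> QS) \<union> ?A" by blast
    then have "P.prob ?B \<le> P.prob ((?B \<inter> QS) \<union> ?A)"
      by (intro P.finite_measure_mono) auto
    also have "\<dots> \<le> P.prob (?B \<inter> QS) + P.prob ?A"
      by (intro measure_Un_le) auto
    finally have le: "P.prob ?B - P.prob ?A \<le> P.prob (?B \<inter> QS)" by simp
    \<comment> \<open>Conditioning on the nearly equal-norm Parseval frames costs at most a factor
      8.\<close>
    have "P.prob ?A / P.prob ?B \<le> (2 * exp (- (25 * E))) / (1 / 8)"
      using pA pB by (intro frac_le) auto
    also have "\<dots> \<le> a"
    proof -
      \<comment> \<open>The quantity to bound is 16 exp (- 25 E), against 2 d exp (- E); the surplus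
        exp (24 E) absorbs the remaining factor 8.\<close>
      have "8 \<le> 1 + 24 * E" using E23 by simp
      also have "\<dots> \<le> exp (24 * E)" by (rule exp_ge_add_one_self)
      finally have "8 * exp (- (25 * E)) \<le> exp (24 * E) * exp (- (25 * E))"
        by (intro mult_right_mono) auto
      also have "\<dots> = exp (- E)" by (simp add: exp_add[symmetric])
      also have "\<dots> \<le> real d * exp (- E)" using d1 by simp
      finally show ?thesis by (simp add: aE)
    qed
    also have "\<dots> \<le> a / D"
      using D by (simp add: aE le_divide_eq mult_left_le)
    finally have "1 - a / D \<le> 1 - P.prob ?A / P.prob ?B" by simp
    also have "\<dots> = (P.prob ?B - P.prob ?A) / P.prob ?B"
      using pB by (simp add: diff_divide_distrib)
    also have "\<dots> \<le> P.prob (?B \<inter> QS) / P.prob ?B"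
      using le by (rule divide_right_mono) simp
    also have "\<dots> = measure (uniform_measure ?P ?B) QS"
      using pB by (intro measure_uniform_measure[symmetric]) (auto simp: P.emeasure_eq_measure QS)
    also have "\<dots> = \<P>(x in nearly_ENP_measure \<epsilon> n. Q x)"
      by (simp add: nearly_ENP_measure_def QS_def)
    finally show ?thesis .
  qed
  then show ?thesis
    by (simp only: a_def D_def Q_def)
qed

end
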